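(* Identify $\mathbb{R}^4$ with $\mathbb{C}^2$ with coordinates $z_1=x_1+iy_1$, $z_2=x_2+iy_2$ (real coordinates ordered $(x_1,y_1,x_2,y_2)$). Let $J$ be a smooth almost complex structure defined on $\mathbb{R}^4$ which, in a neighborhood of the origin, has the block-diagonal form $$J=\begin{pmatrix} a_1& b_1 & 0 & 0 \\ c_1 & -a_1 & 0 & 0\\ 0 & 0 & a_2 & b_2\\ 0 & 0 & c_2 & -a_2 \end{pmatrix}=J_{st}+O(|z_2|),$$ where $a_1,b_1,c_1,a_2,b_2,c_2$ are smooth real functions and $J_{st}$ is the standard complex structure of $\mathbb{C}^2$. Let $D=\{\rho<0\}$ be a domain of finite type in $(\mathbb{R}^4,J)$, where $\rho$ is a smooth defining function of $D$ which is $J$-plurisubharmonic in a neighborhood of $\overline{D}$, and assume that near the origin $$\rho=\operatorname{Re} z_2+H_{2m}(z_1,\overline{z_1})+O\left(|z_1|^{2m+1}+|z_2||z_1|^m+|z_2|^2\right),$$ where $m\ge 1$ is an integer and $H_{2m}$ is a homogeneous real polynomial of degree $2m$ in $(z_1,\overline{z_1})$ which is subharmonic but not harmonic (in particular $0\in\partial D$). Then there exists a neighborhood $U$ of the origin such that the origin is at infinite Kobayashi distance from points in $D\cap U$: for every $q\in D\cap U$ and every sequence $q_j\in D$ converging to $0$, the Kobayashi distances $d_{(D,J)}(q_j,q)$ are unbounded.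
   Context: A map $u:\Delta\to(M,J)$ from the unit disc $\Delta\subset\mathbb{C}$ is a $J$-holomorphic (pseudoholomorphic) disc if $J(u)\circ du=du\circ J_{st}$, i.e. $\partial u/\partial y=J(u)\,\partial u/\partial x$. For a $\mathcal{C}^2$ real function $\rho$, set $d^c_J\rho(v)=-d\rho(Jv)$; the Levi form is $\mathcal{L}_J\rho(p,v)=dd^c_J\rho(p)(v,J(p)v)$, and $\rho$ is $J$-plurisubharmonic if $\mathcal{L}_J\rho(p,v)\ge0$ for all $p,v$ (equivalently, $\rho\circ u$ is subharmonic for every $J$-holomorphic disc $u$). For a $J$-holomorphic disc $u$ with $u(0)=p\in\partial D$, the order of contact $\delta_p(\partial D,u)$ is the degree of the first nonzero term in the Taylor expansion of $\rho\circ u$ at $0$, and $\delta(u)$ is the multiplicity of $u$ at $0$; the (D'Angelo) type of $\partial D$ at $p$ is $\sup\{\delta_p(\partial D,u)/\delta(u)\}$ over nonconstant $J$-holomorphic discs $u$ with $u(0)=p$, and $D$ is of finite type if this is finite at every boundary point. The Kobayashi pseudometric of $(D,J)$ is $K_{(D,J)}(p,v)=\inf\{1/r>0:\ \exists\, u:\Delta\to D$ $J$-holomorphic, $u(0)=p$, $d_0u(\partial/\partial x)=rv\}$, and $d_{(D,J)}(p,q)$ is the infimum of $\int_0^1K_{(D,J)}(\gamma(t),\dot\gamma(t))\,dt$ over piecewise $\mathcal{C}^1$ paths $\gamma$ in $D$ from $p$ to $q$. A boundary point $p$ is at finite distance from $q\in D$ if there is a sequence $q_j\in D$ converging to $p$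 with $d_{(D,J)}(q_j,q)$ bounded; otherwise it is at infinite distance. *)

theory Defs
  imports "HOL-Analysis.Analysis" "HOL-Library.Landau_Symbols"
begin

text \<open>R^4 is identified with C^2 = complex \<times> complex; a point p has z1 = fst p, z2 = snd p,
  real coordinates (Re z1, Im z1, Re z2, Im z2).\<close>

type_synonym c2 = "complex \<times> complex"

fun Ck :: "nat \<Rightarrow> 'a::euclidean_space set \<Rightarrow> ('a \<Rightarrow> 'b::real_normed_vector) \<Rightarrow> bool" where
  "Ck 0 U f = continuous_on U f"
| "Ck (Suc k) U f = (f differentiable_on U \<and>
      (\<forall>i\<in>Basis. Ck k U (\<lambda>x. frechet_derivative f (at x) i)))"

definition smooth_on :: "'a::euclidean_space set \<Rightarrow> ('a \<Rightarrow> 'b::real_normed_vector) \<Rightarrow> bool" where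
  "smooth_on U f \<longleftrightarrow> (\<forall>k. Ck k U f)"

definition almost_complex_structure :: "(c2 \<Rightarrow> c2 \<Rightarrow> c2) \<Rightarrow> bool" where
  "almost_complex_structure J \<longleftrightarrow>
     (\<forall>p. linear (J p) \<and> (\<forall>v. J p (J p v) = - v)) \<and> (\<forall>v. smooth_on UNIV (\<lambda>p. J p v))"

text \<open>The 2x2 real block [[a, b], [c, -a]] acting on w = x + iy as the vector (x, y).\<close>
definition blk :: "(c2 \<Rightarrow> real) \<Rightarrow> (c2 \<Rightarrow> real) \<Rightarrow> (c2 \<Rightarrow> real) \<Rightarrow> c2 \<Rightarrow> complex \<Rightarrow> complex" where
  "blk a b c p w = Complex (a p * Re w + b p * Im w) (c p * Re w - a p * Im w)"

definition J_hol_disc :: "(c2 \<Rightarrow> c2 \<Rightarrow> c2) \<Rightarrow> (complex \<Rightarrow> c2) \<Rightarrow> bool" where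
  "J_hol_disc J u \<longleftrightarrow> Ck 1 (ball 0 1) u \<and>
     (\<forall>z\<in>ball 0 1. frechet_derivative u (at z) \<i> = J (u z) (frechet_derivative u (at z) 1))"

text \<open>Levi form: dd^c_J rho (p)(v, J(p) v), with d^c_J rho (w) = - d rho (J w);
  d of a 1-form alpha on constant vector fields X, Y is X(alpha Y) - Y(alpha X).\<close>
definition levi_form :: "(c2 \<Rightarrow> c2 \<Rightarrow> c2) \<Rightarrow> (c2 \<Rightarrow> real) \<Rightarrow> c2 \<Rightarrow> c2 \<Rightarrow> real" where
  "levi_form J \<rho> p v =
     (let w = J p v;
          dc = (\<lambda>y x. - frechet_derivative \<rho> (at x) (J x y))
      in frechet_derivative (dc w) (at p) v - frechet_derivative (dc v) (at p) w)"

definition vanish_ord :: "(complex \<Rightarrow> 'b::real_normed_vector) \<Rightarrow> enat" where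
  "vanish_ord f = Sup {enat k | k. (\<lambda>z. norm (f z)) \<in> bigo (at 0) (\<lambda>z. norm z ^ k)}"

definition dangelo_type :: "(c2 \<Rightarrow> c2 \<Rightarrow> c2) \<Rightarrow> (c2 \<Rightarrow> real) \<Rightarrow> c2 \<Rightarrow> ereal" where
  "dangelo_type J \<rho> p =
     (SUP u \<in> {u. J_hol_disc J u \<and> u 0 = p \<and> \<not> (\<forall>z\<in>ball 0 1. u z = p)}.
        ereal_of_enat (vanish_ord (\<lambda>z. \<rho> (u z))) / ereal_of_enat (vanish_ord (\<lambda>z. u z - p)))"

definition finite_type :: "(c2 \<Rightarrow> c2 \<Rightarrow> c2) \<Rightarrow> (c2 \<Rightarrow> real) \<Rightarrow> c2 set \<Rightarrow> bool" where
  "finite_type J \<rho> D \<longleftrightarrow> (\<forall>p\<in>frontier D. dangelo_type J \<rho> p < \<infinity>)"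

text \<open>Kobayashi pseudometric (infimum of the empty set is +infinity).\<close>
definition kob_metric :: "(c2 \<Rightarrow> c2 \<Rightarrow> c2) \<Rightarrow> c2 set \<Rightarrow> c2 \<Rightarrow> c2 \<Rightarrow> ennreal" where
  "kob_metric J D p v =
     (INF r \<in> {r::real. r > 0 \<and> (\<exists>u. J_hol_disc J u \<and> u ` ball 0 1 \<subseteq> D \<and> u 0 = p \<and>
                      frechet_derivative u (at 0) 1 = r *\<^sub>R v)}. ennreal (1 / r))"

definition kob_dist :: "(c2 \<Rightarrow> c2 \<Rightarrow> c2) \<Rightarrow> c2 set \<Rightarrow> c2 \<Rightarrow> c2 \<Rightarrow> ennreal" where
  "kob_dist J D p q =
     (INF \<gamma> \<in> {\<gamma>. \<gamma> piecewise_C1_differentiable_on {0..1} \<and> \<gamma> 0 = p \<and> \<gamma> 1 = q \<and> \<gamma> ` {0..1} \<subseteq> D}.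
        (\<integral>\<^sup>+ t \<in> {0..1}. kob_metric J D (\<gamma> t) (vector_derivative \<gamma> (at t)) \<partial>lborel))"

definition hpoly :: "(nat \<Rightarrow> real) \<Rightarrow> nat \<Rightarrow> complex \<Rightarrow> real" where
  "hpoly c n z = (\<Sum>j\<le>n. c j * Re z ^ j * Im z ^ (n - j))"

definition laplacian :: "(complex \<Rightarrow> real) \<Rightarrow> complex \<Rightarrow> real" where
  "laplacian f z = deriv (deriv (\<lambda>t. f (z + of_real t))) 0
                 + deriv (deriv (\<lambda>t. f (z + \<i> * of_real t))) 0"

end

theory Submission
  imports Defs
begin

text \<open>
  Let \<open>qnorm p = |z\<^sub>1|\<^sup>4\<^sup>m + |z\<^sub>2|\<^sup>2\<close>. The point is that \<open>ln qnorm\<close> is Lipschitz for the Kobayashi metric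
  near the origin, and it tends to \<open>-\<infinity>\<close> there. For this, a disc with \<open>u 0 = p\<close> is rescaled
  by the dilation \<open>(z\<^sub>1 / t, z\<^sub>2 / t\<^sup>2\<^sup>m)\<close>, \<open>t\<^sup>4\<^sup>m = qnorm p\<close>: because \<open>J\<close> is block diagonal and equals \<open>J\<^sub>s\<^sub>t\<close>
  on \<open>z\<^sub>2 = 0\<close>, the rescaled structures are \<open>C\<^sup>1\<close>-close to \<open>J\<^sub>s\<^sub>t\<close>, and the rescaled domains are close to
  the model \<open>Re z\<^sub>2 + H(z\<^sub>1) < 0\<close>. It remains to bound the derivative at \<open>0\<close> of the rescaled disc, which
  is done by Sibony's method: with a polynomially growing, strictly plurisubharmonic barrier \<open>phi\<close>
  (built from a bumping of \<open>H\<close>) the function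
  \<open>ln |z - p|\<^sup>2 + (correction) + B * max phi (-M)\<close>, cut off away from \<open>p\<close>, is plurisubharmonic,
  and the maximum principle is applied to its composition with the disc minus \<open>2 ln |\<zeta>|\<close>.
  Discs are only of class \<open>C\<^sup>1\<close>, so the maximum principle is based on the flux of the gradient
  through small circles instead of second derivatives.
\<close>

text \<open>Conjugation by the dilation leaves the blocks of a block diagonal matrix unchanged and
  only moves the point of evaluation; an entry from the \<open>z1\<close> to the \<open>z2\<close>
  direction would be multiplied by \<open>t ^ (1 - 2*m)\<close>. Closeness in C1 is needed because
  the Laplacian of a disc is quadratic in its differential, with coefficients from the derivative of
  the structure. The function \<open>ln |z - p|^2\<close> is plurisubharmonic for the structure
  frozen at \<open>p\<close>; freezing costs a small multiple of \<open>1 / |z - p|\<close>, which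
  the Laplacian of the correction \<open>4 * |z - p|\<close> dominates. The remaining loss is a
  multiple of the squared differential, paid for by \<open>B\<close> times the strict positivity of
  \<open>phi\<close>. A disc may leave every region where \<open>J\<close> is controlled: the
  cut-off is constant there, and the barrier lies below \<open>-M\<close> on the shell in between.
  The pole at the centre is weakened to \<open>2 c ln |zeta|\<close> with \<open>c < 1\<close>, so
  that the exponential of the test function tends to 0 there; \<open>c\<close> tends to 1 at the
  end. All constants are fixed before the dilation parameter, and the final one involves only
  \<open>kappa\<close> and \<open>M\<close>.\<close>

subsection \<open>Pointwise Laplacian of maps of class C1\<close>

abbreviation circ :: "complex \<Rightarrow> real \<Rightarrow> real \<Rightarrow> complex" where
  "circ z r t \<equiv> z + of_real r * cis t"

lemma dist_circ [simp]: "dist z (circ z r t) = \<bar>r\<bar>"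
  by (simp add: dist_norm norm_mult)

text \<open>\<open>\<Phi>\<close> is differentiated at \<open>z\<close> alone and
  \<open>\<psi>\<close> is only continuous: the first-order expansion of the increment of
  \<open>\<Phi>\<close> absorbs the division by \<open>r\<close>, while the weight is frozen at the
  centre. This replaces second derivatives of the disc: \<open>\<psi>\<close> will be a component of
  its gradient and \<open>\<Phi>\<close> a coefficient evaluated along it.\<close>

lemma circ_weighted_limit:
  fixes \<Phi> :: "complex \<Rightarrow> 'b::euclidean_space" and \<psi> :: "complex \<Rightarrow> real"
  assumes d: "d > 0" and der: "(\<Phi> has_derivative \<Phi>') (at z)"
    and cont: "continuous_on (ball z d) \<Phi>" "continuous_on (ball z d) \<psi>"
    and g: "continuous_on UNIV g" "\<And>t. \<bar>g t\<bar> \<le> 1"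
  shows "((\<lambda>r. integral {0..2*pi} (\<lambda>t. (g t * \<psi> (circ z r t)) *\<^sub>R (\<Phi> (circ z r t) - \<Phi> z)) /\<^sub>R r)
     \<longlongrightarrow> \<psi> z *\<^sub>R integral {0..2*pi} (\<lambda>t. g t *\<^sub>R \<Phi>' (cis t))) (at_right 0)"
proof -
  have lin: "bounded_linear \<Phi>'" using der has_derivative_bounded_linear by blast
  obtain K where K: "K > 0" "\<And>h. norm (\<Phi>' h) \<le> norm h * K"
    using bounded_linear.pos_bounded[OF lin] by blast
  define I where "I = (\<lambda>t. (\<psi> z * g t) *\<^sub>R \<Phi>' (cis t))"
  have Icont: "continuous_on {0..2*pi} I"
    unfolding I_def
    by (intro continuous_intros continuous_on_subset[OF g(1)] bounded_linear.continuous_on[OF lin]) auto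
  have "((\<lambda>r. integral {0..2*pi} (\<lambda>t. (g t * \<psi> (circ z r t)) *\<^sub>R (\<Phi> (circ z r t) - \<Phi> z)) /\<^sub>R r)
     \<longlongrightarrow> integral {0..2*pi} I) (at_right 0)"
  proof (rule tendstoI)
    fix e :: real assume e: "e > 0"
    \<comment> \<open>The pointwise error will be at most \<open>e1\<close> times the bracket;
      \<open>4 * pi\<close> is twice the length of the interval, which leaves strict room.\<close>
    define e1 where "e1 = min 1 (e / (4 * pi * (K + \<bar>\<psi> z\<bar> + 2)))"
    have e1: "e1 > 0" "e1 \<le> 1" unfolding e1_def using e K by (auto intro!: divide_pos_pos mult_pos_pos add_pos_nonneg)
    have e1b: "e1 * (K + \<bar>\<psi> z\<bar> + 2) * (2*pi) < e"
    proof -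
      have "e1 \<le> e / (4 * pi * (K + \<bar>\<psi> z\<bar> + 2))" unfolding e1_def by simp
      moreover have "4 * pi * (K + \<bar>\<psi> z\<bar> + 2) > 0" using K by (auto intro!: mult_pos_pos add_pos_nonneg)
      ultimately have "e1 * (4 * pi * (K + \<bar>\<psi> z\<bar> + 2)) \<le> e" by (simp add: pos_le_divide_eq)
      moreover have "e1 * (K + \<bar>\<psi> z\<bar> + 2) * (2*pi) = e1 * (4 * pi * (K + \<bar>\<psi> z\<bar> + 2)) / 2" by simp
      ultimately show ?thesis using e by linarith
    qed
    obtain d1 where d1: "d1 > 0" "\<And>y. norm (y - z) < d1 \<Longrightarrow> norm (\<Phi> y - \<Phi> z - \<Phi>' (y - z)) \<le> e1 * norm (y - z)"
      using der e1(1) unfolding has_derivative_at_alt by blast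
    have "isCont \<psi> z" using cont(2) d by (simp add: continuous_on_eq_continuous_at)
    then obtain d2 where d2: "d2 > 0" "\<And>y. dist y z < d2 \<Longrightarrow> dist (\<psi> y) (\<psi> z) < e1"
      using e1(1) unfolding continuous_at_eps_delta by blast
    have "dist (integral {0..2*pi} (\<lambda>t. (g t * \<psi> (circ z r t)) *\<^sub>R (\<Phi> (circ z r t) - \<Phi> z)) /\<^sub>R r) (integral {0..2*pi} I) < e"
      if r: "r > 0" "r < min d (min d1 d2)" for r
    proof -
      define J where "J = (\<lambda>t. inverse r *\<^sub>R ((g t * \<psi> (circ z r t)) *\<^sub>R (\<Phi> (circ z r t) - \<Phi> z)))"
      have inb: "circ z r t \<in> ball z d" for t using r by simp
      have Jc: "continuous_on {0..2*pi} J"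
        unfolding J_def
        by (intro continuous_intros continuous_on_subset[OF g(1)]
             continuous_on_compose2[OF cont(1)] continuous_on_compose2[OF cont(2)]) (use inb in auto)
      have pt: "norm (J t - I t) \<le> e1 * (K + \<bar>\<psi> z\<bar> + 2)" for t
      proof -
        define q where "q = inverse r *\<^sub>R (\<Phi> (circ z r t) - \<Phi> z)"
        have A: "norm (\<Phi> (circ z r t) - \<Phi> z - \<Phi>' (of_real r * cis t)) \<le> e1 * r"
          using d1(2)[of "circ z r t"] r by (simp add: norm_mult)
        have "\<Phi>' (of_real r * cis t) = r *\<^sub>R \<Phi>' (cis t)"
          using lin by (metis bounded_linear.linear linear_cmul scaleR_conv_of_real)
        then have "q - \<Phi>' (cis t) = inverse r *\<^sub>R (\<Phi> (circ z r t) - \<Phi> z - \<Phi>' (of_real r * cis t))"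
          using r by (simp add: q_def scaleR_diff_right)
        then have "norm (q - \<Phi>' (cis t)) = inverse r * norm (\<Phi> (circ z r t) - \<Phi> z - \<Phi>' (of_real r * cis t))"
          using r by (simp only: norm_scaleR) simp
        also have "\<dots> \<le> inverse r * (e1 * r)" using A r by (intro mult_left_mono) auto
        finally have q1: "norm (q - \<Phi>' (cis t)) \<le> e1" using r by (simp add: field_simps)
        have q2: "norm (\<Phi>' (cis t)) \<le> K" using K(2)[of "cis t"] by simp
        have p1: "\<bar>\<psi> (circ z r t) - \<psi> z\<bar> \<le> e1" using d2(2)[of "circ z r t"] r
          by (simp add: dist_norm norm_mult)
        have eq: "J t - I t = (g t * (\<psi> (circ z r t) - \<psi> z)) *\<^sub>R q + (g t * \<psi> z) *\<^sub>R (q - \<Phi>' (cis t))"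
          unfolding J_def I_def q_def by (simp add: algebra_simps)
        have nq: "norm q \<le> K + 1"
          using norm_triangle_ineq[of "q - \<Phi>' (cis t)" "\<Phi>' (cis t)"] q1 q2 e1 by simp
        have "norm (J t - I t) \<le> \<bar>g t\<bar> * \<bar>\<psi> (circ z r t) - \<psi> z\<bar> * norm q + \<bar>g t\<bar> * \<bar>\<psi> z\<bar> * norm (q - \<Phi>' (cis t))"
          unfolding eq by (rule norm_triangle_le) (simp add: abs_mult)
        also have "\<dots> \<le> 1 * e1 * (K+1) + 1 * \<bar>\<psi> z\<bar> * e1"
          by (intro add_mono mult_mono) (use g(2) p1 q1 nq e1 K in auto)
        also have "\<dots> \<le> e1 * (K + \<bar>\<psi> z\<bar> + 2)" using e1 by (simp add: algebra_simps)
        finally show ?thesis .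
      qed
      have "integral {0..2*pi} (\<lambda>t. (g t * \<psi> (circ z r t)) *\<^sub>R (\<Phi> (circ z r t) - \<Phi> z)) /\<^sub>R r = integral {0..2*pi} J"
        unfolding J_def by (rule integral_cmul[symmetric])
      then have "dist (integral {0..2*pi} (\<lambda>t. (g t * \<psi> (circ z r t)) *\<^sub>R (\<Phi> (circ z r t) - \<Phi> z)) /\<^sub>R r) (integral {0..2*pi} I)
         = norm (integral {0..2*pi} (\<lambda>t. J t - I t))"
        using Jc Icont by (simp add: dist_norm Henstock_Kurzweil_Integration.integral_diff integrable_continuous_interval)
      also have "\<dots> \<le> (e1 * (K + \<bar>\<psi> z\<bar> + 2)) * (2*pi - 0)"
        by (rule integral_bound) (use pt Jc Icont in \<open>auto intro!: continuous_on_diff\<close>)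
      finally show ?thesis using e1b by simp
    qed
    then show "\<forall>\<^sub>F r in at_right 0. dist (integral {0..2*pi} (\<lambda>t. (g t * \<psi> (circ z r t)) *\<^sub>R (\<Phi> (circ z r t) - \<Phi> z)) /\<^sub>R r) (integral {0..2*pi} I) < e"
      unfolding eventually_at_right_field using d d1(1) d2(1)
      by (intro exI[of _ "min d (min d1 d2)"]) auto
  qed
  moreover have "integral {0..2*pi} I = \<psi> z *\<^sub>R integral {0..2*pi} (\<lambda>t. g t *\<^sub>R \<Phi>' (cis t))"
    unfolding I_def by (simp only: scaleR_scaleR[symmetric] integral_cmul)
  ultimately show ?thesis by simp
qed

section \<open>Circle integrals with trigonometric weights\<close>

lemma has_integral_cos2: "((\<lambda>t. cos t * cos t) has_integral pi) {0..2*pi}"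
proof -
  have "((\<lambda>t. cos t * cos t) has_integral ((2*pi + sin (2*pi) * cos (2*pi))/2 - (0 + sin 0 * cos 0)/2)) {0..2*pi}"
  proof (rule fundamental_theorem_of_calculus)
    fix x :: real
    show "((\<lambda>t. (t + sin t * cos t)/2) has_vector_derivative cos x * cos x) (at x within {0..2*pi})"
      unfolding has_real_derivative_iff_has_vector_derivative[symmetric]
      apply (rule derivative_eq_intros refl | simp)+
      using sin_cos_squared_add[of x] by (simp add: power2_eq_square)
  qed auto
  then show ?thesis by simp
qed

lemma has_integral_sin2: "((\<lambda>t. sin t * sin t) has_integral pi) {0..2*pi}"
proof -
  have "((\<lambda>t. sin t * sin t) has_integral ((2*pi - sin (2*pi) * cos (2*pi))/2 - (0 - sin 0 * cos 0)/2)) {0..2*pi}"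
  proof (rule fundamental_theorem_of_calculus)
    fix x :: real
    show "((\<lambda>t. (t - sin t * cos t)/2) has_vector_derivative sin x * sin x) (at x within {0..2*pi})"
      unfolding has_real_derivative_iff_has_vector_derivative[symmetric]
      apply (rule derivative_eq_intros refl | simp)+
      using sin_cos_squared_add[of x] by (simp add: power2_eq_square)
  qed auto
  then show ?thesis by simp
qed

lemma has_integral_sin_cos: "((\<lambda>t. sin t * cos t) has_integral 0) {0..2*pi}"
proof -
  have "((\<lambda>t. sin t * cos t) has_integral ((sin (2*pi))^2/2 - (sin 0)^2/2)) {0..2*pi}"
  proof (rule fundamental_theorem_of_calculus)
    fix x :: real
    show "((\<lambda>t. (sin t)^2/2) has_vector_derivative sin x * cos x) (at x within {0..2*pi})"
      unfolding has_real_derivative_iff_has_vector_derivative[symmetric]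
      by (rule derivative_eq_intros refl | simp)+
  qed auto
  then show ?thesis by simp
qed

lemma linear_cis:
  fixes f :: "complex \<Rightarrow> 'b::real_vector"
  assumes "linear f" shows "f (cis t) = cos t *\<^sub>R f 1 + sin t *\<^sub>R f \<i>"
proof -
  have "cis t = cos t *\<^sub>R 1 + sin t *\<^sub>R \<i>" by (simp add: complex_eq_iff)
  then show ?thesis using assms by (simp add: linear_add linear_cmul)
qed

text \<open>Orthogonality of \<open>cos\<close> and \<open>sin\<close> over a period: these weights
  extract the two partial derivatives of a real-linear map.\<close>

lemma integral_linear_cis:
  fixes f :: "complex \<Rightarrow> 'b::euclidean_space"
  assumes f: "linear f"
  shows "integral {0..2*pi} (\<lambda>t. cos t *\<^sub>R f (cis t)) = pi *\<^sub>R f 1"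
    and "integral {0..2*pi} (\<lambda>t. sin t *\<^sub>R f (cis t)) = pi *\<^sub>R f \<i>"
proof -
  have h: "((\<lambda>t. (k t) *\<^sub>R w) has_integral (I *\<^sub>R w)) {0..2*pi}" if "(k has_integral I) {0..2*pi}" for k :: "real \<Rightarrow> real" and I and w :: 'b
    using has_integral_linear[OF that bounded_linear_scaleR_left[of w]] by (simp add: o_def)
  have "((\<lambda>t. (cos t * cos t) *\<^sub>R f 1 + (sin t * cos t) *\<^sub>R f \<i>) has_integral (pi *\<^sub>R f 1 + 0 *\<^sub>R f \<i>)) {0..2*pi}"
    by (intro has_integral_add h has_integral_cos2 has_integral_sin_cos)
  then show "integral {0..2*pi} (\<lambda>t. cos t *\<^sub>R f (cis t)) = pi *\<^sub>R f 1"
    by (intro integral_unique) (simp add: linear_cis[OF f] algebra_simps)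
  have "((\<lambda>t. (sin t * cos t) *\<^sub>R f 1 + (sin t * sin t) *\<^sub>R f \<i>) has_integral (0 *\<^sub>R f 1 + pi *\<^sub>R f \<i>)) {0..2*pi}"
    by (intro has_integral_add h has_integral_sin2 has_integral_sin_cos)
  then show "integral {0..2*pi} (\<lambda>t. sin t *\<^sub>R f (cis t)) = pi *\<^sub>R f \<i>"
    by (intro integral_unique) (simp add: linear_cis[OF f] algebra_simps)
qed

section \<open>The flux Laplacian: calculus and maximum principle\<close>

definition grad :: "'b \<Rightarrow> 'b \<Rightarrow> complex \<Rightarrow> 'b::real_vector" where
  "grad a b h = Re h *\<^sub>R a + Im h *\<^sub>R b"

lemma grad_1 [simp]: "grad a b 1 = a" and grad_i [simp]: "grad a b \<i> = b"
  and grad_cis: "grad a b (cis t) = cos t *\<^sub>R a + sin t *\<^sub>R b"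
  by (auto simp: grad_def)

definition C1_near :: "(complex \<Rightarrow> 'b::euclidean_space) \<Rightarrow> (complex \<Rightarrow> 'b) \<Rightarrow> (complex \<Rightarrow> 'b) \<Rightarrow> complex \<Rightarrow> real \<Rightarrow> bool" where
  "C1_near f fx fy z d \<longleftrightarrow> d > 0 \<and> (\<forall>w\<in>ball z d. (f has_derivative grad (fx w) (fy w)) (at w))
     \<and> continuous_on (ball z d) fx \<and> continuous_on (ball z d) fy"

abbreviation flux :: "(complex \<Rightarrow> 'b::euclidean_space) \<Rightarrow> (complex \<Rightarrow> 'b) \<Rightarrow> complex \<Rightarrow> real \<Rightarrow> 'b" where
  "flux fx fy z r \<equiv> integral {0..2*pi} (\<lambda>t. cos t *\<^sub>R fx (circ z r t) + sin t *\<^sub>R fy (circ z r t))"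

text \<open>A pointwise Laplacian for maps that are merely of class \<open>C\<^sup>1\<close>: the flux of the gradient
  through a small circle, divided by the area of the disc.\<close>
definition has_lap :: "(complex \<Rightarrow> 'b::euclidean_space) \<Rightarrow> (complex \<Rightarrow> 'b) \<Rightarrow> (complex \<Rightarrow> 'b) \<Rightarrow> complex \<Rightarrow> 'b \<Rightarrow> bool" where
  "has_lap f fx fy z L \<longleftrightarrow> (\<exists>d. C1_near f fx fy z d) \<and>
     ((\<lambda>r. flux fx fy z r /\<^sub>R r)
       \<longlongrightarrow> pi *\<^sub>R L) (at_right 0)"

lemma C1_near_mono: "C1_near f fx fy z d \<Longrightarrow> 0 < e \<Longrightarrow> e \<le> d \<Longrightarrow> C1_near f fx fy z e"
  unfolding C1_near_def by (auto intro: continuous_on_subset)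

lemma C1_near_continuous: "C1_near f fx fy z d \<Longrightarrow> continuous_on (ball z d) f"
  unfolding C1_near_def by (meson continuous_at_imp_continuous_on has_derivative_continuous)

lemma continuous_on_circ:
  assumes "continuous_on (ball z d) f" "0 < r" "r < d"
  shows "continuous_on S (\<lambda>t. f (circ z r t))"
  by (rule continuous_on_compose2[OF assms(1)]) (use assms in \<open>auto intro!: continuous_intros\<close>)

lemma has_lap_add:
  assumes "has_lap f fx fy z L" "has_lap g gx gy z M"
  shows "has_lap (\<lambda>w. f w + g w) (\<lambda>w. fx w + gx w) (\<lambda>w. fy w + gy w) z (L + M)"
proof -
  obtain d1 d2 where d: "C1_near f fx fy z d1" "C1_near g gx gy z d2"
    using assms unfolding has_lap_def by blast
  define d where "d = min d1 d2"
  have d0: "d > 0" using d unfolding C1_near_def d_def by auto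
  have D: "C1_near f fx fy z d" "C1_near g gx gy z d"
    using d d0 by (auto simp: d_def intro: C1_near_mono)
  have "C1_near (\<lambda>w. f w + g w) (\<lambda>w. fx w + gx w) (\<lambda>w. fy w + gy w) z d"
    unfolding C1_near_def
  proof (intro conjI ballI)
    fix w assume w: "w \<in> ball z d"
    have e: "grad (fx w + gx w) (fy w + gy w) = (\<lambda>h. grad (fx w) (fy w) h + grad (gx w) (gy w) h)"
      by (auto simp: grad_def algebra_simps)
    show "((\<lambda>w. f w + g w) has_derivative grad (fx w + gx w) (fy w + gy w)) (at w)"
      unfolding e using D w unfolding C1_near_def by (intro has_derivative_add) auto
  qed (use D d0 in \<open>auto simp: C1_near_def intro!: continuous_on_add\<close>)
  moreover have "((\<lambda>r. flux (\<lambda>w. fx w + gx w) (\<lambda>w. fy w + gy w) z r /\<^sub>R r)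
       \<longlongrightarrow> pi *\<^sub>R (L + M)) (at_right 0)"
  proof (rule Lim_transform_eventually)
    show "((\<lambda>r. flux fx fy z r /\<^sub>R r
       + flux gx gy z r /\<^sub>R r) \<longlongrightarrow> pi *\<^sub>R (L + M)) (at_right 0)"
      unfolding scaleR_add_right using assms unfolding has_lap_def by (intro tendsto_add) auto
    have "flux fx fy z r /\<^sub>R r
       + flux gx gy z r /\<^sub>R r
       = flux (\<lambda>w. fx w + gx w) (\<lambda>w. fy w + gy w) z r /\<^sub>R r"
      if r: "0 < r" "r < d" for r
    proof -
      have c: "(\<lambda>t. cos t *\<^sub>R fx (circ z r t) + sin t *\<^sub>R fy (circ z r t)) integrable_on {0..2*pi}"
        "(\<lambda>t. cos t *\<^sub>R gx (circ z r t) + sin t *\<^sub>R gy (circ z r t)) integrable_on {0..2*pi}"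
        using D r unfolding C1_near_def
        by (auto intro!: integrable_continuous_interval continuous_intros continuous_on_circ)
      show ?thesis
        unfolding scaleR_add_right[symmetric] integral_add[OF c, symmetric]
        by (simp add: algebra_simps)
    qed
    then show "\<forall>\<^sub>F r in at_right 0. flux fx fy z r /\<^sub>R r
       + flux gx gy z r /\<^sub>R r
       = flux (\<lambda>w. fx w + gx w) (\<lambda>w. fy w + gy w) z r /\<^sub>R r"
      unfolding eventually_at_right_field using d0 by blast
  qed
  ultimately show ?thesis unfolding has_lap_def by auto
qed

text \<open>The flux is the radial derivative of the integral of \<open>f\<close> over circles. If
  it is positive for all small radii, that integral strictly exceeds its value at radius 0, which a
  local maximum forbids.\<close>

lemma has_lap_pos_imp_not_local_max:
  fixes f :: "complex \<Rightarrow> real"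
  assumes lap: "has_lap f fx fy z L" and L: "L > 0" and e: "e > 0"
    and mx: "\<And>w. w \<in> ball z e \<Longrightarrow> f w \<le> f z"
  shows False
proof -
  obtain d where d: "C1_near f fx fy z d" using lap unfolding has_lap_def by blast
  have d0: "d > 0" using d by (simp add: C1_near_def)
  define J where "J = (\<lambda>r. flux fx fy z r)"
  have "((\<lambda>r. J r /\<^sub>R r) \<longlongrightarrow> pi *\<^sub>R L) (at_right 0)" using lap unfolding has_lap_def J_def by blast
  then have "\<forall>\<^sub>F r in at_right 0. J r /\<^sub>R r > 0"
    by (rule order_tendstoD(1)) (use L in simp)
  then obtain b where b: "b > 0" "\<And>r. 0 < r \<Longrightarrow> r < b \<Longrightarrow> J r /\<^sub>R r > 0"
    unfolding eventually_at_right_field by blast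
  have Jpos: "J r > 0" if "0 < r" "r < b" for r using b(2)[OF that] that
    by (simp add: zero_less_mult_iff)
  define r0 where "r0 = min b (min d e) / 2"
  have r0: "0 < r0" "r0 < b" "r0 < d" "r0 < e" unfolding r0_def using b d0 e by auto
  define m where "m = (\<lambda>r. integral (cbox 0 (2*pi)) (\<lambda>t. f (circ z r t)))"
  have inb: "circ z r t \<in> ball z d" if "r \<in> {0..r0}" for r t using that r0 by simp
  have cf: "continuous_on (ball z d) f" "continuous_on (ball z d) fx" "continuous_on (ball z d) fy"
    using C1_near_continuous[OF d] d unfolding C1_near_def by auto
  have mder: "(m has_field_derivative integral (cbox 0 (2*pi)) (\<lambda>t. cos t * fx (circ z r t) + sin t * fy (circ z r t))) (at r within {0..r0})"
    if r: "r \<in> {0..r0}" for r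
    unfolding m_def
  proof (rule leibniz_rule_field_derivative)
    fix r t assume rt: "r \<in> {0..r0}" "t \<in> cbox 0 (2*pi)"
    have "(f has_derivative grad (fx (circ z r t)) (fy (circ z r t))) (at (circ z r t))"
      using d inb[OF rt(1)] unfolding C1_near_def by blast
    moreover have "((\<lambda>r. circ z r t) has_derivative (\<lambda>h. of_real h * cis t)) (at r within {0..r0})"
      by (auto intro!: derivative_eq_intros)
    ultimately have "((\<lambda>r. f (circ z r t)) has_derivative (\<lambda>h. grad (fx (circ z r t)) (fy (circ z r t)) (of_real h * cis t))) (at r within {0..r0})"
      by (rule has_derivative_compose[rotated])
    moreover have "(\<lambda>h. grad (fx (circ z r t)) (fy (circ z r t)) (of_real h * cis t)) = (*) (cos t * fx (circ z r t) + sin t * fy (circ z r t))"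
      by (auto simp: grad_def algebra_simps)
    ultimately show "((\<lambda>r. f (circ z r t)) has_field_derivative cos t * fx (circ z r t) + sin t * fy (circ z r t)) (at r within {0..r0})"
      unfolding has_field_derivative_def by simp
  next
    fix r assume "r \<in> {0..r0}"
    then show "(\<lambda>t. f (circ z r t)) integrable_on cbox 0 (2*pi)"
      by (intro integrable_continuous continuous_on_compose2[OF cf(1)]) (use inb in \<open>auto intro!: continuous_intros\<close>)
  next
    show "continuous_on ({0..r0} \<times> cbox 0 (2 * pi)) (\<lambda>(r, t). cos t * fx (circ z r t) + sin t * fy (circ z r t))"
      unfolding case_prod_beta
      by (intro continuous_intros continuous_on_compose2[OF cf(2)] continuous_on_compose2[OF cf(3)])
         (use inb in \<open>auto intro!: continuous_intros\<close>)
  qed (use r in auto)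
  have "m r0 > m 0"
  proof (rule DERIV_pos_imp_increasing_open[of 0 r0 m])
    fix x assume x: "0 < x" "x < r0"
    have "(m has_field_derivative J x) (at x within {0..r0})"
      using mder[of x] x unfolding J_def by simp
    moreover have "at x within {0..r0} = at x" using x by (simp add: at_within_Icc_at)
    ultimately show "\<exists>y. DERIV m x :> y \<and> y > 0" using Jpos[of x] x r0 by auto
  next
    show "continuous_on {0..r0} m" by (rule DERIV_continuous_on[OF mder])
  qed (use r0 in auto)
  moreover have "m r0 \<le> m 0"
    unfolding m_def
  proof (rule integral_le)
    show "(\<lambda>t. f (circ z r0 t)) integrable_on cbox 0 (2*pi)"
      by (intro integrable_continuous continuous_on_compose2[OF cf(1)]) (use inb r0 in \<open>auto intro!: continuous_intros\<close>)
  qed (use mx r0 in auto)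
  ultimately show False by simp
qed

lemma linear_euclidean_expand:
  fixes f :: "'a::euclidean_space \<Rightarrow> 'b::real_vector"
  assumes "linear f" shows "f x = (\<Sum>b\<in>Basis. (x \<bullet> b) *\<^sub>R f b)"
proof -
  have "f x = f (\<Sum>b\<in>Basis. (x \<bullet> b) *\<^sub>R b)" by (simp add: euclidean_representation)
  also have "\<dots> = (\<Sum>b\<in>Basis. (x \<bullet> b) *\<^sub>R f b)"
    using assms by (simp add: linear_sum linear_cmul)
  finally show ?thesis .
qed

lemma has_lap_compose:
  fixes V :: "complex \<Rightarrow> 'a::euclidean_space" and \<Psi> :: "'a \<Rightarrow> real"
  assumes lap: "has_lap V Vx Vy z \<Lambda>" and e: "e > 0"
    and D1: "\<And>x. x \<in> ball (V z) e \<Longrightarrow> (\<Psi> has_derivative D x) (at x)"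
    and Dc: "\<And>k. continuous_on (ball (V z) e) (\<lambda>x. D x k)"
    and D2: "\<And>k. ((\<lambda>x. D x k) has_derivative (\<lambda>h. D' h k)) (at (V z))"
    and lin: "\<And>h. linear (D' h)"
  shows "has_lap (\<lambda>w. \<Psi> (V w)) (\<lambda>w. D (V w) (Vx w)) (\<lambda>w. D (V w) (Vy w)) z
     (D' (Vx z) (Vx z) + D' (Vy z) (Vy z) + D (V z) \<Lambda>)"
proof -
  obtain d1 where d1: "C1_near V Vx Vy z d1" using lap unfolding has_lap_def by blast
  have cV1: "continuous_on (ball z d1) V" using C1_near_continuous[OF d1] .
  have "isCont V z" using cV1 d1 unfolding C1_near_def by (simp add: continuous_on_eq_continuous_at)
  then obtain d2 where d2: "d2 > 0" "\<And>w. dist w z < d2 \<Longrightarrow> dist (V w) (V z) < e"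
    using e unfolding continuous_at_eps_delta by blast
  define d where "d = min d1 d2"
  have d0: "d > 0" using d1 d2 unfolding C1_near_def d_def by auto
  have C: "C1_near V Vx Vy z d" using d1 d0 by (auto simp: d_def intro: C1_near_mono)
  have cV: "continuous_on (ball z d) V" "continuous_on (ball z d) Vx" "continuous_on (ball z d) Vy"
    using C1_near_continuous[OF C] C unfolding C1_near_def by auto
  have Vin: "V w \<in> ball (V z) e" if "w \<in> ball z d" for w
    using d2(2)[of w] that by (simp add: d_def dist_commute)
  have linD: "linear (D x)" if "x \<in> ball (V z) e" for x
    using D1[OF that] by (rule has_derivative_linear)
  have linp: "linear (D (V z))" using e by (intro linD) auto
  have cDV: "continuous_on (ball z d) (\<lambda>w. D (V w) b)" for b
    by (rule continuous_on_compose2[OF Dc cV(1)]) (use Vin in auto)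
  have expand: "D (V w) x = (\<Sum>b\<in>Basis. (x \<bullet> b) * D (V w) b)" if "w \<in> ball z d" for w x
    using linear_euclidean_expand[OF linD[OF Vin[OF that]], of x] by simp
  have "C1_near (\<lambda>w. \<Psi> (V w)) (\<lambda>w. D (V w) (Vx w)) (\<lambda>w. D (V w) (Vy w)) z d"
    unfolding C1_near_def
  proof (intro conjI ballI d0)
    fix w assume w: "w \<in> ball z d"
    have l: "linear (D (V w))" using linD Vin w by blast
    have "(V has_derivative grad (Vx w) (Vy w)) (at w)" using C w unfolding C1_near_def by blast
    moreover have "(\<Psi> has_derivative D (V w)) (at (V w))" using D1 Vin w by blast
    ultimately have "((\<lambda>w. \<Psi> (V w)) has_derivative (\<lambda>h. D (V w) (grad (Vx w) (Vy w) h))) (at w)"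
      by (rule has_derivative_compose)
    moreover have "(\<lambda>h. D (V w) (grad (Vx w) (Vy w) h)) = grad (D (V w) (Vx w)) (D (V w) (Vy w))"
      using l by (auto simp: grad_def linear_add linear_cmul)
    ultimately show "((\<lambda>w. \<Psi> (V w)) has_derivative grad (D (V w) (Vx w)) (D (V w) (Vy w))) (at w)" by simp
  next
    have "continuous_on (ball z d) (\<lambda>w. \<Sum>b\<in>Basis. (Vx w \<bullet> b) * D (V w) b)"
      by (intro continuous_intros cV cDV)
    then show "continuous_on (ball z d) (\<lambda>w. D (V w) (Vx w))"
      by (rule continuous_on_eq) (metis expand)
    have "continuous_on (ball z d) (\<lambda>w. \<Sum>b\<in>Basis. (Vy w \<bullet> b) * D (V w) b)"
      by (intro continuous_intros cV cDV)
    then show "continuous_on (ball z d) (\<lambda>w. D (V w) (Vy w))"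
      by (rule continuous_on_eq) (metis expand)
  qed
  moreover
  define I where "I = (\<lambda>r. flux Vx Vy z r)"
  \<comment> \<open>Expanding the argument of \<open>D\<close> in the basis leaves scalar continuous
    weights, as \<open>circ_weighted_limit\<close> requires.\<close>
  define cI where "cI = (\<lambda>b r. integral {0..2*pi} (\<lambda>t. (cos t * (Vx (circ z r t) \<bullet> b)) *\<^sub>R (D (V (circ z r t)) b - D (V z) b)))"
  define sI where "sI = (\<lambda>b r. integral {0..2*pi} (\<lambda>t. (sin t * (Vy (circ z r t) \<bullet> b)) *\<^sub>R (D (V (circ z r t)) b - D (V z) b)))"
  have der\<Phi>: "((\<lambda>w. D (V w) b) has_derivative (\<lambda>h. D' (grad (Vx z) (Vy z) h) b)) (at z)" for b
  proof -
    have "(V has_derivative grad (Vx z) (Vy z)) (at z)" using C d0 unfolding C1_near_def by simp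
    from has_derivative_compose[OF this D2[of b]] show ?thesis by simp
  qed
  have lind: "linear (\<lambda>h. D' (grad (Vx z) (Vy z) h) b)" for b
    using der\<Phi> has_derivative_linear by blast
  have cl: "((\<lambda>r. cI b r /\<^sub>R r) \<longlongrightarrow> (Vx z \<bullet> b) *\<^sub>R (pi *\<^sub>R D' (Vx z) b)) (at_right 0)" for b
    using circ_weighted_limit[OF d0 der\<Phi>[of b] cDV, of "\<lambda>w. Vx w \<bullet> b" cos]
      integral_linear_cis(1)[OF lind[of b]]
    unfolding cI_def by (simp add: continuous_intros cV)
  have sl: "((\<lambda>r. sI b r /\<^sub>R r) \<longlongrightarrow> (Vy z \<bullet> b) *\<^sub>R (pi *\<^sub>R D' (Vy z) b)) (at_right 0)" for b
    using circ_weighted_limit[OF d0 der\<Phi>[of b] cDV, of "\<lambda>w. Vy w \<bullet> b" sin]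
      integral_linear_cis(2)[OF lind[of b]]
    unfolding sI_def by (simp add: continuous_intros cV)
  have "((\<lambda>r. flux (\<lambda>w. D (V w) (Vx w)) (\<lambda>w. D (V w) (Vy w)) z r /\<^sub>R r)
       \<longlongrightarrow> pi *\<^sub>R (D' (Vx z) (Vx z) + D' (Vy z) (Vy z) + D (V z) \<Lambda>)) (at_right 0)"
  proof (rule Lim_transform_eventually)
    have "((\<lambda>r. D (V z) (I r /\<^sub>R r)) \<longlongrightarrow> D (V z) (pi *\<^sub>R \<Lambda>)) (at_right 0)"
      using lap linp unfolding has_lap_def I_def
      by (intro bounded_linear.tendsto[of "D (V z)"]) (auto simp: linear_conv_bounded_linear)
    then have "((\<lambda>r. D (V z) (I r /\<^sub>R r) + (\<Sum>b\<in>Basis. cI b r /\<^sub>R r + sI b r /\<^sub>R r)) \<longlongrightarrow>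
       D (V z) (pi *\<^sub>R \<Lambda>) + (\<Sum>b\<in>Basis. (Vx z \<bullet> b) *\<^sub>R (pi *\<^sub>R D' (Vx z) b) + (Vy z \<bullet> b) *\<^sub>R (pi *\<^sub>R D' (Vy z) b))) (at_right 0)"
      by (intro tendsto_add tendsto_sum cl sl)
    moreover have "(\<Sum>b\<in>Basis. (Vx z \<bullet> b) *\<^sub>R (pi *\<^sub>R D' (Vx z) b) + (Vy z \<bullet> b) *\<^sub>R (pi *\<^sub>R D' (Vy z) b))
       = pi * (D' (Vx z) (Vx z) + D' (Vy z) (Vy z))"
      unfolding linear_euclidean_expand[OF lin, of "Vx z" "Vx z"] linear_euclidean_expand[OF lin, of "Vy z" "Vy z"]
      by (simp add: sum.distrib sum_distrib_left algebra_simps)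
    moreover have "D (V z) (pi *\<^sub>R \<Lambda>) = pi * D (V z) \<Lambda>" using linp by (simp add: linear_cmul)
    ultimately show "((\<lambda>r. D (V z) (I r /\<^sub>R r) + (\<Sum>b\<in>Basis. cI b r /\<^sub>R r + sI b r /\<^sub>R r)) \<longlongrightarrow>
       pi *\<^sub>R (D' (Vx z) (Vx z) + D' (Vy z) (Vy z) + D (V z) \<Lambda>)) (at_right 0)"
      by (simp add: algebra_simps)
    have "D (V z) (I r /\<^sub>R r) + (\<Sum>b\<in>Basis. cI b r /\<^sub>R r + sI b r /\<^sub>R r) =
      flux (\<lambda>w. D (V w) (Vx w)) (\<lambda>w. D (V w) (Vy w)) z r /\<^sub>R r"
      if r: "0 < r" "r < d" for r
    proof -
      have inb: "circ z r t \<in> ball z d" for t using r by simp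
      have co: "continuous_on S (\<lambda>t. Vx (circ z r t))" "continuous_on S (\<lambda>t. Vy (circ z r t))"
         "continuous_on S (\<lambda>t. D (V (circ z r t)) b)" for S b
        using continuous_on_circ[OF _ r] cV cDV by blast+
      have ci: "(\<lambda>t. cos t *\<^sub>R Vx (circ z r t) + sin t *\<^sub>R Vy (circ z r t)) integrable_on {0..2*pi}"
        by (intro integrable_continuous_interval continuous_intros co)
      have c1: "(\<lambda>t. (cos t * (Vx (circ z r t) \<bullet> b)) *\<^sub>R (D (V (circ z r t)) b - D (V z) b)) integrable_on {0..2*pi}" for b
        by (intro integrable_continuous_interval continuous_intros co)
      have c2: "(\<lambda>t. (sin t * (Vy (circ z r t) \<bullet> b)) *\<^sub>R (D (V (circ z r t)) b - D (V z) b)) integrable_on {0..2*pi}" for b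
        by (intro integrable_continuous_interval continuous_intros co)
      have lI: "D (V z) (I r) = integral {0..2*pi} (\<lambda>t. D (V z) (cos t *\<^sub>R Vx (circ z r t) + sin t *\<^sub>R Vy (circ z r t)))"
        using integral_linear[OF ci, of "D (V z)"] linp unfolding I_def by (simp add: o_def linear_conv_bounded_linear)
      have ci': "(\<lambda>t. D (V z) (cos t *\<^sub>R Vx (circ z r t) + sin t *\<^sub>R Vy (circ z r t))) integrable_on {0..2*pi}"
        using integrable_linear[OF ci, of "D (V z)"] linp by (simp add: o_def linear_conv_bounded_linear)
      have pt: "cos t *\<^sub>R D (V (circ z r t)) (Vx (circ z r t)) + sin t *\<^sub>R D (V (circ z r t)) (Vy (circ z r t)) =
          D (V z) (cos t *\<^sub>R Vx (circ z r t) + sin t *\<^sub>R Vy (circ z r t)) +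
          (\<Sum>b\<in>Basis. (cos t * (Vx (circ z r t) \<bullet> b)) *\<^sub>R (D (V (circ z r t)) b - D (V z) b) + (sin t * (Vy (circ z r t) \<bullet> b)) *\<^sub>R (D (V (circ z r t)) b - D (V z) b))" for t
      proof -
        define w where "w = circ z r t"
        have w: "w \<in> ball z d" "z \<in> ball z d" unfolding w_def using inb[of t] d0 by auto
        have 1: "D (V z) (cos t *\<^sub>R Vx w + sin t *\<^sub>R Vy w) = cos t * D (V z) (Vx w) + sin t * D (V z) (Vy w)"
          using linp by (simp add: linear_add linear_cmul)
        show ?thesis
          unfolding w_def[symmetric] 1 expand[OF w(1), of "Vx w"] expand[OF w(1), of "Vy w"]
            expand[OF w(2), of "Vx w"] expand[OF w(2), of "Vy w"]
          by (simp add: sum_distrib_left sum.distrib[symmetric] sum_subtractf[symmetric] algebra_simps)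
      qed
      have "flux (\<lambda>w. D (V w) (Vx w)) (\<lambda>w. D (V w) (Vy w)) z r
        = D (V z) (I r) + (\<Sum>b\<in>Basis. cI b r + sI b r)"
        unfolding pt
        by (subst integral_add[OF ci'] , intro integrable_sum integrable_add c1 c2, simp)
           (simp add: lI integral_sum integral_add integrable_add c1 c2 cI_def sI_def del: real_scaleR_def)
      then show ?thesis using linp
        by (simp add: linear_cmul sum_distrib_left algebra_simps)
    qed
    then show "\<forall>\<^sub>F r in at_right 0. D (V z) (I r /\<^sub>R r) + (\<Sum>b\<in>Basis. cI b r /\<^sub>R r + sI b r /\<^sub>R r) =
      flux (\<lambda>w. D (V w) (Vx w)) (\<lambda>w. D (V w) (Vy w)) z r /\<^sub>R r"
      unfolding eventually_at_right_field using d0 by blast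
  qed
  ultimately show ?thesis unfolding has_lap_def by auto
qed

text \<open>The starting point for functions of the disc variable itself, to which the chain rule is
  then applied.\<close>

lemma has_lap_id: "has_lap (\<lambda>w. w) (\<lambda>w. 1) (\<lambda>w. \<i>) z 0"
proof -
  have g: "grad 1 \<i> = (\<lambda>h. h)" by (auto simp: grad_def complex_eq_iff)
  have "C1_near (\<lambda>w. w) (\<lambda>w. 1) (\<lambda>w. \<i>) z 1"
    unfolding C1_near_def g by (auto intro!: derivative_eq_intros)
  moreover have "((\<lambda>t. cos t *\<^sub>R 1 + sin t *\<^sub>R \<i>) has_integral ((- \<i> * cis (2*pi)) - (- \<i> * cis 0))) {0..2*pi}"
  proof (rule fundamental_theorem_of_calculus)
    fix x :: real
    show "((\<lambda>t. - \<i> * cis t) has_vector_derivative cos x *\<^sub>R 1 + sin x *\<^sub>R \<i>) (at x within {0..2*pi})"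
      unfolding has_vector_derivative_def
      by (rule derivative_eq_intros refl)+ (auto simp: complex_eq_iff)
  qed auto
  then have "integral {0..2*pi} (\<lambda>t. cos t *\<^sub>R 1 + sin t *\<^sub>R \<i>) = 0" by (simp add: integral_unique)
  ultimately show ?thesis unfolding has_lap_def by auto
qed

text \<open>For a disc of class \<open>C\<^sup>1\<close> the radial derivative is minus \<open>A\<close> applied to the tangential one,
  and the tangential one integrates to zero along circles; hence only the variation of \<open>A\<close> contributes.\<close>
lemma has_lap_J_hol:
  fixes v :: "complex \<Rightarrow> 'a::euclidean_space" and A :: "'a \<Rightarrow> 'a \<Rightarrow> 'a"
  assumes C: "C1_near v vx vy z d"
    and lin: "\<And>w. w \<in> ball z d \<Longrightarrow> linear (A (v w))"
    and eq: "\<And>w. w \<in> ball z d \<Longrightarrow> A (v w) (vx w) = vy w" "\<And>w. w \<in> ball z d \<Longrightarrow> A (v w) (vy w) = - vx w"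
    and cA: "\<And>k. continuous_on (ball z d) (\<lambda>w. A (v w) k)"
    and DA: "\<And>k. ((\<lambda>x. A x k) has_derivative (\<lambda>h. A' h k)) (at (v z))"
  shows "has_lap v vx vy z (\<Sum>b\<in>Basis. (vx z \<bullet> b) *\<^sub>R A' (vy z) b - (vy z \<bullet> b) *\<^sub>R A' (vx z) b)"
proof -
  have d0: "d > 0" using C by (simp add: C1_near_def)
  have cv: "continuous_on (ball z d) v" "continuous_on (ball z d) vx" "continuous_on (ball z d) vy"
    using C1_near_continuous[OF C] C unfolding C1_near_def by auto
  define cI where "cI = (\<lambda>b r. integral {0..2*pi} (\<lambda>t. (cos t * (vy (circ z r t) \<bullet> b)) *\<^sub>R (A (v (circ z r t)) b - A (v z) b)))"
  define sI where "sI = (\<lambda>b r. integral {0..2*pi} (\<lambda>t. (sin t * (vx (circ z r t) \<bullet> b)) *\<^sub>R (A (v (circ z r t)) b - A (v z) b)))"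
  have der\<Phi>: "((\<lambda>w. A (v w) b) has_derivative (\<lambda>h. A' (grad (vx z) (vy z) h) b)) (at z)" for b
  proof -
    have "(v has_derivative grad (vx z) (vy z)) (at z)" using C d0 unfolding C1_near_def by simp
    from has_derivative_compose[OF this DA[of b]] show ?thesis by simp
  qed
  have lind: "linear (\<lambda>h. A' (grad (vx z) (vy z) h) b)" for b
    using der\<Phi> has_derivative_linear by blast
  have cl: "((\<lambda>r. cI b r /\<^sub>R r) \<longlongrightarrow> (vy z \<bullet> b) *\<^sub>R (pi *\<^sub>R A' (vx z) b)) (at_right 0)" for b
    using circ_weighted_limit[OF d0 der\<Phi>[of b] cA, of "\<lambda>w. vy w \<bullet> b" cos]
      integral_linear_cis(1)[OF lind[of b]]
    unfolding cI_def by (simp add: continuous_intros cv)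
  have sl: "((\<lambda>r. sI b r /\<^sub>R r) \<longlongrightarrow> (vx z \<bullet> b) *\<^sub>R (pi *\<^sub>R A' (vy z) b)) (at_right 0)" for b
    using circ_weighted_limit[OF d0 der\<Phi>[of b] cA, of "\<lambda>w. vx w \<bullet> b" sin]
      integral_linear_cis(2)[OF lind[of b]]
    unfolding sI_def by (simp add: continuous_intros cv)
  have "((\<lambda>r. flux vx vy z r /\<^sub>R r)
     \<longlongrightarrow> pi *\<^sub>R (\<Sum>b\<in>Basis. (vx z \<bullet> b) *\<^sub>R A' (vy z) b - (vy z \<bullet> b) *\<^sub>R A' (vx z) b)) (at_right 0)"
  proof (rule Lim_transform_eventually)
    have "((\<lambda>r. \<Sum>b\<in>Basis. sI b r /\<^sub>R r - cI b r /\<^sub>R r) \<longlongrightarrow>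
       (\<Sum>b\<in>Basis. (vx z \<bullet> b) *\<^sub>R (pi *\<^sub>R A' (vy z) b) - (vy z \<bullet> b) *\<^sub>R (pi *\<^sub>R A' (vx z) b))) (at_right 0)"
      by (intro tendsto_sum tendsto_diff cl sl)
    then show "((\<lambda>r. \<Sum>b\<in>Basis. sI b r /\<^sub>R r - cI b r /\<^sub>R r) \<longlongrightarrow>
       pi *\<^sub>R (\<Sum>b\<in>Basis. (vx z \<bullet> b) *\<^sub>R A' (vy z) b - (vy z \<bullet> b) *\<^sub>R A' (vx z) b)) (at_right 0)"
      by (simp add: scaleR_sum_right scaleR_diff_right mult.commute)
    have "(\<Sum>b\<in>Basis. sI b r /\<^sub>R r - cI b r /\<^sub>R r) =
      flux vx vy z r /\<^sub>R r"
      if r: "0 < r" "r < d" for r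
    proof -
      have inb: "circ z r t \<in> ball z d" for t using r by simp
      have co: "continuous_on S (\<lambda>t. vx (circ z r t))" "continuous_on S (\<lambda>t. vy (circ z r t))"
         "continuous_on S (\<lambda>t. A (v (circ z r t)) b)" for S b
        using continuous_on_circ[OF _ r] cv cA by blast+
      \<comment> \<open>The closed curve \<open>v (circ z r t)\<close> has velocity \<open>r\<close>
        times \<open>tg\<close>, so \<open>tg\<close> has integral zero.\<close>
      define tg where "tg = (\<lambda>t. - sin t *\<^sub>R vx (circ z r t) + cos t *\<^sub>R vy (circ z r t))"
      have "((\<lambda>t. r *\<^sub>R tg t) has_integral (v (circ z r (2*pi)) - v (circ z r 0))) {0..2*pi}"
      proof (rule fundamental_theorem_of_calculus)
        fix t :: real
        have "(v has_derivative grad (vx (circ z r t)) (vy (circ z r t))) (at (circ z r t))"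
          using C inb unfolding C1_near_def by blast
        moreover have "((\<lambda>t. circ z r t) has_derivative (\<lambda>h. of_real r * (h *\<^sub>R (\<i> * cis t)))) (at t within {0..2*pi})"
          by (auto intro!: derivative_eq_intros)
        ultimately have "((\<lambda>t. v (circ z r t)) has_derivative (\<lambda>h. grad (vx (circ z r t)) (vy (circ z r t)) (of_real r * (h *\<^sub>R (\<i> * cis t))))) (at t within {0..2*pi})"
          by (rule has_derivative_compose[rotated])
        moreover have "(\<lambda>h. grad (vx (circ z r t)) (vy (circ z r t)) (of_real r * (h *\<^sub>R (\<i> * cis t)))) = (\<lambda>h. h *\<^sub>R (r *\<^sub>R tg t))"
          by (auto simp: grad_def tg_def algebra_simps)
        ultimately show "((\<lambda>t. v (circ z r t)) has_vector_derivative r *\<^sub>R tg t) (at t within {0..2*pi})"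
          unfolding has_vector_derivative_def by simp
      qed auto
      then have "((\<lambda>t. r *\<^sub>R tg t) has_integral 0) {0..2*pi}" by simp
      from has_integral_cmul[OF this, of "inverse r"] have tg0: "(tg has_integral 0) {0..2*pi}" using r by simp
      have linz: "linear (A (v z))" using lin d0 by simp
      have tgA: "((\<lambda>t. A (v z) (tg t)) has_integral 0) {0..2*pi}"
        using has_integral_linear[OF tg0, of "A (v z)"] linz
        by (simp add: o_def linear_conv_bounded_linear linear_0)
      have c1: "(\<lambda>t. (cos t * (vy (circ z r t) \<bullet> b)) *\<^sub>R (A (v (circ z r t)) b - A (v z) b)) integrable_on {0..2*pi}" for b
        by (intro integrable_continuous_interval continuous_intros co)
      have c2: "(\<lambda>t. (sin t * (vx (circ z r t) \<bullet> b)) *\<^sub>R (A (v (circ z r t)) b - A (v z) b)) integrable_on {0..2*pi}" for b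
        by (intro integrable_continuous_interval continuous_intros co)
      have pt: "cos t *\<^sub>R vx (circ z r t) + sin t *\<^sub>R vy (circ z r t) =
         (\<Sum>b\<in>Basis. (sin t * (vx (circ z r t) \<bullet> b)) *\<^sub>R (A (v (circ z r t)) b - A (v z) b) - (cos t * (vy (circ z r t) \<bullet> b)) *\<^sub>R (A (v (circ z r t)) b - A (v z) b))
          - A (v z) (tg t)" for t
      proof -
        define w where "w = circ z r t"
        have w: "w \<in> ball z d" unfolding w_def by (rule inb)
        have tgw: "tg t = - sin t *\<^sub>R vx w + cos t *\<^sub>R vy w" unfolding tg_def w_def ..
        have l: "linear (A (v w))" using lin w by blast
        have 1: "cos t *\<^sub>R vx w + sin t *\<^sub>R vy w = - A (v w) (tg t)"
          unfolding tgw using l eq[OF w] by (simp add: linear_add linear_cmul linear_diff linear_neg)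
        have 2: "A (v w) (tg t) = (\<Sum>b\<in>Basis. (tg t \<bullet> b) *\<^sub>R A (v w) b)"
           "A (v z) (tg t) = (\<Sum>b\<in>Basis. (tg t \<bullet> b) *\<^sub>R A (v z) b)"
          using linear_euclidean_expand l linz by blast+
        show ?thesis unfolding w_def[symmetric] 1 unfolding 2 unfolding tgw
          by (simp add: sum_negf[symmetric] sum_subtractf[symmetric] inner_diff_left inner_add_left algebra_simps)
      qed
      have "flux vx vy z r = (\<Sum>b\<in>Basis. sI b r - cI b r)"
      proof (rule integral_unique)
        have "((\<lambda>t. (\<Sum>b\<in>Basis. (sin t * (vx (circ z r t) \<bullet> b)) *\<^sub>R (A (v (circ z r t)) b - A (v z) b) - (cos t * (vy (circ z r t) \<bullet> b)) *\<^sub>R (A (v (circ z r t)) b - A (v z) b))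
          - A (v z) (tg t)) has_integral (\<Sum>b\<in>Basis. sI b r - cI b r) - 0) {0..2*pi}"
          unfolding sI_def cI_def
          by (intro has_integral_diff has_integral_sum finite_Basis tgA integrable_integral c1 c2)
        then show "((\<lambda>t. cos t *\<^sub>R vx (circ z r t) + sin t *\<^sub>R vy (circ z r t)) has_integral (\<Sum>b\<in>Basis. sI b r - cI b r)) {0..2*pi}"
          unfolding pt by simp
      qed
      then show ?thesis by (simp add: scaleR_sum_right scaleR_diff_right)
    qed
    then show "\<forall>\<^sub>F r in at_right 0. (\<Sum>b\<in>Basis. sI b r /\<^sub>R r - cI b r /\<^sub>R r) =
      flux vx vy z r /\<^sub>R r"
      unfolding eventually_at_right_field using d0 by blast
  qed
  then show ?thesis unfolding has_lap_def using C by blast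
qed

subsection \<open>Chirka's function\<close>

lemma has_derivative_radial:
  fixes l :: "'a::euclidean_space \<Rightarrow> 'b::real_inner"
  assumes l: "bounded_linear l" and k: "(\<kappa> has_field_derivative \<kappa>' ) (at (l (x - p) \<bullet> l (x - p)))"
  shows "((\<lambda>x. \<kappa> (l (x - p) \<bullet> l (x - p))) has_derivative (\<lambda>h. \<kappa>' * (2 * (l (x - p) \<bullet> l h)))) (at x)"
proof -
  have "((\<lambda>x. l (x - p)) has_derivative (\<lambda>h. l h)) (at x)"
    by (rule bounded_linear.has_derivative[OF l]) (auto intro!: derivative_eq_intros)
  then have "((\<lambda>x. l (x - p) \<bullet> l (x - p)) has_derivative (\<lambda>h. l (x - p) \<bullet> l h + l h \<bullet> l (x - p))) (at x)"
    by (intro has_derivative_inner)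
  then have "((\<lambda>x. l (x - p) \<bullet> l (x - p)) has_derivative (\<lambda>h. 2 * (l (x - p) \<bullet> l h))) (at x)"
    by (simp add: inner_commute)
  from has_derivative_compose[OF this k[unfolded has_field_derivative_def]]
  show ?thesis by simp
qed

lemma has_derivative_radial2:
  fixes l :: "'a::euclidean_space \<Rightarrow> 'b::real_inner"
  assumes l: "bounded_linear l" and k: "(\<kappa>1 has_field_derivative \<kappa>2) (at (l (x - p) \<bullet> l (x - p)))"
  shows "((\<lambda>x. \<kappa>1 (l (x - p) \<bullet> l (x - p)) * (2 * (l (x - p) \<bullet> l k))) has_derivative
    (\<lambda>h. 4 * \<kappa>2 * (l (x - p) \<bullet> l h) * (l (x - p) \<bullet> l k) + 2 * \<kappa>1 (l (x - p) \<bullet> l (x - p)) * (l h \<bullet> l k))) (at x)"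
proof -
  have 1: "((\<lambda>x. l (x - p)) has_derivative (\<lambda>h. l h)) (at x)"
    by (rule bounded_linear.has_derivative[OF l]) (auto intro!: derivative_eq_intros)
  have 2: "((\<lambda>x. 2 * (l (x - p) \<bullet> l k)) has_derivative (\<lambda>h. 2 * (l h \<bullet> l k))) (at x)"
    using has_derivative_mult_right[OF has_derivative_inner_left[OF 1, of "l k"], of 2] by simp
  show ?thesis
    by (rule has_derivative_eq_rhs[OF has_derivative_mult[OF has_derivative_radial[OF l k] 2]])
       (auto simp: algebra_simps)
qed

text \<open>Because \<open>g' 1 = 0\<close>, the two one-sided derivatives at 1 agree. Applied to
  the formula below and to its derivative, this makes \<open>cutlog\<close> twice differentiable
  across 1.\<close>

lemma DERIV_stop_at_1:
  fixes g :: "real \<Rightarrow> real"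
  assumes g: "\<And>x. 0 < x \<Longrightarrow> x \<le> 1 \<Longrightarrow> (g has_field_derivative g' x) (at x)" and g1: "g' 1 = 0" and x: "x > 0"
  shows "((\<lambda>x. g (min x 1)) has_field_derivative (if x < 1 then g' x else 0)) (at x)"
proof -
  consider "x < 1" | "x = 1" | "x > 1" by linarith
  then show ?thesis
  proof cases
    case 1
    have "((\<lambda>x. g (min x 1)) has_field_derivative g' x) (at x)"
      by (rule has_field_derivative_transform_within_open[OF g, of x "{..<1}"]) (use x 1 in auto)
    then show ?thesis using 1 by simp
  next
    case 2
    have "(g has_derivative (\<lambda>h. 0)) (at 1)"
      using g[of 1] g1 by (simp add: has_field_derivative_def lambda_zero)
    then have "((\<lambda>x. g (min x 1)) has_derivative (\<lambda>h. 0)) (at 1)"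
      unfolding has_derivative_at_alt
    proof (intro conjI allI impI, simp, elim conjE)
      fix e :: real assume e: "e > 0" and H: "\<forall>e>0. \<exists>d>0. \<forall>y. norm (y - 1) < d \<longrightarrow> norm (g y - g 1 - 0) \<le> e * norm (y - 1)"
      obtain d where d: "d > 0" "\<And>y. norm (y - 1) < d \<Longrightarrow> norm (g y - g 1 - 0) \<le> e * norm (y - 1)"
        using H e by blast
      have "norm (g (min y 1) - g (min 1 1) - 0) \<le> e * norm (y - 1)" if "norm (y - 1) < d" for y
        using d(2)[OF that] e by (cases "y < 1") (auto simp: min_def)
      then show "\<exists>d>0. \<forall>y. norm (y - 1) < d \<longrightarrow> norm (g (min y 1) - g (min 1 1) - 0) \<le> e * norm (y - 1)"
        using d(1) by blast
    qed
    then show ?thesis using 2 by (simp add: has_field_derivative_def lambda_zero)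
  next
    case 3
    have "((\<lambda>x. g (min x 1)) has_field_derivative 0) (at x)"
      by (rule has_field_derivative_transform_within_open[OF DERIV_const[of "g 1"], of "{1<..}"]) (use 3 in auto)
    then show ?thesis using 3 by simp
  qed
qed

text \<open>A smoothed \<open>min (ln x) 0\<close>; the term \<open>4 * sqrt x\<close> provides the positivity that absorbs the
  non-integrability of the structure (Chirka's function), the remaining terms make it \<open>C\<^sup>2\<close> at \<open>1\<close>.\<close>
definition cutlog :: "real \<Rightarrow> real" where
  "cutlog x = (\<lambda>x. ln x + 4 * sqrt x - 7 * x + 8/3 * (x * sqrt x)) (min x 1)"
text \<open>The coefficients \<open>- 7\<close> and \<open>8/3\<close> of \<open>cutlog\<close> are
  the ones for which this formula and its derivative both vanish at 1:
  \<open>1 + 2 - 7 + 4 = 0\<close> and \<open>- 1 - 1 + 2 = 0\<close>.\<close>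

definition cutlog1 :: "real \<Rightarrow> real" where
  "cutlog1 x = (if x < 1 then 1 / x + 2 / sqrt x - 7 + 4 * sqrt x else 0)"
definition cutlog2 :: "real \<Rightarrow> real" where
  "cutlog2 x = (if x < 1 then - 1 / x^2 - 1 / (x * sqrt x) + 2 / sqrt x else 0)"

lemma DERIV_cutlog: "x > 0 \<Longrightarrow> (cutlog has_field_derivative cutlog1 x) (at x)"
  unfolding cutlog_def cutlog1_def
proof (rule DERIV_stop_at_1)
  fix x :: real assume x: "0 < x"
  obtain y where y: "y > 0" "x = y^2" using x by (metis real_sqrt_gt_0_iff real_sqrt_pow2 less_imp_le)
  show "((\<lambda>x. ln x + 4 * sqrt x - 7 * x + 8 / 3 * (x * sqrt x)) has_field_derivative 1 / x + 2 / sqrt x - 7 + 4 * sqrt x) (at x)"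
    using x by (auto intro!: derivative_eq_intros) (use y in \<open>simp add: field_simps power2_eq_square\<close>)
qed auto

lemma cutlog1_min: "x > 0 \<Longrightarrow> cutlog1 x = 1 / min x 1 + 2 / sqrt (min x 1) - 7 + 4 * sqrt (min x 1)"
  unfolding cutlog1_def by (auto simp: min_def)

lemma DERIV_cutlog1: assumes "x > 0" shows "(cutlog1 has_field_derivative cutlog2 x) (at x)"
proof -
  have "((\<lambda>x. (\<lambda>x. 1 / x + 2 / sqrt x - 7 + 4 * sqrt x) (min x 1)) has_field_derivative cutlog2 x) (at x)"
    unfolding cutlog2_def
  proof (rule DERIV_stop_at_1)
    fix x :: real assume x: "0 < x"
    obtain y where y: "y > 0" "x = y^2" using x by (metis real_sqrt_gt_0_iff real_sqrt_pow2 less_imp_le)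
    show "((\<lambda>x. 1 / x + 2 / sqrt x - 7 + 4 * sqrt x) has_field_derivative - 1 / x\<^sup>2 - 1 / (x * sqrt x) + 2 / sqrt x) (at x)"
      using x by (auto intro!: derivative_eq_intros) (use y in \<open>simp add: field_simps power2_eq_square power3_eq_cube\<close>)
  qed (use assms in auto)
  then show ?thesis
    by (rule has_field_derivative_transform_within_open[of _ _ _ "{0<..}"]) (use assms in \<open>auto simp: cutlog1_min\<close>)
qed

text \<open>\<open>cutlog\<close> has a logarithmic pole at 0, but its exponential extends
  continuously by 0; for that reason the maximum principle is run with exponentials.\<close>

definition exp_cutlog :: "real \<Rightarrow> real" where
  "exp_cutlog x = min x 1 * exp (4 * sqrt (min x 1) - 7 * min x 1 + 8/3 * (min x 1 * sqrt (min x 1)))"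

lemma exp_cutlog: "x > 0 \<Longrightarrow> exp (cutlog x) = exp_cutlog x"
  unfolding cutlog_def exp_cutlog_def by (simp add: exp_add exp_diff)

lemma exp_cutlog_0 [simp]: "exp_cutlog 0 = 0" by (simp add: exp_cutlog_def)

lemma continuous_exp_cutlog: "continuous_on UNIV exp_cutlog"
  unfolding exp_cutlog_def by (intro continuous_intros)

text \<open>On \<open>[0,1]\<close> the exponent of the correction stays between \<open>- 7\<close>
  and \<open>7\<close>, so \<open>exp_cutlog x\<close> is comparable with \<open>x\<close>.\<close>

lemma exp_cutlog_ge: assumes "0 \<le> x" "x \<le> 1" shows "exp_cutlog x \<ge> x * exp (- 7)"
proof -
  have "4 * sqrt x - 7 * x + 8/3 * (x * sqrt x) \<ge> - 7"
  proof -
    have "0 \<le> sqrt x" "0 \<le> x * sqrt x" using assms by auto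
    then show ?thesis using assms by linarith
  qed
  then show ?thesis using assms unfolding exp_cutlog_def by (simp add: min_absorb1 mult_left_mono)
qed

lemma exp_cutlog_le: assumes "0 \<le> x" shows "exp_cutlog x \<le> exp 7" "exp_cutlog x \<le> x * exp 7"
proof -
  define n where "n = min x 1"
  have n: "0 \<le> n" "n \<le> 1" "n \<le> x" using assms by (auto simp: n_def)
  have s: "sqrt n \<le> 1" "0 \<le> sqrt n" using n by auto
  have "n * sqrt n \<le> 1 * 1" using n s by (intro mult_mono) auto
  then have "4 * sqrt n - 7 * n + 8/3 * (n * sqrt n) \<le> 7" using n s by linarith
  then have "n * exp (4 * sqrt n - 7 * n + 8/3 * (n * sqrt n)) \<le> n * exp 7" using n by (intro mult_left_mono) auto
  then have "exp_cutlog x \<le> n * exp 7" by (simp add: exp_cutlog_def n_def)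
  moreover have "n * exp 7 \<le> 1 * exp 7" "n * exp 7 \<le> x * exp 7" using n by (intro mult_right_mono; simp)+
  ultimately show "exp_cutlog x \<le> exp 7" "exp_cutlog x \<le> x * exp 7" by linarith+
qed

section \<open>Linear algebra of the standard complex structure\<close>

definition imul :: "complex \<times> complex \<Rightarrow> complex \<times> complex" where
  "imul w = (\<i> * fst w, \<i> * snd w)"

lemma norm_imul [simp]: "norm (imul w) = norm w"
  by (simp add: imul_def norm_prod_def norm_mult)

lemma imul_add: "imul (a + b) = imul a + imul b" and imul_diff: "imul (a - b) = imul a - imul b"
  and imul_imul: "imul (imul a) = - a"  and imul_scaleR: "imul (c *\<^sub>R a) = c *\<^sub>R imul a"
  by (auto simp: imul_def algebra_simps prod_eq_iff)

lemma imul_inner_imul [simp]: "imul a \<bullet> imul a = a \<bullet> a"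
  by (simp flip: power2_norm_eq_inner)

lemma inner_imul [simp]: "a \<bullet> imul a = 0"
  by (cases a) (auto simp: imul_def inner_prod_def inner_complex_def)

text \<open>Bessel's inequality for the orthogonal pair \<open>a\<close>, \<open>imul a\<close> of
  equal norm, cleared of denominators.\<close>

lemma bessel_imul: "(e \<bullet> a)\<^sup>2 + (e \<bullet> imul a)\<^sup>2 \<le> (norm e)\<^sup>2 * (norm a)\<^sup>2"
proof (cases "a = 0")
  case False
  define n where "n = (norm a)\<^sup>2"
  have n: "n > 0" using False by (simp add: n_def)
  have aa: "a \<bullet> a = n" "imul a \<bullet> imul a = n" "imul a \<bullet> a = 0" "a \<bullet> imul a = 0"
    using norm_imul[of a] by (auto simp: n_def power2_norm_eq_inner inner_commute)
  define s t where "s = e \<bullet> a" and "t = e \<bullet> imul a"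
  have st: "a \<bullet> e = s" "imul a \<bullet> e = t" by (auto simp: s_def t_def inner_commute)
  have "0 \<le> (n *\<^sub>R e - s *\<^sub>R a - t *\<^sub>R imul a) \<bullet> (n *\<^sub>R e - s *\<^sub>R a - t *\<^sub>R imul a)" by simp
  also have "\<dots> = n * (n * (e \<bullet> e) - s\<^sup>2 - t\<^sup>2)"
    by (simp add: inner_diff_left inner_diff_right aa st s_def[symmetric] t_def[symmetric]) (simp add: algebra_simps power2_eq_square)
  finally have "0 \<le> n * (e \<bullet> e) - s\<^sup>2 - t\<^sup>2" using n by (simp add: zero_le_mult_iff)
  then show ?thesis by (simp add: s_def t_def n_def power2_norm_eq_inner mult.commute)
qed (simp add: imul_def flip: zero_prod_def)

text \<open>The left side is the Laplacian of \<open>cutlog (|q|^2)\<close> along a disc, with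
  \<open>e\<close> the position \<open>q\<close> and \<open>a\<close>, \<open>b\<close>,
  \<open>\<Lambda>\<close> the partial derivatives and the Laplacian of \<open>q\<close>. For
  \<open>b = imul a\<close> the square root leaves a positive term \<open>4 / |e|\<close>; since the
  error in \<open>b\<close> carries the factor \<open>|e|\<close>, all errors are of order
  \<open>\<epsilon> / |e|\<close> and are absorbed.\<close>

lemma lap_cutlog_lower:
  fixes e a b \<Lambda> :: "complex \<times> complex" and \<epsilon> :: real
  assumes eps: "0 \<le> \<epsilon>" "\<epsilon> \<le> 1/10000" and y: "0 < norm e" "norm e < 1"
    and b: "norm (b - imul a) \<le> 8 * \<epsilon> * norm e * norm a" and \<Lambda>: "norm \<Lambda> \<le> 32 * \<epsilon> * (norm a)\<^sup>2"
  shows "2 * cutlog1 (e \<bullet> e) * (a \<bullet> a + b \<bullet> b + e \<bullet> \<Lambda>) + 4 * cutlog2 (e \<bullet> e) * ((e \<bullet> a)\<^sup>2 + (e \<bullet> b)\<^sup>2) \<ge> - 28 * (norm a)\<^sup>2"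
proof -
  define y where "y = norm e"
  have y01: "0 < y" "y < 1" using y by (auto simp: y_def)
  have ee: "e \<bullet> e = y^2" by (simp add: y_def power2_norm_eq_inner)
  have sq: "sqrt (y^2) = y" using y01 by simp
  have ylt: "y^2 < 1" using y01 by (simp add: power_less_one_iff)
  define k1 k2 where "k1 = cutlog1 (e \<bullet> e)" and "k2 = cutlog2 (e \<bullet> e)"
  have k1: "k1 = 1/y^2 + 2/y - 7 + 4*y" using ylt sq by (simp add: k1_def cutlog1_def ee)
  have k2: "k2 = - 1/y^4 - 1/y^3 + 2/y" using ylt sq
    by (simp add: k2_def cutlog2_def ee power2_eq_square power3_eq_cube power4_eq_xxxx)
  have k1f: "k1 = (1 + 4*y)*(1-y)^2 / y^2" unfolding k1 using y01 by (simp add: field_simps power2_eq_square)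
  have k1pos: "k1 \<ge> 0" unfolding k1f using y01 by simp
  have iy: "1 \<le> 1/y" using y01 by simp
  have k1low: "k1 \<ge> 1/y - 7"
  proof -
    have "1/y^2 \<ge> 0" "2/y \<ge> 1/y" using y01 by (auto simp: field_simps)
    then show ?thesis unfolding k1 using y01 by linarith
  qed
  \<comment> \<open>The terms \<open>1/y^2\<close> of the logarithm cancel, which is its harmonicity
    on complex lines through the origin; \<open>1/y\<close> survives from the square root.\<close>
  have k12: "k1 + y^2 * k2 = 1/y - 7 + 6*y" unfolding k1 k2 using y01
    by (simp add: field_simps power2_eq_square power3_eq_cube power4_eq_xxxx)
  have k1y: "k1 * y \<le> 5/y"
  proof -
    have "(1 + 4*y)*(1-y)^2 \<le> 5 * 1" by (intro mult_mono) (use y01 in \<open>auto simp: power_le_one\<close>)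
    moreover have "k1 * y = ((1 + 4*y)*(1-y)^2)/y" unfolding k1f using y01 by (simp add: field_simps power2_eq_square)
    ultimately show ?thesis using y01 by (simp add: divide_right_mono)
  qed
  have k2y: "\<bar>k2\<bar> * y^3 \<le> 4/y"
  proof -
    have e1: "k2 * y^3 = - 1/y - 1 + 2*y^2" unfolding k2 using y01
      by (simp add: field_simps power2_eq_square power3_eq_cube power4_eq_xxxx)
    have "0 \<le> y^2" by simp
    moreover have "4/y = 4 * (1/y)" "- 1/y = - (1/y)" by simp_all
    ultimately have "\<bar>k2 * y^3\<bar> \<le> 4/y" unfolding e1 using iy ylt by linarith
    then show ?thesis using y01 by (simp add: abs_mult)
  qed
  define n where "n = norm a"
  have n0: "n \<ge> 0" by (simp add: n_def)
  have db: "norm (b - imul a) \<le> 8*\<epsilon>*y*n" using b by (simp add: y_def n_def)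
  have ey: "\<epsilon> * y \<le> 1/10000 * 1" using eps y01 by (intro mult_mono) auto
  have "8*\<epsilon>*y*n \<le> 8*(1/10000)*n" using mult_right_mono[OF ey n0] by simp
  then have db': "norm (b - imul a) \<le> n" using db n0 by linarith
  have nb: "norm b \<le> 2*n" using norm_triangle_ineq[of "b - imul a" "imul a"] db' by (simp add: n_def)
  have nsum: "norm (b + imul a) \<le> 3*n" using norm_triangle_ineq[of b "imul a"] nb by (simp add: n_def)
  have bb: "\<bar>b \<bullet> b - n^2\<bar> \<le> 24*\<epsilon>*y*n^2"
  proof -
    have "b \<bullet> b - n^2 = (b - imul a) \<bullet> (b + imul a)"
      by (simp add: inner_diff_left inner_diff_right inner_add_right n_def power2_norm_eq_inner inner_commute)
    also have "\<bar>\<dots>\<bar> \<le> norm (b - imul a) * norm (b + imul a)" by (rule Cauchy_Schwarz_ineq2)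
    also have "\<dots> \<le> (8*\<epsilon>*y*n) * (3*n)" using db nsum eps y01 n0 by (intro mult_mono) auto
    finally show ?thesis by (simp add: power2_eq_square algebra_simps)
  qed
  have eL: "\<bar>e \<bullet> \<Lambda>\<bar> \<le> 32*\<epsilon>*y*n^2"
  proof -
    have "\<bar>e \<bullet> \<Lambda>\<bar> \<le> y * norm \<Lambda>" unfolding y_def by (rule Cauchy_Schwarz_ineq2)
    also have "\<dots> \<le> y * (32*\<epsilon>*n^2)" using \<Lambda> y01 by (intro mult_left_mono) (auto simp: n_def)
    finally show ?thesis by (simp add: algebra_simps)
  qed
  define s0 s1 where "s0 = (e \<bullet> a)\<^sup>2 + (e \<bullet> imul a)\<^sup>2" and "s1 = (e \<bullet> a)\<^sup>2 + (e \<bullet> b)\<^sup>2"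
  have s0: "0 \<le> s0" "s0 \<le> y^2 * n^2" unfolding s0_def y_def n_def using bessel_imul[of e a] by auto
  have s1: "\<bar>s1 - s0\<bar> \<le> 24*\<epsilon>*y^3*n^2"
  proof -
    have "s1 - s0 = (e \<bullet> (b - imul a)) * (e \<bullet> (b + imul a))"
      unfolding s0_def s1_def by (simp add: inner_diff_right inner_add_right power2_eq_square algebra_simps)
    also have "\<bar>\<dots>\<bar> \<le> (y * norm (b - imul a)) * (y * norm (b + imul a))"
      unfolding abs_mult y_def by (intro mult_mono Cauchy_Schwarz_ineq2) auto
    also have "\<dots> \<le> (y * (8*\<epsilon>*y*n)) * (y * (3*n))"
      using db nsum eps y01 n0 by (intro mult_mono) auto
    finally show ?thesis by (simp add: power2_eq_square power3_eq_cube algebra_simps)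
  qed
  \<comment> \<open>For negative \<open>k2\<close> the worst case is Bessel's bound on
    \<open>s0\<close>, which leads to \<open>k1 + y^2 * k2\<close>; otherwise the second summand is
    dropped.\<close>
  have main: "4 * k1 * n^2 + 4 * k2 * s0 \<ge> 4 * n^2 * (1/y - 7)"
  proof (cases "k2 \<ge> 0")
    case True
    have "k1 * n^2 \<ge> (1/y - 7) * n^2" using k1low by (intro mult_right_mono) auto
    moreover have "k2 * s0 \<ge> 0" using True s0 by simp
    ultimately show ?thesis by (simp add: algebra_simps)
  next
    case False
    have "k2 * s0 \<ge> k2 * (y^2*n^2)" using False s0 by (intro mult_left_mono_neg) auto
    then have "k1 * n^2 + k2 * s0 \<ge> n^2 * (k1 + y^2*k2)" by (simp add: algebra_simps)
    moreover have "n^2 * (k1 + y^2*k2) \<ge> n^2 * (1/y - 7)" unfolding k12 using y01 by (intro mult_left_mono) auto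
    ultimately have "k1 * n^2 + k2 * s0 \<ge> n^2 * (1/y - 7)" by linarith
    then show ?thesis by (simp add: algebra_simps)
  qed
  have e1: "2 * k1 * (a \<bullet> a + b \<bullet> b + e \<bullet> \<Lambda>) \<ge> 4 * k1 * n^2 - 560 * \<epsilon> / y * n^2"
  proof -
    have "a \<bullet> a = n^2" by (simp add: n_def power2_norm_eq_inner)
    then have "a \<bullet> a + b \<bullet> b + e \<bullet> \<Lambda> \<ge> 2*n^2 - 56*\<epsilon>*y*n^2" using bb eL by linarith
    then have "2 * k1 * (a \<bullet> a + b \<bullet> b + e \<bullet> \<Lambda>) \<ge> 2 * k1 * (2*n^2 - 56*\<epsilon>*y*n^2)" using k1pos by (intro mult_left_mono) auto
    moreover have "2 * k1 * (56*\<epsilon>*y*n^2) \<le> 560 * \<epsilon> / y * n^2"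
    proof -
      have "(k1 * y) * (112 * \<epsilon> * n^2) \<le> (5/y) * (112 * \<epsilon> * n^2)" using k1y eps by (intro mult_right_mono) auto
      then show ?thesis by (simp add: algebra_simps)
    qed
    ultimately show ?thesis by (simp add: algebra_simps)
  qed
  have e2: "4 * k2 * s1 \<ge> 4 * k2 * s0 - 384 * \<epsilon> / y * n^2"
  proof -
    have "\<bar>k2 * (s1 - s0)\<bar> \<le> \<bar>k2\<bar> * (24*\<epsilon>*y^3*n^2)" unfolding abs_mult using s1 by (intro mult_left_mono) auto
    also have "\<dots> = (\<bar>k2\<bar> * y^3) * (24*\<epsilon>*n^2)" by (simp add: algebra_simps)
    also have "\<dots> \<le> (4/y) * (24*\<epsilon>*n^2)" using k2y eps by (intro mult_right_mono) auto
    finally have "\<bar>k2 * s1 - k2 * s0\<bar> \<le> 96 * \<epsilon> / y * n^2" by (simp add: algebra_simps)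
    then show ?thesis by linarith
  qed
  \<comment> \<open>The errors total \<open>560 + 384 = 944\<close>, and
    \<open>944 * \<epsilon>\<close> is below 4, the coefficient of \<open>n^2 / y\<close> in
    \<open>main\<close>. What is left is \<open>4\<close> times \<open>- 7\<close>.\<close>
  define q where "q = \<epsilon> / y * n^2"
  have "(944 * \<epsilon>) * (n^2/y) \<le> 4 * (n^2/y)" using eps y01 by (intro mult_right_mono) auto
  then have "944 * q \<le> 4 * (n^2/y)" by (simp add: q_def)
  moreover have "4 * n^2 * (1/y - 7) = 4 * (n^2/y) - 28 * n^2" by (simp add: algebra_simps)
  moreover have "560 * \<epsilon> / y * n^2 = 560 * q" "384 * \<epsilon> / y * n^2 = 384 * q" by (simp_all add: q_def)
  ultimately have "2 * k1 * (a \<bullet> a + b \<bullet> b + e \<bullet> \<Lambda>) + 4 * k2 * s1 \<ge> - 28 * n^2"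
    using main e1 e2 by linarith
  then show ?thesis unfolding k1_def k2_def s1_def n_def .
qed

subsection \<open>Homogeneous subharmonic polynomials\<close>

text \<open>Truncated subtraction in the exponents is harmless: in those cases the factor
  \<open>j * (j - 1)\<close> or its counterpart for \<open>n - j\<close> is zero.\<close>

definition lap_poly :: "(nat \<Rightarrow> real) \<Rightarrow> nat \<Rightarrow> real \<Rightarrow> real \<Rightarrow> real" where
  "lap_poly c n x y = (\<Sum>j\<le>n. c j * (real j * real (j - 1) * x ^ (j - 2) * y ^ (n - j)
     + real (n - j) * real (n - j - 1) * x ^ j * y ^ (n - j - 2)))"

lemma laplacian_hpoly: "laplacian (hpoly c n) z = lap_poly c n (Re z) (Im z)"
proof -
  have p: "((\<lambda>t. (a + t) ^ k) has_field_derivative real k * (a + t) ^ (k - 1)) (at t)" for a t :: real and k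
    by (auto intro!: derivative_eq_intros)
  have p2: "((\<lambda>t. real k * (a + t) ^ (k - 1)) has_field_derivative real k * real (k - 1) * (a + t) ^ (k - 2)) (at t)" for a t :: real and k
    using DERIV_cmult[OF p[of a "k - 1" t], of "real k"] by (simp add: numeral_2_eq_2 mult.assoc)
  define fx where "fx = (\<lambda>t. \<Sum>j\<le>n. c j * (real j * (Re z + t) ^ (j - 1)) * Im z ^ (n - j))"
  define fy where "fy = (\<lambda>t. \<Sum>j\<le>n. c j * Re z ^ j * (real (n - j) * (Im z + t) ^ (n - j - 1)))"
  have "((\<lambda>t. hpoly c n (z + of_real t)) has_field_derivative fx t) (at t)" for t
  proof -
    have e: "Re (z + of_real t) = Re z + t" "Im (z + of_real t) = Im z" for t by simp_all
    show ?thesis unfolding hpoly_def fx_def e by (intro DERIV_sum DERIV_cmult DERIV_cmult_right p)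
  qed
  then have dx: "deriv (\<lambda>t. hpoly c n (z + of_real t)) = fx" using DERIV_imp_deriv by blast
  have "(fx has_field_derivative (\<Sum>j\<le>n. c j * (real j * real (j - 1) * (Re z + 0) ^ (j - 2)) * Im z ^ (n - j))) (at 0)"
    unfolding fx_def by (intro DERIV_sum DERIV_cmult DERIV_cmult_right p2)
  then have ddx: "deriv fx 0 = (\<Sum>j\<le>n. c j * (real j * real (j - 1) * Re z ^ (j - 2)) * Im z ^ (n - j))"
    using DERIV_imp_deriv by force
  have "((\<lambda>t. hpoly c n (z + \<i> * of_real t)) has_field_derivative fy t) (at t)" for t
  proof -
    have e: "Re (z + \<i> * of_real t) = Re z" "Im (z + \<i> * of_real t) = Im z + t" for t by simp_all
    show ?thesis unfolding hpoly_def fy_def e by (intro DERIV_sum DERIV_cmult DERIV_cmult_right p)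
  qed
  then have dy: "deriv (\<lambda>t. hpoly c n (z + \<i> * of_real t)) = fy" using DERIV_imp_deriv by blast
  have "(fy has_field_derivative (\<Sum>j\<le>n. c j * Re z ^ j * (real (n - j) * real (n - j - 1) * (Im z + 0) ^ (n - j - 2)))) (at 0)"
    unfolding fy_def by (intro DERIV_sum DERIV_cmult DERIV_cmult_right p2)
  then have ddy: "deriv fy 0 = (\<Sum>j\<le>n. c j * Re z ^ j * (real (n - j) * real (n - j - 1) * Im z ^ (n - j - 2)))"
    using DERIV_imp_deriv by force
  show ?thesis
    unfolding laplacian_def dx dy ddx ddy lap_poly_def sum.distrib[symmetric]
    by (rule sum.cong) (auto simp: algebra_simps)
qed

text \<open>Collecting powers exhibits the Laplacian as a form of degree \<open>n\<close>; a
  Laplacian that is not identically zero then has a nonzero coefficient, as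
  \<open>finite_zeros_form\<close> asks.\<close>

lemma lap_poly_coeffs:
  "lap_poly c (Suc (Suc n)) x y
    = (\<Sum>j\<le>n. (c (j + 2) * real ((j + 2) * (j + 1)) + c j * real ((n + 2 - j) * (n + 1 - j))) * x ^ j * y ^ (n - j))"
proof -
  have 1: "(\<Sum>j\<le>Suc (Suc n). c j * (real j * real (j - 1) * x ^ (j - 2) * y ^ (Suc (Suc n) - j)))
     = (\<Sum>j\<le>n. c (j + 2) * real ((j + 2) * (j + 1)) * x ^ j * y ^ (n - j))"
    unfolding sum.atMost_Suc_shift by (auto simp: algebra_simps intro!: sum.cong)
  have 2: "(\<Sum>j\<le>Suc (Suc n). c j * (real (Suc (Suc n) - j) * real (Suc (Suc n) - j - 1) * x ^ j * y ^ (Suc (Suc n) - j - 2)))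
     = (\<Sum>j\<le>n. c j * real ((n + 2 - j) * (n + 1 - j)) * x ^ j * y ^ (n - j))"
  proof -
    define g where "g = (\<lambda>j. c j * (real (Suc (Suc n) - j) * real (Suc (Suc n) - j - 1) * x ^ j * y ^ (Suc (Suc n) - j - 2)))"
    have "(\<Sum>j\<le>Suc (Suc n). g j) = (\<Sum>j\<le>n. g j) + g (Suc n) + g (Suc (Suc n))" by simp
    also have "\<dots> = (\<Sum>j\<le>n. g j)" by (simp add: g_def)
    also have "\<dots> = (\<Sum>j\<le>n. c j * real ((n + 2 - j) * (n + 1 - j)) * x ^ j * y ^ (n - j))"
    proof (rule sum.cong)
      fix j
      have e: "Suc (Suc n) - j - 2 = n - j" "Suc (Suc n) - j - 1 = n + 1 - j" "Suc (Suc n) - j = n + 2 - j" by auto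
      show "g j = c j * real ((n + 2 - j) * (n + 1 - j)) * x ^ j * y ^ (n - j)"
        unfolding g_def e(1,2) unfolding e(3) of_nat_mult by (simp only: mult.assoc)
    qed simp
    finally show ?thesis unfolding g_def .
  qed
  have "lap_poly c (Suc (Suc n)) x y = (\<Sum>j\<le>Suc (Suc n). c j * (real j * real (j - 1) * x ^ (j - 2) * y ^ (Suc (Suc n) - j)))
     + (\<Sum>j\<le>Suc (Suc n). c j * (real (Suc (Suc n) - j) * real (Suc (Suc n) - j - 1) * x ^ j * y ^ (Suc (Suc n) - j - 2)))"
    unfolding lap_poly_def sum.distrib[symmetric] by (rule sum.cong) (simp_all only: distrib_left)
  then show ?thesis unfolding 1 2 sum.distrib[symmetric] by (simp only: distrib_right)
qed

text \<open>Off the real axis a zero is determined up to sign by the slope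
  \<open>Re u / Im u\<close>, which is a root of the nonzero polynomial with the same
  coefficients.\<close>

lemma finite_zeros_form:
  assumes e: "\<exists>j\<le>n. e j \<noteq> (0::real)"
  shows "finite {u :: complex. norm u = 1 \<and> (\<Sum>j\<le>n. e j * Re u ^ j * Im u ^ (n - j)) = 0}" (is "finite ?Z")
proof -
  define R where "R = {x. (\<Sum>j\<le>n. e j * x ^ j) = 0}"
  have "finite R" unfolding R_def using e by (subst polyfun_finite_roots) auto
  define S where "S = (\<lambda>r. let s = 1 / sqrt (1 + r^2) in {Complex (r * s) s, Complex (r * (- s)) (- s)})"
  have "?Z \<subseteq> {1, -1} \<union> (\<Union>r\<in>R. S r)"
  proof
    fix u assume "u \<in> ?Z"
    then have u: "norm u = 1" "(\<Sum>j\<le>n. e j * Re u ^ j * Im u ^ (n - j)) = 0" by auto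
    have n1: "(Re u)^2 + (Im u)^2 = 1" using u(1) by (metis cmod_power2 power_one)
    show "u \<in> {1, -1} \<union> (\<Union>r\<in>R. S r)"
    proof (cases "Im u = 0")
      case True
      then have "Re u = 1 \<or> Re u = -1" using n1 by (simp add: power2_eq_1_iff)
      then show ?thesis using True by (auto simp: complex_eq_iff)
    next
      case False
      define r where "r = Re u / Im u"
      have re: "Re u = r * Im u" using False by (simp add: r_def)
      have "(\<Sum>j\<le>n. e j * Re u ^ j * Im u ^ (n - j)) = Im u ^ n * (\<Sum>j\<le>n. e j * r ^ j)"
        unfolding sum_distrib_left
      proof (rule sum.cong)
        fix j assume "j \<in> {..n}"
        then have "Im u ^ n = Im u ^ j * Im u ^ (n - j)" by (simp flip: power_add)
        then show "e j * Re u ^ j * Im u ^ (n - j) = Im u ^ n * (e j * r ^ j)"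
          unfolding re by (simp add: power_mult_distrib)
      qed simp
      then have "r \<in> R" using u(2) False by (simp add: R_def)
      have "(1 + r^2) * (Im u)^2 = 1" using n1 unfolding re by (simp add: power_mult_distrib algebra_simps)
      moreover have r2: "1 + r^2 > 0" by (simp add: add_pos_nonneg)
      ultimately have "(Im u)^2 = 1 / (1 + r^2)" by (simp add: eq_divide_eq mult.commute)
      also have "\<dots> = (1 / sqrt (1 + r^2))^2" using r2 by (simp add: power_divide)
      finally have "(Im u)^2 = (1 / sqrt (1 + r^2))^2" .
      then have "Im u = 1 / sqrt (1 + r^2) \<or> Im u = - (1 / sqrt (1 + r^2))" by (simp only: power2_eq_iff)
      then have "u \<in> S r" unfolding S_def Let_def using re by (auto simp: complex_eq_iff)
      then show ?thesis using \<open>r \<in> R\<close> by auto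
    qed
  qed
  moreover have "finite ({1, -1} \<union> (\<Union>r\<in>R. S r))" using \<open>finite R\<close> by (auto simp: S_def Let_def)
  ultimately show ?thesis by (rule finite_subset)
qed

section \<open>The Laplacian in polar coordinates\<close>

lemma DERIV_cos_sin_power:
  "((\<lambda>t. cos t ^ j * sin t ^ l) has_field_derivative
     (- real j * (cos t ^ (j - 1) * sin t ^ (l + 1)) + real l * (cos t ^ (j + 1) * sin t ^ (l - 1)))) (at t)"
  by (auto intro!: derivative_eq_intros simp: algebra_simps)

text \<open>Eliminating the surplus squares by \<open>sin^2 + cos^2 = 1\<close> splits the second
  angular derivative into the Laplacian of the monomial on the circle and multiples of the monomial,
  which add up to \<open>- (j + l)^2\<close>.\<close>

lemma DERIV2_cos_sin_power:
  fixes t :: real and j l :: nat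
  defines "T \<equiv> (real j * real (j - 1) * cos t ^ (j - 2) * sin t ^ l + real l * real (l - 1) * cos t ^ j * sin t ^ (l - 2))
      - (real (j + l))\<^sup>2 * (cos t ^ j * sin t ^ l)"
  shows "((\<lambda>t. - real j * (cos t ^ (j - 1) * sin t ^ (l + 1)) + real l * (cos t ^ (j + 1) * sin t ^ (l - 1))) has_field_derivative T) (at t)"
proof -
  let ?c = "cos t" and ?s = "sin t"
  have s2: "?s * ?s = 1 - ?c * ?c" using sin_cos_squared_add[of t] by (simp add: power2_eq_square)
  have "((\<lambda>t. - real j * (cos t ^ (j - 1) * sin t ^ (l + 1)) + real l * (cos t ^ (j + 1) * sin t ^ (l - 1))) has_field_derivative
     - real j * (- real (j - 1) * (?c ^ (j - 1 - 1) * ?s ^ (l + 1 + 1)) + real (l + 1) * (?c ^ (j - 1 + 1) * ?s ^ (l + 1 - 1)))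
     + real l * (- real (j + 1) * (?c ^ (j + 1 - 1) * ?s ^ (l - 1 + 1)) + real (l - 1) * (?c ^ (j + 1 + 1) * ?s ^ (l - 1 - 1)))) (at t)"
    by (intro DERIV_add DERIV_cmult DERIV_cos_sin_power)
  moreover have "- real j * (- real (j - 1) * (?c ^ (j - 1 - 1) * ?s ^ (l + 1 + 1)) + real (l + 1) * (?c ^ (j - 1 + 1) * ?s ^ (l + 1 - 1)))
     + real l * (- real (j + 1) * (?c ^ (j + 1 - 1) * ?s ^ (l - 1 + 1)) + real (l - 1) * (?c ^ (j + 1 + 1) * ?s ^ (l - 1 - 1))) = T"
  proof -
    have A: "real j * real (j - 1) * (?c ^ (j - 1 - 1) * ?s ^ (l + 1 + 1)) =
       real j * real (j - 1) * ?c ^ (j - 2) * ?s ^ l - real j * real (j - 1) * (?c ^ j * ?s ^ l)"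
    \<comment> \<open>For \<open>j < 2\<close> the exponents truncate, but then the coefficient
      \<open>j * (j - 1)\<close> is zero.\<close>
    proof (cases "j \<ge> 2")
      case True
      then obtain i where i: "j = i + 2" using le_Suc_ex by (metis add.commute)
      have "?c ^ i * ?s ^ (l + 2) = ?c ^ i * ?s ^ l * (?s * ?s)" by (simp only: power_add power2_eq_square mult.assoc)
      also have "\<dots> = ?c ^ i * ?s ^ l - ?c ^ (i + 2) * ?s ^ l" unfolding s2 by (simp only: power_add power2_eq_square right_diff_distrib mult_1_right ac_simps)
      finally have *: "?c ^ i * ?s ^ (l + 2) = ?c ^ i * ?s ^ l - ?c ^ (i + 2) * ?s ^ l" .
      have "real j * real (j - 1) * (?c ^ (j - 1 - 1) * ?s ^ (l + 1 + 1)) = real j * real (j - 1) * (?c ^ i * ?s ^ (l + 2))"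
        unfolding i by simp
      also have "\<dots> = real j * real (j - 1) * ?c ^ (j - 2) * ?s ^ l - real j * real (j - 1) * (?c ^ j * ?s ^ l)"
        unfolding * unfolding i by (simp only: right_diff_distrib mult.assoc diff_add_inverse2)
      finally show ?thesis .
    next
      case False
      then have "j = 0 \<or> j = 1" by linarith
      then show ?thesis by auto
    qed
    have c2: "?c * ?c = 1 - ?s * ?s" using s2 by simp
    have B: "real l * real (l - 1) * (?c ^ (j + 1 + 1) * ?s ^ (l - 1 - 1)) =
       real l * real (l - 1) * ?c ^ j * ?s ^ (l - 2) - real l * real (l - 1) * (?c ^ j * ?s ^ l)"
    proof (cases "l \<ge> 2")
      case True
      then obtain i where i: "l = i + 2" using le_Suc_ex by (metis add.commute)
      have "?c ^ (j + 2) * ?s ^ i = ?c ^ j * ?s ^ i * (?c * ?c)" by (simp only: power_add power2_eq_square ac_simps)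
      also have "\<dots> = ?c ^ j * ?s ^ i - ?c ^ j * ?s ^ (i + 2)" unfolding c2 by (simp only: power_add power2_eq_square right_diff_distrib mult_1_right ac_simps)
      finally have *: "?c ^ (j + 2) * ?s ^ i = ?c ^ j * ?s ^ i - ?c ^ j * ?s ^ (i + 2)" .
      have "real l * real (l - 1) * (?c ^ (j + 1 + 1) * ?s ^ (l - 1 - 1)) = real l * real (l - 1) * (?c ^ (j + 2) * ?s ^ i)"
        unfolding i by simp
      also have "\<dots> = real l * real (l - 1) * ?c ^ j * ?s ^ (l - 2) - real l * real (l - 1) * (?c ^ j * ?s ^ l)"
        unfolding * unfolding i by (simp only: right_diff_distrib mult.assoc diff_add_inverse2)
      finally show ?thesis .
    next
      case False
      then have "l = 0 \<or> l = 1" by linarith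
      then show ?thesis by auto
    qed
    have C: "real j * real (l + 1) * (?c ^ (j - 1 + 1) * ?s ^ (l + 1 - 1)) = real j * real (l + 1) * (?c ^ j * ?s ^ l)"
      by (cases j) auto
    have D: "real l * real (j + 1) * (?c ^ (j + 1 - 1) * ?s ^ (l - 1 + 1)) = real l * real (j + 1) * (?c ^ j * ?s ^ l)"
      by (cases l) auto
    have E: "real j * real (j - 1) + real j * real (l + 1) + real l * real (j + 1) + real l * real (l - 1) = (real (j + l))\<^sup>2"
      by (cases j; cases l) (auto simp: power2_eq_square algebra_simps)
    show ?thesis unfolding T_def E[symmetric] distrib_left mult_minus_right mult_minus_left mult.assoc[symmetric]
      using A B C D unfolding mult.assoc[symmetric] by (simp only: distrib_right)
  qed
  ultimately show ?thesis by (simp only:)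
qed

text \<open>In polar coordinates the Laplacian of \<open>r^n w(t)\<close> is
  \<open>r^(n-2) (w'' + n^2 w)\<close>. Subharmonicity thus becomes a differential inequality for
  the angular profile.\<close>

lemma hpoly_angular:
  obtains h1 h2 where "\<And>t. ((\<lambda>t. hpoly c n (cis t)) has_field_derivative h1 t) (at t)"
    "\<And>t. (h1 has_field_derivative h2 t) (at t)" "continuous_on UNIV h2"
    "\<And>t. h2 t + (real n)\<^sup>2 * hpoly c n (cis t) = lap_poly c n (cos t) (sin t)"
proof -
  define h1 where "h1 = (\<lambda>t. \<Sum>j\<le>n. c j * (- real j * (cos t ^ (j - 1) * sin t ^ (n - j + 1)) + real (n - j) * (cos t ^ (j + 1) * sin t ^ (n - j - 1))))"
  define h2 where "h2 = (\<lambda>t. \<Sum>j\<le>n. c j * ((real j * real (j - 1) * cos t ^ (j - 2) * sin t ^ (n - j) + real (n - j) * real (n - j - 1) * cos t ^ j * sin t ^ (n - j - 2))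
      - (real (j + (n - j)))\<^sup>2 * (cos t ^ j * sin t ^ (n - j))))"
  have "((\<lambda>t. hpoly c n (cis t)) has_field_derivative h1 t) (at t)" for t
    unfolding hpoly_def h1_def by (simp only: mult.assoc cis.sel) (intro DERIV_sum DERIV_cmult DERIV_cos_sin_power)
  moreover have "(h1 has_field_derivative h2 t) (at t)" for t
    unfolding h1_def h2_def by (intro DERIV_sum DERIV_cmult DERIV2_cos_sin_power)
  moreover have "continuous_on UNIV h2" unfolding h2_def by (intro continuous_intros)
  moreover have "h2 t + (real n)\<^sup>2 * hpoly c n (cis t) = lap_poly c n (cos t) (sin t)" for t
    unfolding h2_def lap_poly_def hpoly_def sum_distrib_left sum.distrib[symmetric]
    by (rule sum.cong) (auto simp: algebra_simps)
  ultimately show thesis using that by blast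
qed

lemma hpoly_homogeneous: "hpoly c n (of_real r * z) = r ^ n * hpoly c n z"
  unfolding hpoly_def sum_distrib_left
proof (rule sum.cong)
  fix j assume "j \<in> {..n}"
  then have "r ^ n = r ^ j * r ^ (n - j)" by (simp flip: power_add)
  then show "c j * Re (of_real r * z) ^ j * Im (of_real r * z) ^ (n - j) = r ^ n * (c j * Re z ^ j * Im z ^ (n - j))"
    by (simp add: power_mult_distrib)
qed simp

text \<open>A product of factors \<open>1 - Re (u * cnj \<zeta>)\<close>, one for each point of
  \<open>Z\<close>. On the circle each is \<open>1 - cos (t - a)\<close>, with a nondegenerate zero
  at which the other factors are positive. Writing the profile through \<open>cis\<close> keeps it
  periodic.\<close>

lemma angular_vanishing:
  assumes "finite Z" "\<forall>\<zeta>\<in>Z. norm \<zeta> = (1::real)"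
  shows "\<exists>F f1 f2. (\<forall>t. ((\<lambda>t. F (cis t)) has_field_derivative f1 t) (at t)) \<and> (\<forall>t. (f1 has_field_derivative f2 t) (at t)) \<and>
     continuous_on UNIV (f2 :: real \<Rightarrow> real) \<and> (\<forall>t. F (cis t) \<ge> (0::real)) \<and> (\<forall>t. cis t \<notin> Z \<longrightarrow> F (cis t) > 0) \<and>
     (\<forall>t. cis t \<in> Z \<longrightarrow> F (cis t) = 0 \<and> f1 t = 0 \<and> f2 t > 0)"
  using assms
proof (induction Z)
  case empty
  show ?case by (intro exI[of _ "\<lambda>_. 1"] exI[of _ "\<lambda>_. 0"]) auto
next
  case (insert \<zeta> Z)
  then obtain F f1 f2 where F: "\<And>t. ((\<lambda>t. F (cis t)) has_field_derivative f1 t) (at t)" "\<And>t. (f1 has_field_derivative f2 t) (at t)"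
     "continuous_on UNIV f2" "\<And>t. F (cis t) \<ge> 0" "\<And>t. cis t \<notin> Z \<Longrightarrow> F (cis t) > 0"
     "\<And>t. cis t \<in> Z \<Longrightarrow> F (cis t) = 0 \<and> f1 t = 0 \<and> f2 t > 0" by auto
  have "norm \<zeta> = 1" using insert by simp
  then obtain a where a: "\<zeta> = cis a" by (metis complex_norm_eq_1_exp_eq cis_conv_exp)
  have Zz: "\<zeta> \<notin> Z" by fact
  define k where "k = (\<lambda>u. 1 - Re (u * cnj \<zeta>))"
  have kc: "k (cis t) = 1 - cos (t - a)" for t
    unfolding k_def a by (simp add: cos_diff)
  have k0: "k (cis t) = 0 \<longleftrightarrow> cis t = \<zeta>" "k (cis t) = 0 \<Longrightarrow> sin (t - a) = 0 \<and> cos (t - a) = 1" "k (cis t) \<ge> 0" for t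
  proof -
    show s: "sin (t - a) = 0 \<and> cos (t - a) = 1" if "k (cis t) = 0"
      using that sin_cos_squared_add[of "t - a"] unfolding kc by simp
    show "k (cis t) = 0 \<longleftrightarrow> cis t = \<zeta>"
    proof
      assume "k (cis t) = 0"
      from s[OF this] have "cis (t - a) = 1" by (simp add: complex_eq_iff)
      then show "cis t = \<zeta>" unfolding a by (metis cis_divide cis_neq_zero divide_self_if eq_divide_eq_1 right_inverse_eq)
    next
      assume "cis t = \<zeta>"
      then have "cos t = cos a" "sin t = sin a" unfolding a by (auto simp: complex_eq_iff)
      then show "k (cis t) = 0" unfolding kc by (simp add: cos_diff flip: power2_eq_square)
    qed
    show "k (cis t) \<ge> 0" unfolding kc by simp
  qed
  define g1 where "g1 = (\<lambda>t. f1 t * (1 - cos (t - a)) + F (cis t) * sin (t - a))"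
  define g2 where "g2 = (\<lambda>t. f2 t * (1 - cos (t - a)) + 2 * f1 t * sin (t - a) + F (cis t) * cos (t - a))"
  have 1: "((\<lambda>t. F (cis t) * k (cis t)) has_field_derivative g1 t) (at t)" for t
  proof -
    have "((\<lambda>t. 1 - cos (t - a)) has_field_derivative sin (t - a)) (at t)" by (auto intro!: derivative_eq_intros)
    from DERIV_mult[OF F(1)[of t] this] show ?thesis unfolding kc g1_def by (simp add: algebra_simps)
  qed
  have 2: "(g1 has_field_derivative g2 t) (at t)" for t
  proof -
    have c: "((\<lambda>t. 1 - cos (t - a)) has_field_derivative sin (t - a)) (at t)" by (auto intro!: derivative_eq_intros)
    have s: "((\<lambda>t. sin (t - a)) has_field_derivative cos (t - a)) (at t)" by (auto intro!: derivative_eq_intros)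
    from DERIV_add[OF DERIV_mult[OF F(2)[of t] c] DERIV_mult[OF F(1)[of t] s]]
    show ?thesis unfolding g1_def g2_def by (simp add: algebra_simps)
  qed
  have cf: "continuous_on UNIV f1" "continuous_on UNIV (\<lambda>t. F (cis t))"
    using DERIV_continuous_on[OF has_field_derivative_at_within[OF F(2)]]
      DERIV_continuous_on[OF has_field_derivative_at_within[OF F(1)]] by simp_all
  have 3: "continuous_on UNIV g2" unfolding g2_def by (intro continuous_intros F(3) cf)
  have 4: "0 \<le> F (cis t) * k (cis t)" for t using F(4) k0(3) by simp
  have 5: "F (cis t) * k (cis t) > 0" if "cis t \<notin> insert \<zeta> Z" for t
  proof -
    have "k (cis t) \<noteq> 0" using that k0(1) by auto
    then show ?thesis using that F(5)[of t] k0(3)[of t] by simp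
  qed
  have 6: "F (cis t) * k (cis t) = 0 \<and> g1 t = 0 \<and> g2 t > 0" if t: "cis t \<in> insert \<zeta> Z" for t
  proof (cases "cis t = \<zeta>")
    case True
    then have kz: "k (cis t) = 0" using k0(1) by blast
    note s = k0(2)[OF kz]
    have "F (cis t) > 0" using F(5)[of t] True Zz by simp
    then show ?thesis using s kz unfolding g1_def g2_def by simp
  next
    case False
    then have tz: "cis t \<in> Z" using t by simp
    have "k (cis t) > 0" using False k0(1,3) by (metis order_le_less)
    then show ?thesis using F(6)[OF tz] unfolding kc g1_def g2_def by simp
  qed
  show ?case
    by (rule exI[of _ "\<lambda>u. F u * k u"], rule exI[of _ g1], rule exI[of _ g2]) (use 1 2 3 4 5 6 in blast)
qed

text \<open>Functions homogeneous of degree \<open>n\<close> with angular profile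
  \<open>\<phi>\<close>. Bounds on \<open>w1\<close> and \<open>w2\<close> are asked on one period
  only, which contains the range of the argument \<open>ang\<close>.\<close>

locale polar_fun =
  fixes n :: nat and \<phi> :: "complex \<Rightarrow> real" and w1 w2 :: "real \<Rightarrow> real" and M :: real
  assumes n: "n \<ge> 3"
    and d1: "\<And>t. ((\<lambda>t. \<phi> (cis t)) has_field_derivative w1 t) (at t)"
    and d2: "\<And>t. (w1 has_field_derivative w2 t) (at t)"
    and bound: "\<And>t. \<bar>\<phi> (cis t)\<bar> \<le> M" "\<And>t. t \<in> {-pi..pi} \<Longrightarrow> \<bar>w1 t\<bar> \<le> M" "\<And>t. t \<in> {-pi..pi} \<Longrightarrow> \<bar>w2 t\<bar> \<le> M"
begin

definition W where "W z = norm z ^ n * \<phi> (sgn z)"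
definition ang where "ang z = Im (Ln z)"
text \<open>The real and imaginary part of a local logarithm have differentials
  \<open>Re (k / z)\<close> and \<open>Im (k / z)\<close> in direction \<open>k\<close>; this
  formula and the next are the chain rule in those coordinates. At \<open>z = 0\<close> the power of
  the norm makes both vanish.\<close>

definition DW where "DW z k = norm z ^ n * (real n * \<phi> (sgn z) * Re (k / z) + w1 (ang z) * Im (k / z))"
definition D2W where "D2W z h k = norm z ^ n * (real n * Re (h / z) * (real n * \<phi> (sgn z) * Re (k / z) + w1 (ang z) * Im (k / z))
   + (real n * w1 (ang z) * Im (h / z) * Re (k / z) + w2 (ang z) * Im (h / z) * Im (k / z))
   - (real n * \<phi> (sgn z) * Re (k * h / z\<^sup>2) + w1 (ang z) * Im (k * h / z\<^sup>2)))"

lemma M0: "M \<ge> 0" using bound(1)[of 0] by linarith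

text \<open>The derivative of a function of \<open>cis t\<close> inherits its periodicity, so
  \<open>w1\<close> does not depend on the branch of the argument.\<close>

lemma w1_cis: assumes "cis s = cis t" shows "w1 s = w1 t"
proof -
  have "((\<lambda>u. \<phi> (cis (u + s))) has_field_derivative w1 s) (at 0)"
    using d1[of s] DERIV_shift[of "\<lambda>t. \<phi> (cis t)" "w1 s" 0 s] by simp
  moreover have "((\<lambda>u. \<phi> (cis (u + t))) has_field_derivative w1 t) (at 0)"
    using d1[of t] DERIV_shift[of "\<lambda>t. \<phi> (cis t)" "w1 t" 0 t] by simp
  moreover have "(\<lambda>u. \<phi> (cis (u + s))) = (\<lambda>u. \<phi> (cis (u + t)))"
    using assms by (simp flip: cis_mult)
  ultimately show ?thesis using DERIV_unique by metis
qed

lemma sgn_exp: "sgn (exp w) = cis (Im w)" for w :: complex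
  by (simp add: sgn_eq exp_eq_polar[of w] norm_mult)

lemma sgn_Ln: "z \<noteq> 0 \<Longrightarrow> sgn z = cis (ang z)"
  using sgn_exp[of "Ln z"] by (simp add: ang_def)

lemma w1_exp: "w1 (ang (exp w)) = w1 (Im w)"
  by (rule w1_cis) (metis sgn_Ln sgn_exp exp_not_eq_zero)

lemma ang_bounds: "z \<noteq> 0 \<Longrightarrow> ang z \<in> {-pi..pi}"
  using mpi_less_Im_Ln[of z] Im_Ln_le_pi[of z] by (simp add: ang_def)

context
  fixes c :: complex assumes c: "c \<noteq> 0"
begin

text \<open>\<open>Ln\<close> jumps across the negative axis. On the ball of radius
  \<open>|c|\<close> around \<open>c\<close> the quotient \<open>x / c\<close> has positive real
  part, so this branch of the logarithm is smooth there; it agrees with \<open>Ln\<close> at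
  \<open>c\<close>.\<close>

definition om where "om x = Ln (x / c) + Ln c"

lemma near: assumes "x \<in> ball c (norm c)" shows "exp (om x) = x" "x \<noteq> 0"
proof -
  show x: "x \<noteq> 0" using assms by auto
  show "exp (om x) = x" using c x by (simp add: om_def exp_add)
qed

lemma norm_near: assumes "x \<in> ball c (norm c)" shows "norm x ^ n = exp (real n * Re (om x))"
proof -
  have "norm x = exp (Re (om x))" using near[OF assms] norm_exp_eq_Re by metis
  then show ?thesis by (simp add: exp_of_nat_mult)
qed

lemma om_c: "om c = Ln c" using c by (simp add: om_def)

lemma om_der: "(om has_derivative (\<lambda>h. h / c)) (at c)"
proof -
  have "(om has_field_derivative 1 / c) (at c)"
    unfolding om_def using c by (auto intro!: derivative_eq_intros)
  then show ?thesis by (rule has_derivative_eq_rhs[OF has_field_derivative_imp_has_derivative]) auto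
qed

lemma Re_om_der: "((\<lambda>x. Re (om x)) has_derivative (\<lambda>h. Re (h / c))) (at c)"
  and Im_om_der: "((\<lambda>x. Im (om x)) has_derivative (\<lambda>h. Im (h / c))) (at c)"
  by (rule bounded_linear.has_derivative[OF bounded_linear_Re om_der] bounded_linear.has_derivative[OF bounded_linear_Im om_der])+

lemma exp_om_der: "((\<lambda>x. exp (real n * Re (om x))) has_derivative (\<lambda>h. norm c ^ n * (real n * Re (h / c)))) (at c)"
proof -
  have cc: "norm c ^ n = exp (real n * Re (om c))" using norm_near[of c] c by simp
  have "((\<lambda>x. real n * Re (om x)) has_derivative (\<lambda>h. real n * Re (h / c))) (at c)"
    by (rule has_derivative_mult_right[OF Re_om_der])
  from has_derivative_exp[OF this] show ?thesis unfolding cc by (simp add: mult.commute)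
qed

lemma comp_om_der: assumes "(f has_field_derivative f') (at (ang c))"
  shows "((\<lambda>x. f (Im (om x))) has_derivative (\<lambda>h. f' * Im (h / c))) (at c)"
proof -
  have "(f has_derivative (*) f') (at (Im (om c)))" using assms unfolding has_field_derivative_def om_c ang_def .
  from has_derivative_compose[OF Im_om_der this] show ?thesis .
qed

lemma W_der: "(W has_derivative DW c) (at c)"
proof -
  have "((\<lambda>x. exp (real n * Re (om x)) * \<phi> (cis (Im (om x)))) has_derivative
     (\<lambda>h. exp (real n * Re (om c)) * (w1 (ang c) * Im (h / c)) + norm c ^ n * (real n * Re (h / c)) * \<phi> (cis (Im (om c))))) (at c)"
    by (rule has_derivative_mult[OF exp_om_der comp_om_der[of "\<lambda>t. \<phi> (cis t)"]]) (rule d1)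
  moreover have "(\<lambda>h. exp (real n * Re (om c)) * (w1 (ang c) * Im (h / c)) + norm c ^ n * (real n * Re (h / c)) * \<phi> (cis (Im (om c)))) = DW c"
    using norm_near[of c] c sgn_Ln[OF c]
    by (intro ext) (simp add: DW_def om_c ang_def algebra_simps)
  ultimately have "((\<lambda>x. exp (real n * Re (om x)) * \<phi> (cis (Im (om x)))) has_derivative DW c) (at c)" by simp
  then show ?thesis
  proof (rule has_derivative_transform_within_open)
    fix x assume x: "x \<in> ball c (norm c)"
    show "exp (real n * Re (om x)) * \<phi> (cis (Im (om x))) = W x"
      unfolding W_def norm_near[OF x] using near[OF x] sgn_exp[of "om x"] by simp
  qed (use c in auto)
qed

lemma DW_der: "((\<lambda>x. DW x k) has_derivative (\<lambda>h. D2W c h k)) (at c)"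
proof -
  have q: "((\<lambda>x. k / x) has_derivative (\<lambda>h. - (k * h / c\<^sup>2))) (at c)"
    using c by (auto intro!: derivative_eq_intros simp: power2_eq_square field_simps)
  have qr: "((\<lambda>x. Re (k / x)) has_derivative (\<lambda>h. - Re (k * h / c\<^sup>2))) (at c)"
    using bounded_linear.has_derivative[OF bounded_linear_Re q] by simp
  have qi: "((\<lambda>x. Im (k / x)) has_derivative (\<lambda>h. - Im (k * h / c\<^sup>2))) (at c)"
    using bounded_linear.has_derivative[OF bounded_linear_Im q] by simp
  have f: "((\<lambda>x. real n * \<phi> (cis (Im (om x)))) has_derivative (\<lambda>h. real n * (w1 (ang c) * Im (h / c)))) (at c)"
    by (rule has_derivative_mult_right[OF comp_om_der[of "\<lambda>t. \<phi> (cis t)"]]) (rule d1)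
  have g: "((\<lambda>x. w1 (Im (om x))) has_derivative (\<lambda>h. w2 (ang c) * Im (h / c))) (at c)"
    by (rule comp_om_der) (rule d2)
  note all = has_derivative_mult[OF exp_om_der has_derivative_add[OF has_derivative_mult[OF f qr] has_derivative_mult[OF g qi]]]
  have e: "exp (real n * Re (om c)) = norm c ^ n" "\<phi> (cis (Im (om c))) = \<phi> (sgn c)" "w1 (Im (om c)) = w1 (ang c)"
    using norm_near[of c] c sgn_Ln[OF c] by (auto simp: om_c ang_def)
  have "((\<lambda>x. exp (real n * Re (om x)) * (real n * \<phi> (cis (Im (om x))) * Re (k / x) + w1 (Im (om x)) * Im (k / x)))
     has_derivative (\<lambda>h. D2W c h k)) (at c)"
    by (rule has_derivative_eq_rhs[OF all]) (intro ext, simp only: e D2W_def, simp only: algebra_simps)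
  then show ?thesis
  proof (rule has_derivative_transform_within_open)
    fix x assume x: "x \<in> ball c (norm c)"
    show "exp (real n * Re (om x)) * (real n * \<phi> (cis (Im (om x))) * Re (k / x) + w1 (Im (om x)) * Im (k / x)) = DW x k"
      unfolding DW_def norm_near[OF x] using near[OF x] sgn_exp[of "om x"] w1_exp[of "om x"] by simp
  qed (use c in auto)
qed

end

lemma W_bound: "\<bar>W z\<bar> \<le> M * norm z ^ n"
proof (cases "z = 0")
  case False
  then show ?thesis using bound(1)[of "ang z"]
    unfolding W_def sgn_Ln[OF False] abs_mult by (simp add: mult.commute mult_right_mono)
qed (use n in \<open>simp add: W_def zero_power\<close>)

lemma pow_split: "norm (z::complex) ^ n = norm z ^ (n - 1) * norm z" "norm z ^ n = norm z ^ (n - 2) * (norm z)\<^sup>2"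
proof -
  have "n - 1 + 1 = n" "n - 2 + 2 = n" using n by auto
  then show "norm z ^ n = norm z ^ (n - 1) * norm z" "norm z ^ n = norm z ^ (n - 2) * (norm z)\<^sup>2"
    by (metis power_add power_one_right)+
qed

lemma DW_bound: "\<bar>DW z k\<bar> \<le> (real n + 1) * M * norm z ^ (n - 1) * norm k"
proof (cases "z = 0")
  case False
  have 1: "\<bar>Re (k / z)\<bar> \<le> norm k / norm z" "\<bar>Im (k / z)\<bar> \<le> norm k / norm z"
    by (metis abs_Re_le_cmod norm_divide) (metis abs_Im_le_cmod norm_divide)
  have p: "\<bar>\<phi> (sgn z)\<bar> \<le> M" "\<bar>w1 (ang z)\<bar> \<le> M" using bound ang_bounds[OF False] sgn_Ln[OF False] by auto
  have "\<bar>real n * \<phi> (sgn z) * Re (k / z) + w1 (ang z) * Im (k / z)\<bar> \<le> real n * M * (norm k / norm z) + M * (norm k / norm z)"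
    by (rule order_trans[OF abs_triangle_ineq]) (unfold abs_mult, intro add_mono mult_mono, use 1 p M0 in auto)
  then have "\<bar>DW z k\<bar> \<le> norm z ^ n * (real n * M * (norm k / norm z) + M * (norm k / norm z))"
    unfolding DW_def abs_mult by (simp add: mult_left_mono)
  also have "\<dots> = (real n + 1) * M * norm z ^ (n - 1) * norm k"
    unfolding pow_split(1) using False by (simp add: field_simps)
  finally show ?thesis .
qed (use n M0 in \<open>simp add: DW_def zero_power\<close>)

lemma D2W_bound: "\<bar>D2W z h k\<bar> \<le> (real n + 1)\<^sup>2 * 2 * M * norm z ^ (n - 2) * norm h * norm k"
proof (cases "z = 0")
  case False
  define a b where "a = norm h / norm z" and "b = norm k / norm z"
  have ab: "a \<ge> 0" "b \<ge> 0" by (auto simp: a_def b_def)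
  have 1: "\<bar>Re (k / z)\<bar> \<le> b" "\<bar>Im (k / z)\<bar> \<le> b" "\<bar>Re (h / z)\<bar> \<le> a" "\<bar>Im (h / z)\<bar> \<le> a"
    unfolding a_def b_def norm_divide[symmetric] by (rule abs_Re_le_cmod abs_Im_le_cmod)+
  have ab': "norm (k * h / z\<^sup>2) = a * b" by (simp add: a_def b_def norm_divide norm_mult norm_power power2_eq_square)
  have 2: "\<bar>Re (k * h / z\<^sup>2)\<bar> \<le> a * b" "\<bar>Im (k * h / z\<^sup>2)\<bar> \<le> a * b"
    unfolding ab'[symmetric] by (rule abs_Re_le_cmod abs_Im_le_cmod)+
  have p: "\<bar>\<phi> (sgn z)\<bar> \<le> M" "\<bar>w1 (ang z)\<bar> \<le> M" "\<bar>w2 (ang z)\<bar> \<le> M"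
    using bound ang_bounds[OF False] sgn_Ln[OF False] by auto
  define P Q R S where "P = real n * \<phi> (sgn z)" and "Q = w1 (ang z)" and "R = w2 (ang z)" and "S = real n"
  have q: "\<bar>P\<bar> \<le> S * M" "\<bar>Q\<bar> \<le> M" "\<bar>R\<bar> \<le> M" "S \<ge> 0" using p by (auto simp: P_def Q_def R_def S_def abs_mult mult_left_mono)
  have t3: "\<bar>x * y\<bar> \<le> X * Y" if "\<bar>x\<bar> \<le> X" "\<bar>y\<bar> \<le> Y" for x y X Y :: real
    using that unfolding abs_mult by (intro mult_mono) auto
  have ta: "\<bar>x + y\<bar> \<le> X + Y" if "\<bar>x\<bar> \<le> X" "\<bar>y\<bar> \<le> Y" for x y X Y :: real using that by linarith
  have ts: "\<bar>x - y\<bar> \<le> X + Y" if "\<bar>x\<bar> \<le> X" "\<bar>y\<bar> \<le> Y" for x y X Y :: real using that by linarith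
  have qS: "\<bar>S\<bar> \<le> S" using q by simp
  have "\<bar>S * Re (h / z) * (P * Re (k / z) + Q * Im (k / z))
   + (S * Q * Im (h / z) * Re (k / z) + R * Im (h / z) * Im (k / z))
   - (P * Re (k * h / z\<^sup>2) + Q * Im (k * h / z\<^sup>2))\<bar>
    \<le> (S * a * (S * M * b + M * b) + (S * M * a * b + M * a * b)) + (S * M * (a * b) + M * (a * b))"
    by (intro ta ts t3 q(1-3) 1 2 qS)
  also have "\<dots> = (S * S + 3 * S + 2) * M * a * b" by (simp add: algebra_simps)
  also have "\<dots> \<le> ((S + 1)\<^sup>2 * 2) * M * a * b"
    using ab M0 q(4) by (intro mult_right_mono) (auto simp: power2_eq_square algebra_simps)
  finally have "\<bar>D2W z h k\<bar> \<le> norm z ^ n * (((S + 1)\<^sup>2 * 2) * M * a * b)"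
    unfolding D2W_def abs_mult P_def Q_def R_def S_def by (simp add: mult_left_mono)
  also have "\<dots> = (S + 1)\<^sup>2 * 2 * M * norm z ^ (n - 2) * norm h * norm k"
    unfolding pow_split(2) a_def b_def using False by (simp add: power2_eq_square)
  finally show ?thesis unfolding S_def .
qed (use n M0 in \<open>simp add: D2W_def zero_power\<close>)

lemma (in -) higher_order_imp_derivative_0:
  fixes f :: "complex \<Rightarrow> real"
  assumes f: "\<And>z. \<bar>f z\<bar> \<le> K * norm z ^ Suc (Suc j)"
  shows "(f has_derivative (\<lambda>h. 0)) (at 0)"
proof -
  have f0: "f 0 = 0" using f[of 0] by simp
  have K: "K \<ge> 0" using f[of 1] by simp
  show ?thesis unfolding has_derivative_at_alt
  proof (intro conjI allI impI, simp)
    fix e :: real assume e: "e > 0"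
    show "\<exists>d>0. \<forall>y. norm (y - 0) < d \<longrightarrow> norm (f y - f 0 - 0) \<le> e * norm (y - 0)"
    proof (intro exI[of _ "min 1 (e / (K + 1))"] conjI allI impI)
      show "min 1 (e / (K + 1)) > 0" using e K by simp
      fix y :: complex assume y: "norm (y - 0) < min 1 (e / (K + 1))"
      have y1: "norm y \<le> 1" "norm y \<le> e / (K + 1)" using y by auto
      have "norm y ^ Suc (Suc j) = norm y ^ j * norm y * norm y" by simp
      also have "\<dots> \<le> 1 * (e / (K + 1)) * norm y"
        using y1 e K by (intro mult_mono) (auto simp: power_le_one)
      finally have "K * norm y ^ Suc (Suc j) \<le> K * (1 * (e / (K + 1)) * norm y)"
        using K by (intro mult_left_mono)
      also have "\<dots> = (K / (K + 1)) * (e * norm y)" by simp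
      also have "\<dots> \<le> 1 * (e * norm y)" using K e by (intro mult_right_mono) auto
      finally show "norm (f y - f 0 - 0) \<le> e * norm (y - 0)" using f[of y] f0 by simp
    qed
  qed
qed

lemma W_has_derivative: "(W has_derivative DW z) (at z)"
proof (cases "z = 0")
  case True
  have "DW 0 = (\<lambda>h. 0)" using n by (auto simp: DW_def zero_power)
  moreover have "n = Suc (Suc (n - 2))" using n by simp
  then have "(W has_derivative (\<lambda>h. 0)) (at 0)"
    using W_bound by (intro higher_order_imp_derivative_0[of W M "n - 2"]) simp
  ultimately show ?thesis using True by simp
qed (rule W_der)

text \<open>At the origin no logarithm is available; instead \<open>DW\<close> is of order
  \<open>n - 1 >= 2\<close> there, and this is where \<open>n >= 3\<close> enters.\<close>

lemma DW_has_derivative: "((\<lambda>x. DW x k) has_derivative (\<lambda>h. D2W z h k)) (at z)"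
proof (cases "z = 0")
  case True
  have "(\<lambda>h. D2W 0 h k) = (\<lambda>h. 0)" using n by (auto simp: D2W_def zero_power)
  moreover have j: "n - 1 = Suc (Suc (n - 3))" using n by simp
  have "\<bar>DW z k\<bar> \<le> ((real n + 1) * M * norm k) * norm z ^ Suc (Suc (n - 3))" for z
    using DW_bound[of z k] unfolding j by (simp only: ac_simps)
  then have "((\<lambda>z. DW z k) has_derivative (\<lambda>h. 0)) (at 0)"
    by (rule higher_order_imp_derivative_0)
  ultimately show ?thesis using True by simp
qed (rule DW_der)

lemma D2W_linear: "linear (D2W z h)"
proof (rule linearI)
  fix r b
  have e: "(r *\<^sub>R b) / z = r *\<^sub>R (b / z)" "(r *\<^sub>R b) * h / z\<^sup>2 = r *\<^sub>R (b * h / z\<^sup>2)"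
    by (simp_all add: scaleR_conv_of_real)
  show "D2W z h (r *\<^sub>R b) = r *\<^sub>R D2W z h b"
    unfolding D2W_def e by (simp add: algebra_simps)
qed (simp add: D2W_def add_divide_distrib algebra_simps)

text \<open>Passing from \<open>h\<close> to \<open>\<i> * h\<close> rotates \<open>h / z\<close> by
  a right angle, so the mixed terms and those in \<open>(h / z)^2\<close> cancel and the polar
  Laplacian remains.\<close>

lemma D2W_trace: assumes "z \<noteq> 0" shows "D2W z h h + D2W z (\<i> * h) (\<i> * h) = norm z ^ n * (norm (h / z))\<^sup>2 * (w2 (ang z) + (real n)\<^sup>2 * \<phi> (cis (ang z)))"
proof -
  define q where "q = h / z"
  have e: "\<i> * h / z = \<i> * q" "h / z = q" "\<i> * h * (\<i> * h) / z\<^sup>2 = - (q * q)" "h * h / z\<^sup>2 = q * q"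
    by (simp_all add: q_def power2_eq_square algebra_simps)
  show ?thesis unfolding D2W_def e sgn_Ln[OF assms] cmod_power2
    by (simp add: algebra_simps power2_eq_square)
qed

end

text \<open>Where \<open>l\<close> is nonnegative, \<open>\<nu>\<close> cannot vanish; it has a
  positive minimum on that compact set, and a multiple of it dominates the maximum of
  \<open>l\<close>. Elsewhere every positive \<open>C\<close> works.\<close>

lemma compact_comparison:
  fixes l \<nu> :: "real \<Rightarrow> real"
  assumes S: "compact S" and c: "continuous_on S l" "continuous_on S \<nu>"
    and nn: "\<And>t. t \<in> S \<Longrightarrow> \<nu> t \<ge> 0" and z: "\<And>t. t \<in> S \<Longrightarrow> \<nu> t = 0 \<Longrightarrow> l t < 0"
  shows "\<exists>C>0. \<forall>t\<in>S. l t \<le> C * \<nu> t"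
proof -
  define T where "T = {t\<in>S. l t \<ge> 0}"
  have "closedin (top_of_set S) T"
    using continuous_closedin_preimage[OF c(1), of "{0..}"] unfolding T_def by (simp add: vimage_def Int_def)
  then have T: "compact T" using S closedin_compact by blast
  show ?thesis
  proof (cases "T = {}")
    case True
    then show ?thesis using nn unfolding T_def by (intro exI[of _ 1]) force
  next
    case False
    have cT: "continuous_on T l" "continuous_on T \<nu>" using c by (auto simp: T_def intro: continuous_on_subset)
    obtain a where a: "a \<in> T" "\<And>t. t \<in> T \<Longrightarrow> \<nu> a \<le> \<nu> t" using continuous_attains_inf[OF T False cT(2)] by blast
    obtain b where b: "b \<in> T" "\<And>t. t \<in> T \<Longrightarrow> l t \<le> l b" using continuous_attains_sup[OF T False cT(1)] by blast
    have pos: "\<nu> a > 0" using a(1) nn[of a] z[of a] unfolding T_def by force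
    define C where "C = l b / \<nu> a + 1"
    have C: "C > 0" using pos b(1) unfolding C_def T_def by (simp add: add_nonneg_pos)
    have "l t \<le> C * \<nu> t" if t: "t \<in> S" for t
    proof (cases "t \<in> T")
      case True
      have "l t \<le> l b" using b True by blast
      also have "\<dots> \<le> C * \<nu> a" unfolding C_def using pos by (simp add: distrib_right)
      also have "\<dots> \<le> C * \<nu> t" using C a(2)[OF True] by (simp add: mult_left_mono)
      finally show ?thesis .
    next
      case False
      then have "l t < 0" using t by (simp add: T_def)
      also have "0 \<le> C * \<nu> t" using C nn[OF t] by simp
      finally show ?thesis by simp
    qed
    then show ?thesis using C by blast
  qed
qed

text \<open>A subharmonic \<open>W\<close> below \<open>H\<close> with a gap of full homogeneity:
  where \<open>Re z2 + H z1 <= 0\<close>, the function \<open>Re z2 + W z1\<close> is at most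
  \<open>- \<epsilon> * |z1|^n\<close>. The sum of \<open>D2\<close> along \<open>h\<close> and
  \<open>\<i> * h\<close> is the Laplacian of \<open>W\<close> times \<open>|h|^2\<close>. The
  derivatives are parameters because the chain rule and the error estimates use them
  explicitly.\<close>

definition bump :: "nat \<Rightarrow> (complex \<Rightarrow> real) \<Rightarrow> real \<Rightarrow> (complex \<Rightarrow> real) \<Rightarrow> (complex \<Rightarrow> complex \<Rightarrow> real) \<Rightarrow> (complex \<Rightarrow> complex \<Rightarrow> complex \<Rightarrow> real) \<Rightarrow> real \<Rightarrow> bool" where
  "bump n H \<epsilon> W D D2 C \<longleftrightarrow>
     \<epsilon> > 0 \<and> C \<ge> 0 \<and> (\<forall>z. (W has_derivative D z) (at z)) \<and>
     (\<forall>z k. ((\<lambda>x. D x k) has_derivative (\<lambda>h. D2 z h k)) (at z)) \<and> (\<forall>z h. linear (D2 z h)) \<and>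
     (\<forall>z h. D2 z h h + D2 z (\<i> * h) (\<i> * h) \<ge> 0) \<and>
     (\<forall>z h. \<bar>D z h\<bar> \<le> C * norm z ^ (n - 1) * norm h) \<and>
     (\<forall>z h k. \<bar>D2 z h k\<bar> \<le> C * norm z ^ (n - 2) * norm h * norm k) \<and>
     (\<forall>z. W z \<le> H z - \<epsilon> * norm z ^ n) \<and> (\<forall>z. \<bar>W z\<bar> \<le> C * norm z ^ n)"

section \<open>Existence of bumpings\<close>

lemma bounded_on_circle:
  assumes "continuous_on UNIV (f :: real \<Rightarrow> real)"
  shows "\<exists>M. \<forall>t\<in>{-pi..pi}. \<bar>f t\<bar> \<le> M"
proof -
  have "continuous_on {-pi..pi} f" using assms continuous_on_subset by blast
  then have "bounded (f ` {-pi..pi})" using compact_continuous_image compact_imp_bounded compact_Icc by blast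
  then show ?thesis unfolding bounded_iff by auto
qed

lemma cis_in_circle: "\<exists>s\<in>{-pi..pi}. cis t = cis s"
proof -
  have "cis (Arg (cis t)) = cis t" using cis_Arg_unique[of "cis t"] by (metis cis_Arg cis_neq_zero sgn_cis)
  moreover have "Arg (cis t) \<in> {-pi..pi}" using Arg_bounded[of "cis t"] by auto
  ultimately show ?thesis by metis
qed

text \<open>The angular part \<open>exp (- B * F)\<close> of the function subtracted from the polynomial is
  \<open>n\<close>-trigonometrically concave near the directions in which the Laplacian vanishes.\<close>
lemma bump_exists_ge4:
  assumes n: "n \<ge> 4" and subh: "\<And>z. laplacian (hpoly h n) z \<ge> 0"
    and nh: "\<exists>z. laplacian (hpoly h n) z \<noteq> 0"
  shows "\<exists>\<epsilon> W D D2 C. bump n (hpoly h n) \<epsilon> W D D2 C"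
proof -
  obtain n' where n': "n = Suc (Suc n')" using n by (metis add_2_eq_Suc le_Suc_ex numeral_Bit0 add.assoc)
  define e where "e = (\<lambda>j. h (j + 2) * real ((j + 2) * (j + 1)) + h j * real ((n' + 2 - j) * (n' + 1 - j)))"
  have lp: "lap_poly h n x y = (\<Sum>j\<le>n'. e j * x ^ j * y ^ (n' - j))" for x y
    unfolding n' lap_poly_coeffs e_def ..
  obtain h1 h2 where h: "\<And>t. ((\<lambda>t. hpoly h n (cis t)) has_field_derivative h1 t) (at t)"
    "\<And>t. (h1 has_field_derivative h2 t) (at t)" "continuous_on UNIV h2"
    "\<And>t. h2 t + (real n)\<^sup>2 * hpoly h n (cis t) = lap_poly h n (cos t) (sin t)"
    using hpoly_angular[of h n] by blast
  define \<nu> where "\<nu> = (\<lambda>t. lap_poly h n (cos t) (sin t))"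
  have \<nu>0: "\<nu> t \<ge> 0" for t using subh[of "cis t"] unfolding laplacian_hpoly \<nu>_def by simp
  have \<nu>c: "continuous_on UNIV \<nu>" unfolding \<nu>_def lap_poly_def by (intro continuous_intros)
  define Z where "Z = {u :: complex. norm u = 1 \<and> (\<Sum>j\<le>n'. e j * Re u ^ j * Im u ^ (n' - j)) = 0}"
  have "\<exists>j\<le>n'. e j \<noteq> 0"
  proof (rule ccontr)
    assume "\<not> ?thesis"
    then have "lap_poly h n x y = 0" for x y unfolding lp by simp
    then show False using nh by (simp add: laplacian_hpoly)
  qed
  then have Zf: "finite Z" unfolding Z_def by (rule finite_zeros_form)
  have Z\<nu>: "cis t \<in> Z \<longleftrightarrow> \<nu> t = 0" for t unfolding Z_def \<nu>_def lp by simp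
  obtain F f1 f2 where F: "\<And>t. ((\<lambda>t. F (cis t)) has_field_derivative f1 t) (at t)" "\<And>t. (f1 has_field_derivative f2 t) (at t)"
     "continuous_on UNIV f2" "\<And>t. F (cis t) \<ge> 0"
     "\<And>t. cis t \<in> Z \<Longrightarrow> F (cis t) = 0 \<and> f1 t = 0 \<and> f2 t > 0"
    using angular_vanishing[OF Zf] unfolding Z_def by auto
  have Fc: "continuous_on UNIV (\<lambda>t. F (cis t))" "continuous_on UNIV f1"
    using DERIV_continuous_on[OF has_field_derivative_at_within[OF F(2)]]
      DERIV_continuous_on[OF has_field_derivative_at_within[OF F(1)]] by simp_all
  have hc: "continuous_on UNIV (\<lambda>t. hpoly h n (cis t))" "continuous_on UNIV h1"
    using DERIV_continuous_on[OF has_field_derivative_at_within[OF h(2)]]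
      DERIV_continuous_on[OF has_field_derivative_at_within[OF h(1)]] by simp_all
  \<comment> \<open>At a zero of the Laplacian \<open>F\<close> and \<open>f1\<close> vanish, so
    \<open>g = exp (- B * F)\<close> satisfies \<open>g'' + n^2 g = g (n^2 - B f2)\<close>;
    \<open>B\<close> makes this negative. The zeros in one period form a compact set on which
    \<open>f2\<close> is positive, so one \<open>B\<close> serves for all.\<close>
  obtain B where B: "B > 0" "\<And>t. t \<in> {-pi..pi} \<Longrightarrow> \<nu> t = 0 \<Longrightarrow> (real n)\<^sup>2 < B * f2 t"
  proof -
    define K where "K = {t\<in>{-pi..pi}. \<nu> t = 0}"
    have "closedin (top_of_set {-pi..pi}) K"
      using continuous_closedin_preimage[OF continuous_on_subset[OF \<nu>c subset_UNIV], of "{0}" "{-pi..pi}"]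
      unfolding K_def by (simp add: vimage_def Int_def)
    then have K: "compact K" using closedin_compact[OF compact_Icc] by blast
    have "\<exists>d>0. \<forall>t\<in>K. d \<le> f2 t"
    proof (cases "K = {}")
      case False
      then obtain a where "a \<in> K" "\<And>t. t \<in> K \<Longrightarrow> f2 a \<le> f2 t"
        using continuous_attains_inf[OF K _ continuous_on_subset[OF F(3) subset_UNIV]] by blast
      then show ?thesis using F(5) Z\<nu> unfolding K_def by blast
    qed (auto intro: exI[of _ 1])
    then obtain d where d: "d > 0" "\<And>t. t \<in> K \<Longrightarrow> d \<le> f2 t" by blast
    define B where "B = ((real n)\<^sup>2 + 1) / d"
    have B0: "B > 0" unfolding B_def using d by (intro divide_pos_pos add_nonneg_pos) auto
    have b: "(real n)\<^sup>2 < B * f2 t" if "t \<in> {-pi..pi}" "\<nu> t = 0" for t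
    proof -
      have "(real n)\<^sup>2 + 1 = B * d" using d by (simp add: B_def)
      also have "\<dots> \<le> B * f2 t" using d(2)[of t] that B0 by (intro mult_left_mono) (auto simp: K_def)
      finally show ?thesis by simp
    qed
    show thesis using that[OF B0] b by blast
  qed
  define g where "g = (\<lambda>t. exp (- B * F (cis t)))"
  define g1 where "g1 = (\<lambda>t. - B * f1 t * g t)"
  define g2 where "g2 = (\<lambda>t. g t * (B\<^sup>2 * (f1 t)\<^sup>2 - B * f2 t))"
  have gd: "(g has_field_derivative g1 t) (at t)" for t
  proof -
    have "((\<lambda>t. - B * F (cis t)) has_field_derivative - B * f1 t) (at t)" by (rule DERIV_cmult[OF F(1)])
    from DERIV_fun_exp[OF this] show ?thesis unfolding g_def g1_def by (simp add: mult.commute)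
  qed
  have g1d: "(g1 has_field_derivative g2 t) (at t)" for t
  proof -
    have "((\<lambda>t. - B * f1 t) has_field_derivative - B * f2 t) (at t)" by (rule DERIV_cmult[OF F(2)])
    from DERIV_mult[OF this gd] show ?thesis unfolding g1_def g2_def
      by (simp add: algebra_simps power2_eq_square)
  qed
  have gc: "continuous_on UNIV g" "continuous_on UNIV g1" "continuous_on UNIV g2"
    unfolding g2_def g1_def g_def by (intro continuous_intros Fc F)+
  \<comment> \<open>With this \<open>C\<close>, subtracting \<open>g / C\<close> from the angular
    profile costs at most the Laplacian \<open>\<nu>\<close>, so subharmonicity is kept.\<close>
  have "\<exists>C>0. \<forall>t\<in>{-pi..pi}. g2 t + (real n)\<^sup>2 * g t \<le> C * \<nu> t"
  proof (rule compact_comparison)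
    fix t assume t: "t \<in> {-pi..pi}" "\<nu> t = 0"
    have "f1 t = 0" using F(5)[of t] Z\<nu> t by blast
    then have "g2 t + (real n)\<^sup>2 * g t = g t * ((real n)\<^sup>2 - B * f2 t)" by (simp add: g2_def algebra_simps)
    also have "\<dots> < 0" using B(2)[OF t] by (intro mult_pos_neg) (auto simp: g_def)
    finally show "g2 t + (real n)\<^sup>2 * g t < 0" .
  qed (use \<nu>0 in \<open>auto intro!: continuous_intros intro: continuous_on_subset[OF gc(1)] continuous_on_subset[OF gc(3)] continuous_on_subset[OF \<nu>c]\<close>)
  then obtain C where C: "C > 0" "\<And>t. t \<in> {-pi..pi} \<Longrightarrow> g2 t + (real n)\<^sup>2 * g t \<le> C * \<nu> t" by blast
  obtain MF where MF: "\<And>t. t \<in> {-pi..pi} \<Longrightarrow> \<bar>F (cis t)\<bar> \<le> MF" using bounded_on_circle[OF Fc(1)] by blast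
  \<comment> \<open>As \<open>F <= MF\<close> on the circle, this is a lower bound for the
    subtracted amount \<open>g / C\<close>.\<close>
  define \<epsilon> where "\<epsilon> = exp (- B * MF) / C"
  have \<epsilon>: "\<epsilon> > 0" using C by (simp add: \<epsilon>_def)
  have gl: "g t \<ge> exp (- B * MF)" for t
  proof -
    obtain s where "s \<in> {-pi..pi}" "cis t = cis s" using cis_in_circle by blast
    then have "F (cis t) \<le> MF" using MF[of s] by simp
    then show ?thesis using B(1) by (simp add: g_def)
  qed
  define \<phi> where "\<phi> = (\<lambda>u. hpoly h n u - (1 / C) * exp (- B * F u))"
  define w1 where "w1 = (\<lambda>t. h1 t - (1 / C) * g1 t)"
  define w2 where "w2 = (\<lambda>t. h2 t - (1 / C) * g2 t)"
  have d1: "((\<lambda>t. \<phi> (cis t)) has_field_derivative w1 t) (at t)" for t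
    using DERIV_diff[OF h(1) DERIV_cmult[OF gd, of "1 / C"]] unfolding \<phi>_def w1_def g_def by simp
  have d2: "(w1 has_field_derivative w2 t) (at t)" for t
    using DERIV_diff[OF h(2) DERIV_cmult[OF g1d, of "1 / C"]] unfolding w1_def w2_def by simp
  have wc: "continuous_on UNIV (\<lambda>t. \<phi> (cis t))" "continuous_on UNIV w1" "continuous_on UNIV w2"
    using DERIV_continuous_on[OF has_field_derivative_at_within[OF d1]]
      DERIV_continuous_on[OF has_field_derivative_at_within[OF d2]]
    unfolding w2_def using C(1) by (auto intro!: continuous_intros h gc)
  obtain M0 where M0: "\<And>t. t \<in> {-pi..pi} \<Longrightarrow> \<bar>\<phi> (cis t)\<bar> \<le> M0" using bounded_on_circle[OF wc(1)] by blast
  obtain M1 where M1: "\<And>t. t \<in> {-pi..pi} \<Longrightarrow> \<bar>w1 t\<bar> \<le> M1" using bounded_on_circle[OF wc(2)] by blast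
  obtain M2 where M2: "\<And>t. t \<in> {-pi..pi} \<Longrightarrow> \<bar>w2 t\<bar> \<le> M2" using bounded_on_circle[OF wc(3)] by blast
  define M where "M = max M0 (max M1 M2)"
  interpret P: polar_fun n \<phi> w1 w2 M
  proof
    show "\<bar>\<phi> (cis t)\<bar> \<le> M" for t
    proof -
      obtain s where "s \<in> {-pi..pi}" "cis t = cis s" using cis_in_circle by blast
      then show ?thesis using M0[of s] by (simp add: M_def)
    qed
    show "\<bar>w1 t\<bar> \<le> M" "\<bar>w2 t\<bar> \<le> M" if "t \<in> {-pi..pi}" for t
      using M1[OF that] M2[OF that] by (auto simp: M_def)
  qed (use n d1 d2 in auto)
  have tr: "P.D2W z k k + P.D2W z (\<i> * k) (\<i> * k) \<ge> 0" for z k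
  proof (cases "z = 0")
    case False
    define t where "t = P.ang z"
    have t: "t \<in> {-pi..pi}" unfolding t_def by (rule P.ang_bounds[OF False])
    have "w2 t + (real n)\<^sup>2 * \<phi> (cis t) = \<nu> t - (1 / C) * (g2 t + (real n)\<^sup>2 * g t)"
      unfolding \<nu>_def h(4)[symmetric] w2_def \<phi>_def g_def by (simp add: algebra_simps)
    moreover have "(1 / C) * (g2 t + (real n)\<^sup>2 * g t) \<le> \<nu> t" using C(2)[OF t] C(1) by (simp add: pos_divide_le_eq mult.commute)
    ultimately show ?thesis unfolding P.D2W_trace[OF False] t_def[symmetric] by simp
  qed (use n in \<open>simp add: P.D2W_def zero_power\<close>)
  have up: "P.W z \<le> hpoly h n z - \<epsilon> * norm z ^ n" for z
  proof (cases "z = 0")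
    case False
    have zs: "hpoly h n z = norm z ^ n * hpoly h n (sgn z)"
      using hpoly_homogeneous[of h n "norm z" "sgn z"] by (simp add: sgn_eq)
    have "\<phi> (sgn z) \<le> hpoly h n (sgn z) - \<epsilon>"
      using gl[of "P.ang z"] C(1) unfolding \<phi>_def P.sgn_Ln[OF False] \<epsilon>_def g_def by (simp add: divide_right_mono)
    then have "norm z ^ n * \<phi> (sgn z) \<le> norm z ^ n * (hpoly h n (sgn z) - \<epsilon>)" by (rule mult_left_mono) simp
    then show ?thesis unfolding P.W_def zs by (simp add: algebra_simps)
  next
    case True
    have "hpoly h n 0 = 0" using hpoly_homogeneous[of h n 0 0] n by (simp add: zero_power)
    then show ?thesis using True n by (simp add: P.W_def zero_power)
  qed
  define CC where "CC = max M (max ((real n + 1) * M) ((real n + 1)\<^sup>2 * 2 * M))"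
  have "bump n (hpoly h n) \<epsilon> P.W P.DW P.D2W CC"
    unfolding bump_def
  proof (intro conjI allI \<epsilon> P.W_has_derivative P.DW_has_derivative P.D2W_linear tr up)
    show "CC \<ge> 0" using P.M0 by (simp add: CC_def)
    show "\<bar>P.DW z k\<bar> \<le> CC * norm z ^ (n - 1) * norm k" for z k
      by (rule order_trans[OF P.DW_bound]) (intro mult_right_mono, auto simp: CC_def)
    show "\<bar>P.D2W z h k\<bar> \<le> CC * norm z ^ (n - 2) * norm h * norm k" for z h k
      by (rule order_trans[OF P.D2W_bound]) (intro mult_right_mono, auto simp: CC_def)
    show "\<bar>P.W z\<bar> \<le> CC * norm z ^ n" for z
      by (rule order_trans[OF P.W_bound]) (intro mult_right_mono, auto simp: CC_def)
  qed
  then show ?thesis by blast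
qed

text \<open>Degree 2 lies outside \<open>polar_fun\<close>. Here the Laplacian is the constant
  \<open>4 * q\<close>, so subtracting \<open>q * |z|^2\<close> leaves a harmonic quadratic form.
  Its derivative \<open>D\<close> is bilinear and symmetric and therefore also serves as second
  derivative.\<close>

lemma bump_exists_2:
  assumes subh: "\<And>z. laplacian (hpoly h 2) z \<ge> 0" and nh: "\<exists>z. laplacian (hpoly h 2) z \<noteq> 0"
  shows "\<exists>\<epsilon> W D D2 C. bump 2 (hpoly h 2) \<epsilon> W D D2 C"
proof -
  have lap: "laplacian (hpoly h 2) z = 2 * (h 0 + h 2)" for z
    unfolding laplacian_hpoly numeral_2_eq_2 lap_poly_coeffs by simp
  define q where "q = (h 0 + h 2) / 2"
  have q: "q > 0" using subh[of 0] nh unfolding lap q_def by auto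
  have H: "hpoly h 2 z = h 0 * (Im z)\<^sup>2 + h 1 * (Re z * Im z) + h 2 * (Re z)\<^sup>2" for z
    unfolding hpoly_def by (simp add: numeral_2_eq_2)
  define a where "a = h 2 - q"
  define b where "b = h 1"
  have a: "h 0 - q = - a" by (simp add: a_def q_def field_simps)
  define W where "W = (\<lambda>z. - a * (Im z * Im z) + b * (Re z * Im z) + a * (Re z * Re z))"
  define D where "D = (\<lambda>z k. - 2 * a * (Im z * Im k) + b * (Re k * Im z + Re z * Im k) + 2 * a * (Re z * Re k))"
  have WH: "W z = hpoly h 2 z - q * norm z ^ 2" for z
  proof -
    have "hpoly h 2 z - q * norm z ^ 2 = (h 0 - q) * (Im z)\<^sup>2 + b * (Re z * Im z) + a * (Re z)\<^sup>2"
      unfolding H cmod_power2 a_def b_def by (simp add: algebra_simps)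
    then show ?thesis unfolding a W_def by (simp add: power2_eq_square)
  qed
  have d1: "(W has_derivative D z) (at z)" for z
    unfolding W_def D_def by (auto intro!: derivative_eq_intros simp: algebra_simps)
  have d2: "((\<lambda>x. D x k) has_derivative (\<lambda>h. D h k)) (at z)" for z k
    unfolding D_def by (auto intro!: derivative_eq_intros simp: algebra_simps)
  define C where "C = 4 * \<bar>a\<bar> + 2 * \<bar>b\<bar>"
  have bd: "\<bar>D z k\<bar> \<le> C * norm z * norm k" for z k
  proof -
    have 1: "\<bar>x * y\<bar> \<le> norm z * norm k" if "\<bar>x\<bar> \<le> norm z" "\<bar>y\<bar> \<le> norm k" for x y
      unfolding abs_mult using that by (intro mult_mono) auto
    have *: "\<bar>Im z * Im k\<bar> \<le> norm z * norm k" "\<bar>Im z * Re k\<bar> \<le> norm z * norm k" "\<bar>Re z * Im k\<bar> \<le> norm z * norm k" "\<bar>Re z * Re k\<bar> \<le> norm z * norm k"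
      by (intro 1 abs_Re_le_cmod abs_Im_le_cmod)+
    have e: "D z k = 2 * a * (Re z * Re k - Im z * Im k) + b * (Im z * Re k + Re z * Im k)"
      by (simp add: D_def algebra_simps)
    have "\<bar>D z k\<bar> \<le> \<bar>2 * a\<bar> * (2 * (norm z * norm k)) + \<bar>b\<bar> * (2 * (norm z * norm k))"
      unfolding e by (rule order_trans[OF abs_triangle_ineq]) (unfold abs_mult, intro add_mono mult_left_mono, use * in auto)
    then show ?thesis by (simp add: C_def abs_mult algebra_simps)
  qed
  have lin: "linear (D z)" for z by (rule has_derivative_linear[OF d1])
  have WD: "W z = D z z / 2" for z unfolding W_def D_def by (simp add: algebra_simps)
  have "bump 2 (hpoly h 2) q W D (\<lambda>z. D) C"
    unfolding bump_def
  proof (intro conjI allI q d1 d2 lin)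
    show "C \<ge> 0" by (simp add: C_def)
    show "D k k + D (\<i> * k) (\<i> * k) \<ge> 0" for k by (simp add: D_def)
    show "\<bar>D z k\<bar> \<le> C * norm z ^ (2 - 1) * norm k" for z k using bd[of z k] by simp
    show "\<bar>D h k\<bar> \<le> C * norm z ^ (2 - 2) * norm h * norm k" for z h k using bd[of h k] by simp
    show "W z \<le> hpoly h 2 z - q * norm z ^ 2" for z using WH by simp
    have c: "C * norm z ^ 2 \<ge> 0" for z :: complex by (simp add: C_def)
    show "\<bar>W z\<bar> \<le> C * norm z ^ 2" for z using bd[of z z] c[of z] unfolding WD by (simp add: power2_eq_square)
  qed
  then show ?thesis by blast
qed

lemma bump_exists:
  assumes "m \<ge> 1" "\<forall>z. laplacian (hpoly h (2*m)) z \<ge> 0" "\<exists>z. laplacian (hpoly h (2*m)) z \<noteq> 0"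
  shows "\<exists>\<epsilon> W D D2 C. bump (2*m) (hpoly h (2*m)) \<epsilon> W D D2 C"
proof (cases "m = 1")
  case True
  then show ?thesis using bump_exists_2[of h] assms by simp
next
  case False
  then show ?thesis using bump_exists_ge4[of "2*m" h] assms by simp
qed

subsection \<open>The barrier function\<close>

text \<open>For the standard structure only the last term is strictly plurisubharmonic: the first
  and third are real parts of holomorphic functions, and \<open>W\<close> is merely
  subharmonic.\<close>

definition phi :: "(complex \<Rightarrow> real) \<Rightarrow> real \<Rightarrow> real \<Rightarrow> complex \<times> complex \<Rightarrow> real" where
  "phi W lam \<kappa> x = Re (snd x) + W (fst x) + lam * Re (snd x * snd x) + \<kappa> * (x \<bullet> x)"

definition Dphi where
  "Dphi D lam \<kappa> x k = Re (snd k) + D (fst x) (fst k) + lam * (2 * Re (snd x * snd k)) + \<kappa> * (2 * (x \<bullet> k))"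
  for D :: "complex \<Rightarrow> complex \<Rightarrow> real" and x k :: "complex \<times> complex"

definition D2phi where
  "D2phi D2 lam \<kappa> x h k = D2 (fst x) (fst h) (fst k) + lam * (2 * Re (snd h * snd k)) + \<kappa> * (2 * (h \<bullet> k))"
  for D2 :: "complex \<Rightarrow> complex \<Rightarrow> complex \<Rightarrow> real" and x h k :: "complex \<times> complex"

lemma phi_der:
  assumes "\<And>z. (W has_derivative D z) (at z)"
  shows "(phi W lam \<kappa> has_derivative Dphi D lam \<kappa> x) (at x)"
proof -
  have f: "((\<lambda>x. fst x) has_derivative (\<lambda>h. fst h)) (at x)" "((\<lambda>x. snd x) has_derivative (\<lambda>h. snd h)) (at x)"
    by (auto intro!: derivative_eq_intros)
  have W: "((\<lambda>x. W (fst x)) has_derivative (\<lambda>h. D (fst x) (fst h))) (at x)"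
    using has_derivative_compose[OF f(1) assms] .
  have "((\<lambda>x. Re (snd x) + W (fst x) + lam * Re (snd x * snd x) + \<kappa> * (x \<bullet> x)) has_derivative
     (\<lambda>h. Re (snd h) + D (fst x) (fst h) + lam * Re (snd x * snd h + snd h * snd x) + \<kappa> * (x \<bullet> h + h \<bullet> x))) (at x)"
    by (intro has_derivative_add has_derivative_mult_right bounded_linear.has_derivative[OF bounded_linear_Re]
        has_derivative_inner has_derivative_mult f W has_derivative_ident)
  moreover have "(\<lambda>h. Re (snd h) + D (fst x) (fst h) + lam * Re (snd x * snd h + snd h * snd x) + \<kappa> * (x \<bullet> h + h \<bullet> x)) = Dphi D lam \<kappa> x"
    by (auto simp: Dphi_def inner_commute mult.commute)
  ultimately show ?thesis unfolding phi_def[abs_def] by simp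
qed

lemma Dphi_der:
  assumes "\<And>z k. ((\<lambda>x. D x k) has_derivative (\<lambda>h. D2 z h k)) (at z)"
  shows "((\<lambda>x. Dphi D lam \<kappa> x k) has_derivative (\<lambda>h. D2phi D2 lam \<kappa> x h k)) (at x)"
proof -
  have f: "((\<lambda>x. fst x) has_derivative (\<lambda>h. fst h)) (at x)" "((\<lambda>x. snd x) has_derivative (\<lambda>h. snd h)) (at x)"
    by (auto intro!: derivative_eq_intros)
  have W: "((\<lambda>x. D (fst x) (fst k)) has_derivative (\<lambda>h. D2 (fst x) (fst h) (fst k))) (at x)"
    using has_derivative_compose[OF f(1) assms] .
  have "((\<lambda>x. Re (snd k) + D (fst x) (fst k) + lam * (2 * Re (snd x * snd k)) + \<kappa> * (2 * (x \<bullet> k))) has_derivative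
     (\<lambda>h. 0 + D2 (fst x) (fst h) (fst k) + lam * (2 * Re (snd h * snd k)) + \<kappa> * (2 * (h \<bullet> k)))) (at x)"
    by (intro has_derivative_add has_derivative_mult_right bounded_linear.has_derivative[OF bounded_linear_Re]
        has_derivative_inner_left has_derivative_mult_left f W has_derivative_ident has_derivative_const)
  then show ?thesis unfolding Dphi_def D2phi_def by simp
qed

lemma D2phi_linear: "(\<And>z h. linear (D2 z h)) \<Longrightarrow> linear (D2phi D2 lam \<kappa> x h)"
  by (rule linearI) (simp_all add: D2phi_def linear_add linear_cmul inner_add_right algebra_simps)

text \<open>The harmonic term \<open>lam * Re z\<^sub>2\<^sup>2\<close> makes \<open>phi\<close> negative where \<open>Im z\<^sub>2\<close> is large, which
  \<open>Re z\<^sub>2 + W z\<^sub>1\<close> alone does not; the bumping takes care of large \<open>z\<^sub>1\<close>.\<close>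
lemma phi_barrier:
  assumes m: "m \<ge> 1" and b: "bump (2*m) H \<epsilon> W D D2 C"
    and CH: "CH \<ge> 0" "\<And>z. \<bar>H z\<bar> \<le> CH * norm z ^ (2*m)"
  obtains R1 lam \<kappa> M where "R1 \<ge> 8" "0 \<le> lam" "\<kappa> > 0"
    "\<And>x. norm (fst x) \<le> 3 \<Longrightarrow> norm (snd x) \<le> 3 \<Longrightarrow> phi W lam \<kappa> x > - M"
    "\<And>x. norm (fst x) \<le> R1 \<Longrightarrow> norm (snd x) \<le> R1 ^ (2*m) \<Longrightarrow> Re (snd x) + H (fst x) \<le> 1/4 \<Longrightarrow> phi W lam \<kappa> x \<le> 2"
    "\<And>x. norm (fst x) \<le> R1 \<Longrightarrow> norm (snd x) \<le> R1 ^ (2*m) \<Longrightarrow> Re (snd x) + H (fst x) \<le> 1/4 \<Longrightarrow>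
        R1 / 2 \<le> norm (fst x) \<or> R1 ^ (2*m) / 2 \<le> norm (snd x) \<Longrightarrow> phi W lam \<kappa> x < - M"
proof -
  have \<epsilon>: "\<epsilon> > 0" and C: "C \<ge> 0" and WH: "\<And>z. W z \<le> H z - \<epsilon> * norm z ^ (2*m)" and WC: "\<And>z. \<bar>W z\<bar> \<le> C * norm z ^ (2*m)"
    using b unfolding bump_def by auto
  \<comment> \<open>On the polydisc of radius 3 the terms \<open>Re z2\<close> and
    \<open>lam * Re z2^2\<close> lose at most 3 and 9, and \<open>W\<close> at most
    \<open>C * 3 ^ (2*m)\<close>; the last 1 gives strictness.\<close>
  define M where "M = 13 + C * 3 ^ (2*m)"
  have M: "M \<ge> 13" using C by (simp add: M_def)
  \<comment> \<open>With \<open>lam * R = c0\<close> and \<open>|z2| <= R\<close> the quadratic term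
    \<open>lam * (Re z2)^2\<close> is of linear size; \<open>c0\<close> is small enough for half of
    the depth in the model domain and half of the gap \<open>\<epsilon> * T\<close> to absorb
    it.\<close>
  define c0 where "c0 = min 1 (min (1 / (4 * (1 + CH))) (\<epsilon> / (4 * (CH\<^sup>2 + 1))))"
  have CH2: "CH\<^sup>2 + 1 > 0" by (simp add: add_nonneg_pos)
  have c0: "c0 > 0" "c0 \<le> 1" "c0 * (1 + CH) \<le> 1/4" "c0 * CH\<^sup>2 \<le> \<epsilon> / 4"
  proof -
    show "c0 > 0" unfolding c0_def using \<epsilon> CH(1) CH2 by auto
    show "c0 \<le> 1" by (simp add: c0_def)
    have "c0 \<le> 1 / (4 * (1 + CH))" by (simp add: c0_def)
    then show "c0 * (1 + CH) \<le> 1/4" using CH(1) by (simp add: field_simps)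
    have "c0 \<le> \<epsilon> / (4 * (CH\<^sup>2 + 1))" by (simp add: c0_def)
    then have "c0 * (CH\<^sup>2 + 1) \<le> \<epsilon> / 4" using CH2 by (simp add: field_simps)
    then show "c0 * CH\<^sup>2 \<le> \<epsilon> / 4" using \<open>c0 > 0\<close> by (simp add: distrib_left)
  qed
  define \<mu> :: real where "\<mu> = 1 / 2 ^ (2*m)"
  have \<mu>: "\<mu> > 0" by (simp add: \<mu>_def)
  \<comment> \<open>The entries are the decay rates in the four cases that cover the shell: large
    \<open>z1\<close>, large \<open>Im z2\<close>, large \<open>H z1\<close>, great depth.\<close>
  define c2 where "c2 = min (min (\<epsilon> * \<mu> / 2) (c0 / 16)) (min (\<epsilon> / (16 * (CH + 1))) (1/16))"
  have c2: "c2 > 0" "c2 \<le> \<epsilon> * \<mu> / 2" "c2 \<le> c0 / 16" "c2 \<le> \<epsilon> / (16 * (CH + 1))" "c2 \<le> 1/16"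
  proof -
    show "c2 > 0" unfolding c2_def using \<epsilon> \<mu> c0(1) CH(1) by auto
    show "c2 \<le> \<epsilon> * \<mu> / 2" "c2 \<le> c0 / 16" "c2 \<le> \<epsilon> / (16 * (CH + 1))" "c2 \<le> 1/16"
      unfolding c2_def min_le_iff_disj by simp_all
  qed
  \<comment> \<open>On the shell \<open>phi\<close> is at most \<open>2 - c2 * R\<close> with
    \<open>R >= R1\<close>, and this has to fall below \<open>- M\<close>.\<close>
  define R1 where "R1 = max 8 ((M + 3) / c2)"
  have R1: "R1 \<ge> 8" "R1 * c2 \<ge> M + 3"
  proof -
    show "R1 \<ge> 8" by (simp add: R1_def)
    have "(M + 3) / c2 \<le> R1" by (simp add: R1_def)
    then show "R1 * c2 \<ge> M + 3" using c2(1) by (simp add: pos_divide_le_eq)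
  qed
  define R where "R = R1 ^ (2*m)"
  have RR: "R \<ge> R1"
    using power_increasing[of 1 "2*m" R1] m R1 by (simp add: R_def)
  have R8: "R \<ge> 8" and Rp: "R > 0" using RR R1 by auto
  have Rc: "R * c2 \<ge> M + 3" using mult_right_mono[OF RR, of c2] c2(1) R1(2) by linarith
  define lam where "lam = c0 / R"
  have lam: "lam > 0" "lam \<le> 1" "lam * R = c0"
    using c0 R8 Rp by (auto simp: lam_def pos_divide_le_eq)
  define \<kappa> where "\<kappa> = 1 / (R1\<^sup>2 + R\<^sup>2)"
  have kden: "R1\<^sup>2 + R\<^sup>2 > 0" using R1 by (simp add: add_pos_nonneg)
  have \<kappa>: "\<kappa> > 0" using kden by (simp add: \<kappa>_def)
  have kb: "\<kappa> * (x \<bullet> x) \<le> 1" if "norm (fst x) \<le> R1" "norm (snd x) \<le> R" for x :: "complex \<times> complex"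
  proof -
    have "x \<bullet> x = (norm (fst x))\<^sup>2 + (norm (snd x))\<^sup>2"
      by (simp add: inner_prod_def power2_norm_eq_inner)
    also have "\<dots> \<le> R1\<^sup>2 + R\<^sup>2" using that by (intro add_mono power_mono) auto
    finally show ?thesis using kden by (simp add: \<kappa>_def pos_divide_le_eq)
  qed
  \<comment> \<open>Depth \<open>s\<close>, the gap of the bumping and \<open>Im z2\<close> each
    push \<open>phi\<close> down. Of the constant 2, one unit pays for the \<open>\<kappa>\<close>
    term and one for points slightly outside the model domain, where \<open>s < 0\<close>.\<close>
  have key: "phi W lam \<kappa> x \<le> 2 - max (- (Re (snd x) + H (fst x))) 0 / 2 - \<epsilon> * norm (fst x) ^ (2*m) / 2 - lam * (Im (snd x))\<^sup>2"
    if x: "norm (fst x) \<le> R1" "norm (snd x) \<le> R" "Re (snd x) + H (fst x) \<le> 1/4" for x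
  proof -
    define T where "T = norm (fst x) ^ (2*m)"
    define a y s h where "a = Re (snd x)" and "y = Im (snd x)" and "s = - (Re (snd x) + H (fst x))" and "h = H (fst x)"
    have T: "0 \<le> T" "T \<le> R" unfolding T_def R_def using x(1) by (auto intro: power_mono)
    have h: "\<bar>h\<bar> \<le> CH * T" using CH(2) by (simp add: h_def T_def)
    have ha: "\<bar>a\<bar> \<le> R" using abs_Re_le_cmod[of "snd x"] x(2) by (simp add: a_def)
    have as: "a = - s - h" by (simp add: a_def s_def h_def)
    have hT: "h\<^sup>2 \<le> CH\<^sup>2 * R * T"
    proof -
      have "h\<^sup>2 \<le> (CH * T)\<^sup>2" using h by (simp add: abs_le_square_iff[symmetric] CH(1) T)
      also have "\<dots> = CH\<^sup>2 * T * T" by (simp add: power2_eq_square)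
      also have "\<dots> \<le> CH\<^sup>2 * R * T" using T by (intro mult_right_mono mult_left_mono) auto
      finally show ?thesis .
    qed
    have "lam * (2 * h\<^sup>2) \<le> lam * (2 * (CH\<^sup>2 * R * T))" using hT lam by simp
    also have "\<dots> = 2 * (c0 * CH\<^sup>2) * T" unfolding lam(3)[symmetric] by simp
    also have "\<dots> \<le> 2 * (\<epsilon> / 4) * T" using c0(4) T by (intro mult_right_mono) auto
    finally have l1: "lam * (2 * h\<^sup>2) \<le> \<epsilon> * T / 2" by simp
    have l2: "- s + lam * (2 * s\<^sup>2) \<le> 1 - max s 0 / 2"
    proof (cases "s \<ge> 0")
      case True
      have "CH * T \<le> CH * R" using T CH(1) by (simp add: mult_left_mono)
      then have "s \<le> (1 + CH) * R" using as ha h by (simp add: algebra_simps)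
      then have "s * s \<le> ((1 + CH) * R) * s" using True by (rule mult_right_mono)
      then have "lam * (2 * s\<^sup>2) \<le> lam * (2 * (((1 + CH) * R) * s))" using lam by (simp add: power2_eq_square)
      also have "\<dots> = 2 * (c0 * (1 + CH)) * s" unfolding lam(3)[symmetric] by simp
      also have "\<dots> \<le> 2 * (1/4) * s" using c0(3) True by (intro mult_right_mono) auto
      finally show ?thesis using True by simp
    next
      case False
      have s1: "s \<ge> - 1/4" using x(3) by (simp add: s_def)
      then have "s\<^sup>2 \<le> (1/4)\<^sup>2" using False by (simp add: abs_le_square_iff[symmetric])
      then have "lam * (2 * s\<^sup>2) \<le> 1 * (2 * (1/4)\<^sup>2)" using lam by (intro mult_mono) auto
      then show ?thesis using False s1 by (simp add: power2_eq_square)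
    qed
    have sq: "a\<^sup>2 \<le> 2 * s\<^sup>2 + 2 * h\<^sup>2"
    proof -
      have "0 \<le> (s - h)\<^sup>2" by simp
      then show ?thesis unfolding as by (simp add: power2_eq_square algebra_simps)
    qed
    have "lam * a\<^sup>2 \<le> lam * (2 * s\<^sup>2 + 2 * h\<^sup>2)" using sq lam by simp
    then have l3: "lam * a\<^sup>2 \<le> lam * (2 * s\<^sup>2) + lam * (2 * h\<^sup>2)" by (simp add: distrib_left)
    have e: "phi W lam \<kappa> x = a + W (fst x) + lam * a\<^sup>2 - lam * y\<^sup>2 + \<kappa> * (x \<bullet> x)"
      by (simp add: phi_def a_def y_def power2_eq_square algebra_simps)
    have w: "W (fst x) \<le> h - \<epsilon> * T" using WH by (simp add: h_def T_def)
    have "phi W lam \<kappa> x \<le> 2 - max s 0 / 2 - \<epsilon> * T / 2 - lam * y\<^sup>2"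
      unfolding e using w l1 l2 l3 kb[OF x(1,2)] as by linarith
    then show ?thesis unfolding s_def T_def y_def .
  qed
  show thesis
  proof (rule that[of R1 lam \<kappa> M])
    show "R1 \<ge> 8" "0 \<le> lam" "\<kappa> > 0" using R1 lam \<kappa> by auto
  next
    fix x :: "complex \<times> complex" assume x: "norm (fst x) \<le> 3" "norm (snd x) \<le> 3"
    have "\<bar>W (fst x)\<bar> \<le> C * norm (fst x) ^ (2*m)" by (rule WC)
    also have "\<dots> \<le> C * 3 ^ (2*m)" using x C by (intro mult_left_mono power_mono) auto
    finally have 1: "W (fst x) \<ge> - C * 3 ^ (2*m)" by simp
    have 2: "Re (snd x) \<ge> - 3" using abs_Re_le_cmod[of "snd x"] x by linarith
    have "\<bar>Re (snd x * snd x)\<bar> \<le> norm (snd x) * norm (snd x)" using abs_Re_le_cmod[of "snd x * snd x"] by (simp add: norm_mult)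
    also have "\<dots> \<le> 3 * 3" using x by (intro mult_mono) auto
    finally have "\<bar>lam * Re (snd x * snd x)\<bar> \<le> 1 * (3 * 3)" unfolding abs_mult using lam by (intro mult_mono) auto
    then have 3: "lam * Re (snd x * snd x) \<ge> - 9" by linarith
    have 4: "\<kappa> * (x \<bullet> x) \<ge> 0" using \<kappa> by simp
    show "phi W lam \<kappa> x > - M" unfolding phi_def M_def using 1 2 3 4 by linarith
  next
    fix x :: "complex \<times> complex" assume x: "norm (fst x) \<le> R1" "norm (snd x) \<le> R1 ^ (2*m)" "Re (snd x) + H (fst x) \<le> 1/4"
    note k = key[OF x(1) x(2)[folded R_def] x(3)]
    define X where "X = - (Re (snd x) + H (fst x))"
    define q where "q = max X 0 / 2"
    have q: "q \<ge> 0" "q \<ge> X / 2"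
      unfolding q_def by (simp, intro divide_right_mono max.cobounded1) simp
    define T where "T = norm (fst x) ^ (2*m)"
    define L where "L = lam * (Im (snd x))\<^sup>2"
    define E where "E = \<epsilon> * T"
    have p: "E \<ge> 0" "L \<ge> 0" using \<epsilon> lam by (auto simp: E_def T_def L_def)
    have k: "phi W lam \<kappa> x \<le> 2 - q - E / 2 - L"
      using key[OF x(1) x(2)[folded R_def] x(3)] by (simp only: q_def X_def T_def L_def E_def)
    show "phi W lam \<kappa> x \<le> 2" using k p q by linarith
    assume sh: "R1 / 2 \<le> norm (fst x) \<or> R1 ^ (2*m) / 2 \<le> norm (snd x)"
    have "q + E / 2 + L \<ge> c2 * R"
    proof -
      \<comment> \<open>If \<open>|z2| >= R/2\<close>, then \<open>Im z2\<close> or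
        \<open>Re z2\<close> has modulus at least \<open>R/4\<close>; in the second case
        \<open>H z1\<close> or \<open>Re z2 + H z1\<close> has modulus at least
        \<open>R/8\<close>.\<close>
      consider (a) "R1 / 2 \<le> norm (fst x)" | (b) "R / 4 \<le> \<bar>Im (snd x)\<bar>" | (c) "R / 8 \<le> \<bar>H (fst x)\<bar>"
        | (d) "R / 8 \<le> \<bar>Re (snd x) + H (fst x)\<bar>"
      proof -
        have "norm (snd x) \<le> \<bar>Re (snd x)\<bar> + \<bar>Im (snd x)\<bar>" by (rule cmod_le)
        then show thesis using sh that unfolding R_def[symmetric] by linarith
      qed
      then show ?thesis
      proof cases
        case a
        have "\<mu> * R = (R1 / 2) ^ (2*m)" by (simp add: \<mu>_def R_def power_divide)
        also have "\<dots> \<le> T" unfolding T_def using a R1 by (intro power_mono) auto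
        finally have "\<epsilon> * (\<mu> * R) \<le> \<epsilon> * T" using \<epsilon> by simp
        moreover have "c2 * R \<le> \<epsilon> * \<mu> / 2 * R" using c2(2) Rp by (intro mult_right_mono) auto
        moreover have "\<epsilon> * \<mu> / 2 * R = \<epsilon> * (\<mu> * R) / 2" by simp
        ultimately have "c2 * R \<le> E / 2" unfolding E_def by linarith
        then show ?thesis using p(2) q(1) by linarith
      next
        case b
        have "(R / 4)\<^sup>2 \<le> \<bar>Im (snd x)\<bar>\<^sup>2" using b Rp by (intro power_mono) auto
        then have "lam * (R / 4)\<^sup>2 \<le> lam * (Im (snd x))\<^sup>2" using lam by simp
        moreover have "lam * (R / 4)\<^sup>2 = (lam * R) * R / 16" by (simp add: power2_eq_square)
        moreover have "c2 * R \<le> c0 / 16 * R" using c2(3) Rp by (intro mult_right_mono) auto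
        ultimately have "c2 * R \<le> L" using lam(3) unfolding L_def by simp
        then show ?thesis using p q(1) by linarith
      next
        case c
        define aa where "aa = \<epsilon> / (16 * (CH + 1))"
        have "CH * T \<le> (CH + 1) * T" by (simp add: T_def distrib_right)
        then have "R / 8 \<le> (CH + 1) * T" using c CH(2)[of "fst x"] by (simp add: T_def)
        then have "aa * 8 * (R / 8) \<le> aa * 8 * ((CH + 1) * T)"
          using \<epsilon> CH(1) unfolding aa_def by (intro mult_left_mono) auto
        moreover have "aa * 8 * ((CH + 1) * T) = \<epsilon> * T / 2" using CH(1) unfolding aa_def by (simp add: field_simps)
        moreover have "c2 * R \<le> aa * R" using c2(4) Rp unfolding aa_def by (intro mult_right_mono) auto
        moreover have "aa * 8 * (R / 8) = aa * R" by simp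
        ultimately have "c2 * R \<le> E / 2" unfolding E_def by linarith
        then show ?thesis using p(2) q(1) by linarith
      next
        case d
        \<comment> \<open>\<open>R >= 8\<close> excludes the other sign, since
          \<open>Re z2 + H z1 <= 1/4\<close>.\<close>
        then have "X \<ge> R / 8" using x(3) R8 unfolding X_def by linarith
        moreover have "c2 * R \<le> 1/16 * R" using c2(5) Rp by (intro mult_right_mono) auto
        ultimately have "c2 * R \<le> q" using q(2) by linarith
        then show ?thesis using p by linarith
      qed
    qed
    then have "phi W lam \<kappa> x \<le> 2 - c2 * R" using k by linarith
    then show "phi W lam \<kappa> x < - M" using Rc by (simp add: mult.commute)
  qed
qed

text \<open>The left side is the Laplacian of \<open>phi\<close> along a disc with partial
  derivatives \<open>X\<close>, \<open>Y\<close> and Laplacian \<open>\<Lambda>\<close>. For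
  \<open>Y = imul X\<close> and \<open>\<Lambda> = 0\<close> it is at least
  \<open>2 * \<kappa> * |X|^2\<close>; deviations cost a multiple of \<open>e * |X|^2\<close>, so
  for small \<open>e\<close> half of this survives.\<close>

lemma lap_phi_lower:
  assumes b: "bump n H \<epsilon> W D D2 C" and lam: "0 \<le> lam" and \<kappa>: "\<kappa> > 0" and R1: "R1 \<ge> 1" "R \<ge> 1"
  shows "\<exists>e0>0. \<forall>e x X Y \<Lambda>. 0 \<le> e \<longrightarrow> e \<le> e0 \<longrightarrow> norm (fst x) \<le> R1 \<longrightarrow> norm (snd x) \<le> R \<longrightarrow>
     norm (Y - imul X) \<le> e * norm X \<longrightarrow> norm \<Lambda> \<le> 16 * e * (norm X)\<^sup>2 \<longrightarrow>
     D2phi D2 lam \<kappa> x X X + D2phi D2 lam \<kappa> x Y Y + Dphi D lam \<kappa> x \<Lambda> \<ge> \<kappa> * (norm X)\<^sup>2"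
proof -
  have C: "C \<ge> 0" and dD: "\<And>z k. ((\<lambda>x. D x k) has_derivative (\<lambda>h. D2 z h k)) (at z)" and lin: "\<And>z h. linear (D2 z h)"
    and tr: "\<And>z h. D2 z h h + D2 z (\<i> * h) (\<i> * h) \<ge> 0"
    and B1: "\<And>z h. \<bar>D z h\<bar> \<le> C * norm z ^ (n - 1) * norm h"
    and B2: "\<And>z h k. \<bar>D2 z h k\<bar> \<le> C * norm z ^ (n - 2) * norm h * norm k"
    using b unfolding bump_def by auto
  have lin1: "linear (\<lambda>h. D2 z h k)" for z k using dD has_derivative_linear by blast
  define CC where "CC = C * R1 ^ n"
  have CC: "CC \<ge> 0" using C R1 by (simp add: CC_def)
  \<comment> \<open>The sum of the constants in the error estimates \<open>t1\<close> to
    \<open>t5\<close>.\<close>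
  define KK where "KK = 16 + 3 * CC + 16 * CC + lam * (2 * (3 + 16 * R)) + \<kappa> * (2 * 16 * (R1 + R))"
  have KK: "KK > 0"
  proof -
    have "0 \<le> lam * (2 * (3 + 16 * R))" "0 \<le> \<kappa> * (2 * 16 * (R1 + R))"
      using lam \<kappa> R1 by (auto intro!: mult_nonneg_nonneg)
    then show ?thesis unfolding KK_def using CC by linarith
  qed
  define e0 where "e0 = min 1 (\<kappa> / KK)"
  have "D2phi D2 lam \<kappa> x X X + D2phi D2 lam \<kappa> x Y Y + Dphi D lam \<kappa> x \<Lambda> \<ge> \<kappa> * (norm X)\<^sup>2"
    if e: "0 \<le> e" "e \<le> e0" and x: "norm (fst x) \<le> R1" "norm (snd x) \<le> R"
      and Y: "norm (Y - imul X) \<le> e * norm X" and L: "norm \<Lambda> \<le> 16 * e * (norm X)\<^sup>2" for e x X Y \<Lambda>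
  proof -
    define N where "N = norm X"
    have N: "N \<ge> 0" by (simp add: N_def)
    have e1: "e \<le> 1" and eK: "e * KK \<le> \<kappa>"
      using e(2) KK by (auto simp: e0_def pos_le_divide_eq)
    have nf: "norm (fst w) \<le> norm w" "norm (snd w) \<le> norm w" for w :: "complex \<times> complex"
      by (metis norm_fst_le prod.collapse, metis norm_snd_le prod.collapse)
    have YX: "norm (Y - imul X) \<le> e * N" using Y by (simp add: N_def)
    have eN: "e * N \<le> N" using e1 N by (simp add: mult_left_le_one_le e)
    have nY: "norm Y \<le> 2 * N" using norm_triangle_ineq[of "Y - imul X" "imul X"] YX eN by (simp add: N_def)
    have L': "norm \<Lambda> \<le> 16 * e * N\<^sup>2" using L by (simp add: N_def)
    have L1: "norm (fst \<Lambda>) \<le> 16 * e * N\<^sup>2" "norm (snd \<Lambda>) \<le> 16 * e * N\<^sup>2" using nf[of \<Lambda>] L' by linarith+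
    have pw: "norm (fst x) ^ j \<le> R1 ^ n" if "j \<le> n" for j
    proof -
      have "norm (fst x) ^ j \<le> R1 ^ j" using x by (intro power_mono) auto
      also have "\<dots> \<le> R1 ^ n" using that R1 by (intro power_increasing) auto
      finally show ?thesis .
    qed
    have B1': "\<bar>D (fst x) h\<bar> \<le> CC * norm h" for h
    proof -
      have "C * norm (fst x) ^ (n - 1) * norm h \<le> CC * norm h"
        unfolding CC_def using pw[of "n - 1"] C by (intro mult_right_mono mult_left_mono) auto
      then show ?thesis using B1[of "fst x" h] by linarith
    qed
    have B2': "\<bar>D2 (fst x) h k\<bar> \<le> CC * norm h * norm k" for h k
    proof -
      have "C * norm (fst x) ^ (n - 2) * norm h * norm k \<le> CC * norm h * norm k"
        unfolding CC_def using pw[of "n - 2"] C by (intro mult_right_mono mult_left_mono) auto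
      then show ?thesis using B2[of "fst x" h k] by linarith
    qed
    have t1: "\<bar>Re (snd \<Lambda>)\<bar> \<le> 16 * (e * N\<^sup>2)" using abs_Re_le_cmod[of "snd \<Lambda>"] L1 by simp
    have t2: "\<bar>D (fst x) (fst \<Lambda>)\<bar> \<le> 16 * CC * (e * N\<^sup>2)"
    proof -
      have "CC * norm (fst \<Lambda>) \<le> CC * (16 * e * N\<^sup>2)" using L1 CC by (intro mult_left_mono)
      then show ?thesis using B1'[of "fst \<Lambda>"] by (simp add: algebra_simps)
    qed
    have t3: "D2 (fst x) (fst X) (fst X) + D2 (fst x) (fst Y) (fst Y) \<ge> - 3 * CC * (e * N\<^sup>2)"
    proof -
      define I where "I = \<i> * fst X"
      define d where "d = fst Y - I"
      have d: "norm d \<le> e * N" using nf(1)[of "Y - imul X"] YX by (simp add: d_def I_def imul_def)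
      have nI: "norm I \<le> N" using nf(1)[of X] by (simp add: I_def norm_mult N_def)
      have nY1: "norm (fst Y) \<le> 2 * N" using nf(1)[of Y] nY by linarith
      have "D2 (fst x) (fst Y) (fst Y) - D2 (fst x) I I = D2 (fst x) d (fst Y) + D2 (fst x) I d"
        unfolding d_def using linear_diff[of "\<lambda>h. D2 (fst x) h (fst Y)" "fst Y" I, OF lin1] linear_diff[OF lin, of "fst x" I "fst Y" I] by simp
      moreover have "\<bar>D2 (fst x) d (fst Y)\<bar> \<le> CC * (e * N) * (2 * N)"
        by (rule order_trans[OF B2']) (intro mult_mono d nY1, use CC e N in auto)
      moreover have "\<bar>D2 (fst x) I d\<bar> \<le> CC * N * (e * N)"
        by (rule order_trans[OF B2']) (intro mult_mono d nI, use CC e N in auto)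
      moreover have "D2 (fst x) (fst X) (fst X) + D2 (fst x) I I \<ge> 0" using tr unfolding I_def by blast
      moreover have "CC * (e * N) * (2 * N) = 2 * CC * (e * N\<^sup>2)" "CC * N * (e * N) = CC * (e * N\<^sup>2)" by (simp_all add: power2_eq_square)
      ultimately show ?thesis by linarith
    qed
    have t4: "\<bar>Re (snd X * snd X) + Re (snd Y * snd Y) + Re (snd x * snd \<Lambda>)\<bar> \<le> (3 + 16 * R) * (e * N\<^sup>2)"
    proof -
      \<comment> \<open>\<open>Re z2^2\<close> is pluriharmonic for the standard structure: the sum
        of squares contains the small factor \<open>Y - imul X\<close>.\<close>
      have i: "snd X * snd X + snd Y * snd Y = (snd Y - \<i> * snd X) * (snd Y + \<i> * snd X)"
        by (simp add: algebra_simps)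
      have d: "norm (snd Y - \<i> * snd X) \<le> e * N" using nf(2)[of "Y - imul X"] YX by (simp add: imul_def)
      have s: "norm (snd Y + \<i> * snd X) \<le> 3 * N"
        using norm_triangle_ineq[of "snd Y" "\<i> * snd X"] nf(2)[of Y] nf(2)[of X] nY by (simp add: norm_mult N_def)
      have "norm (snd X * snd X + snd Y * snd Y) \<le> (e * N) * (3 * N)"
        unfolding i norm_mult by (intro mult_mono d s) (use e N in auto)
      moreover have "norm (snd x * snd \<Lambda>) \<le> R * (16 * e * N\<^sup>2)"
        unfolding norm_mult by (intro mult_mono x L1) (use R1 in auto)
      moreover have "\<bar>Re (snd X * snd X) + Re (snd Y * snd Y) + Re (snd x * snd \<Lambda>)\<bar> \<le> norm (snd X * snd X + snd Y * snd Y) + norm (snd x * snd \<Lambda>)"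
        using abs_Re_le_cmod[of "snd X * snd X + snd Y * snd Y"] abs_Re_le_cmod[of "snd x * snd \<Lambda>"]
        unfolding plus_complex.sel by linarith
      moreover have "(e * N) * (3 * N) + R * (16 * e * N\<^sup>2) = (3 + 16 * R) * (e * N\<^sup>2)" by (simp add: power2_eq_square algebra_simps)
      ultimately show ?thesis by linarith
    qed
    have t5: "\<bar>x \<bullet> \<Lambda>\<bar> \<le> 16 * (R1 + R) * (e * N\<^sup>2)"
    proof -
      have "norm x \<le> R1 + R" using norm_Pair_le[of "fst x" "snd x"] x by simp
      then have "norm x * norm \<Lambda> \<le> (R1 + R) * (16 * e * N\<^sup>2)" using L' R1 by (intro mult_mono) auto
      then show ?thesis using Cauchy_Schwarz_ineq2[of x \<Lambda>] by (simp add: algebra_simps)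
    qed
    have XX: "X \<bullet> X = N\<^sup>2" by (simp add: N_def power2_norm_eq_inner)
    have YY: "Y \<bullet> Y \<ge> 0" by simp
    have l4: "lam * (2 * (Re (snd X * snd X) + Re (snd Y * snd Y) + Re (snd x * snd \<Lambda>))) \<ge> - (lam * (2 * ((3 + 16 * R) * (e * N\<^sup>2))))"
    proof -
      have "lam * (2 * (Re (snd X * snd X) + Re (snd Y * snd Y) + Re (snd x * snd \<Lambda>))) \<ge> lam * (2 * (- ((3 + 16 * R) * (e * N\<^sup>2))))"
        using t4 by (intro mult_left_mono lam) (simp_all only: abs_le_iff, linarith+)
      then show ?thesis by simp
    qed
    have l5: "\<kappa> * (2 * (X \<bullet> X + Y \<bullet> Y + x \<bullet> \<Lambda>)) \<ge> \<kappa> * (2 * N\<^sup>2) - \<kappa> * (2 * (16 * (R1 + R) * (e * N\<^sup>2)))"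
    proof -
      have "\<kappa> * (2 * (X \<bullet> X + Y \<bullet> Y + x \<bullet> \<Lambda>)) \<ge> \<kappa> * (2 * (N\<^sup>2 - 16 * (R1 + R) * (e * N\<^sup>2)))"
        unfolding XX using t5 YY \<kappa> by (intro mult_left_mono) (simp_all only: abs_le_iff, linarith+)
      then show ?thesis by (simp add: algebra_simps)
    qed
    have tot: "D2phi D2 lam \<kappa> x X X + D2phi D2 lam \<kappa> x Y Y + Dphi D lam \<kappa> x \<Lambda> =
       Re (snd \<Lambda>) + D (fst x) (fst \<Lambda>) + (D2 (fst x) (fst X) (fst X) + D2 (fst x) (fst Y) (fst Y))
       + lam * (2 * (Re (snd X * snd X) + Re (snd Y * snd Y) + Re (snd x * snd \<Lambda>))) + \<kappa> * (2 * (X \<bullet> X + Y \<bullet> Y + x \<bullet> \<Lambda>))"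
      unfolding D2phi_def Dphi_def by (simp only: distrib_left ac_simps)
    have "KK * (e * N\<^sup>2) = 16 * (e * N\<^sup>2) + 16 * CC * (e * N\<^sup>2) + 3 * CC * (e * N\<^sup>2) + lam * (2 * ((3 + 16 * R) * (e * N\<^sup>2))) + \<kappa> * (2 * (16 * (R1 + R) * (e * N\<^sup>2)))"
      unfolding KK_def by (simp only: distrib_right mult.assoc)
    then have "D2phi D2 lam \<kappa> x X X + D2phi D2 lam \<kappa> x Y Y + Dphi D lam \<kappa> x \<Lambda> \<ge> \<kappa> * (2 * N\<^sup>2) - KK * (e * N\<^sup>2)"
      unfolding tot using t1 t2 t3 l4 l5 by (simp add: abs_le_iff)
    moreover have "KK * (e * N\<^sup>2) \<le> \<kappa> * N\<^sup>2"
    proof -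
      have "(e * KK) * N\<^sup>2 \<le> \<kappa> * N\<^sup>2" using eK by (intro mult_right_mono) auto
      then show ?thesis by (simp add: ac_simps)
    qed
    ultimately show ?thesis unfolding N_def[symmetric] by simp
  qed
  moreover have "e0 > 0" using KK \<kappa> by (simp add: e0_def)
  ultimately show ?thesis by blast
qed

subsection \<open>Gradient estimate for scaled discs\<close>

text \<open>\<open>ln |w|^2\<close> is harmonic off the origin and \<open>|w|^2\<close> has
  Laplacian 4; the latter supplies the strict positivity that the maximum principle demands.\<close>

lemma has_lap_radial_weight:
  fixes z :: complex
  assumes z: "z \<noteq> 0"
  shows "\<exists>gx gy. has_lap (\<lambda>w. - c * ln (w \<bullet> w) + \<eta> * (w \<bullet> w)) gx gy z (4 * \<eta>)"
proof -
  define k where "k = (\<lambda>x. - c * ln x + \<eta> * x)"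
  define k1 where "k1 = (\<lambda>x. - c / x + \<eta>)"
  define k2 where "k2 = (\<lambda>x. c / x^2)"
  have k: "(k has_field_derivative k1 x) (at x)" "(k1 has_field_derivative k2 x) (at x)" if "x > 0" for x
    unfolding k_def k1_def k2_def using that
    by (auto intro!: derivative_eq_intros simp: field_simps power2_eq_square)
  have pos: "x \<bullet> x > 0" if "x \<in> ball z (norm z)" for x
    using that by auto
  have b: "bounded_linear (\<lambda>x::complex. x)" by (rule bounded_linear_ident)
  define D where "D = (\<lambda>(x::complex) h. k1 (x \<bullet> x) * (2 * (x \<bullet> h)))"
  define D' where "D' = (\<lambda>h i. 4 * k2 (z \<bullet> z) * (z \<bullet> h) * (z \<bullet> i) + 2 * k1 (z \<bullet> z) * (h \<bullet> i))"
  have d2: "((\<lambda>x. D x i) has_derivative (\<lambda>h. 4 * k2 (x \<bullet> x) * (x \<bullet> h) * (x \<bullet> i) + 2 * k1 (x \<bullet> x) * (h \<bullet> i))) (at x)"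
    if "x \<in> ball z (norm z)" for x i
    using has_derivative_radial2[OF b, of k1 "k2 (x \<bullet> x)" x 0 i] k(2)[OF pos[OF that]] by (simp add: D_def)
  have "has_lap (\<lambda>w. k (w \<bullet> w)) (\<lambda>w. D w 1) (\<lambda>w. D w \<i>) z (D' 1 1 + D' \<i> \<i> + D z 0)"
  proof (rule has_lap_compose[OF has_lap_id, where D = D and D' = D' and e = "norm z" and \<Psi> = "\<lambda>w. k (w \<bullet> w)"])
    show "norm z > 0" using z by simp
    show "((\<lambda>w. k (w \<bullet> w)) has_derivative D x) (at x)" if "x \<in> ball z (norm z)" for x
      using has_derivative_radial[OF b, of k "k1 (x \<bullet> x)" x 0] k(1)[OF pos[OF that]] by (simp add: D_def[abs_def])
    show "continuous_on (ball z (norm z)) (\<lambda>x. D x i)" for i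
      using d2 by (intro has_derivative_continuous_on) (blast intro: has_derivative_at_withinI)
    show "((\<lambda>x. D x i) has_derivative (\<lambda>h. D' h i)) (at z)" for i
      using d2[of z i] z by (simp add: D'_def)
    show "linear (D' h)" for h
      by (rule linearI) (simp_all add: D'_def inner_add_right algebra_simps)
  qed
  moreover have "D' 1 1 + D' \<i> \<i> + D z 0 = 4 * \<eta>"
  proof -
    have i: "z \<bullet> 1 = Re z" "z \<bullet> \<i> = Im z" "(1::complex) \<bullet> 1 = 1" "\<i> \<bullet> \<i> = 1" by (simp_all add: inner_complex_def)
    have zz: "z \<bullet> z = (Re z)\<^sup>2 + (Im z)\<^sup>2" by (simp add: inner_complex_def power2_eq_square)
    have p: "z \<bullet> z > 0" using z by simp
    have "D' 1 1 + D' \<i> \<i> + D z 0 = 4 * k2 (z \<bullet> z) * (z \<bullet> z) + 4 * k1 (z \<bullet> z)"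
      unfolding D'_def D_def i by (simp add: zz power2_eq_square algebra_simps)
    also have "\<dots> = 4 * \<eta>" unfolding k1_def k2_def using p by (simp add: field_simps power2_eq_square)
    finally show ?thesis .
  qed
  ultimately show ?thesis unfolding k_def by auto
qed

text \<open>A disc after dilation, with the dilation parameter eliminated: \<open>e\<close> bounds
  the C1 distance of \<open>A\<close> to the standard structure as well as the excess of the model
  defining function. The disc equation and the domain condition are asked only while
  \<open>v z\<close> lies in the polydisc \<open>U\<close>, since nothing is known about
  \<open>A\<close> outside.\<close>

locale scaled_disc =
  fixes m :: nat and H W :: "complex \<Rightarrow> real" and D :: "complex \<Rightarrow> complex \<Rightarrow> real" and D2 :: "complex \<Rightarrow> complex \<Rightarrow> complex \<Rightarrow> real"
    and \<epsilon> C R1 lam \<kappa> M e :: real and A :: "complex \<times> complex \<Rightarrow> complex \<times> complex \<Rightarrow> complex \<times> complex"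
    and A' :: "complex \<times> complex \<Rightarrow> complex \<times> complex \<Rightarrow> complex \<times> complex \<Rightarrow> complex \<times> complex"
    and v vx vy :: "complex \<Rightarrow> complex \<times> complex" and U :: "(complex \<times> complex) set"
  defines U_def: "U \<equiv> {x. norm (fst x) < R1 \<and> norm (snd x) < R1 ^ (2*m)}"
  assumes m: "m \<ge> 1" and bump: "bump (2*m) H \<epsilon> W D D2 C"
    and R1: "R1 \<ge> 8" and \<kappa>: "\<kappa> > 0"
    and inner: "\<And>x. norm (fst x) \<le> 3 \<Longrightarrow> norm (snd x) \<le> 3 \<Longrightarrow> phi W lam \<kappa> x > - M"
    and upper: "\<And>x. x \<in> U \<Longrightarrow> Re (snd x) + H (fst x) \<le> e \<Longrightarrow> phi W lam \<kappa> x \<le> 2"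
    and shell: "\<And>x. x \<in> U \<Longrightarrow> Re (snd x) + H (fst x) \<le> e \<Longrightarrow>
        R1 / 2 \<le> norm (fst x) \<or> R1 ^ (2*m) / 2 \<le> norm (snd x) \<Longrightarrow> phi W lam \<kappa> x < - M"
    and levi: "\<And>x X Y \<Lambda>. x \<in> U \<Longrightarrow> norm (Y - imul X) \<le> e * norm X \<Longrightarrow> norm \<Lambda> \<le> 16 * e * (norm X)\<^sup>2 \<Longrightarrow>
     D2phi D2 lam \<kappa> x X X + D2phi D2 lam \<kappa> x Y Y + Dphi D lam \<kappa> x \<Lambda> \<ge> \<kappa> * (norm X)\<^sup>2"
    and e: "0 \<le> e" "e \<le> 1/40000"
    and vder: "\<And>z. z \<in> ball 0 1 \<Longrightarrow> (v has_derivative grad (vx z) (vy z)) (at z)"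
    and vcont: "continuous_on (ball 0 1) vx" "continuous_on (ball 0 1) vy"
    and vJ: "\<And>z. z \<in> ball 0 1 \<Longrightarrow> v z \<in> U \<Longrightarrow> vy z = A (v z) (vx z)"
    and v0: "norm (fst (v 0)) \<le> 1" "norm (snd (v 0)) \<le> 1"
    and vdom: "\<And>z. z \<in> ball 0 1 \<Longrightarrow> v z \<in> U \<Longrightarrow> Re (snd (v z)) + H (fst (v z)) \<le> e"
    and Alin: "\<And>x. x \<in> U \<Longrightarrow> linear (A x)"
    and Asq: "\<And>x w. x \<in> U \<Longrightarrow> A x (A x w) = - w"
    and Anear: "\<And>x w. x \<in> U \<Longrightarrow> norm (A x w - imul w) \<le> e * norm w"
    and Ader: "\<And>x w. x \<in> U \<Longrightarrow> ((\<lambda>x. A x w) has_derivative (\<lambda>h. A' x h w)) (at x)"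
    and A'b: "\<And>x h w. x \<in> U \<Longrightarrow> norm (A' x h w) \<le> e * norm h * norm w"
begin

lemma dW: "(W has_derivative D z) (at z)" and dD: "((\<lambda>x. D x k) has_derivative (\<lambda>h. D2 z h k)) (at z)"
  and lD2: "linear (D2 z h)"
  using bump unfolding bump_def by auto

abbreviation "R \<equiv> R1 ^ (2*m)"
abbreviation "ph \<equiv> phi W lam \<kappa>"

lemma R: "R \<ge> R1" using power_increasing[of 1 "2*m" R1] m R1 by simp

lemma U_open: "open U"
proof -
  have "U = (\<lambda>x. norm (fst x)) -` {..<R1} \<inter> (\<lambda>x. norm (snd x)) -` {..<R}" unfolding U_def by auto
  then show ?thesis by (simp add: open_Int open_vimage continuous_on_fst continuous_on_snd continuous_on_norm)
qed

lemma U_convex: "convex U"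
proof -
  have "U = ball 0 R1 \<times> ball 0 R" unfolding U_def by auto
  then show ?thesis by (simp add: convex_Times)
qed

definition "p = v 0"
definition "l w = (1/2) *\<^sub>R (w - imul (A p w))"
definition "en z = l (v z - p)"

lemma pU: "p \<in> U" unfolding U_def p_def using v0 R1 R by auto

lemma l_linear: "linear l"
  by (rule linearI) (simp_all add: l_def linear_add[OF Alin[OF pU]] linear_cmul[OF Alin[OF pU]] imul_add imul_scaleR algebra_simps)

lemma l_bl: "bounded_linear l" using l_linear by (simp add: linear_conv_bounded_linear)

lemma l_near: "norm (l w - w) \<le> e / 2 * norm w"
proof -
  have "l w - w = (- 1/2) *\<^sub>R imul (A p w - imul w)"
  proof -
    have "imul (A p w - imul w) = imul (A p w) + w" by (simp add: imul_diff imul_imul)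
    then show ?thesis unfolding l_def by (simp add: algebra_simps) (simp flip: scaleR_add_left)
  qed
  then have "norm (l w - w) = 1/2 * norm (A p w - imul w)" by simp
  then show ?thesis using Anear[OF pU, of w] by simp
qed

lemma l_bounds: "norm w \<le> 2 * norm (l w)" "norm (l w) \<le> 2 * norm w"
proof -
  have "e / 2 * norm w \<le> 1/2 * norm w" using e by (intro mult_right_mono) auto
  then have "norm (l w - w) \<le> 1/2 * norm w" using l_near[of w] by linarith
  then show "norm w \<le> 2 * norm (l w)" "norm (l w) \<le> 2 * norm w"
    using norm_triangle_ineq2[of w "l w"] norm_triangle_ineq2[of "l w" w] by (auto simp: norm_minus_commute)
qed

lemma l_imul: "l (A p w) = imul (l w)"
  unfolding l_def Asq[OF pU] by (simp add: imul_scaleR imul_diff imul_imul) (simp add: imul_def prod_eq_iff)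

lemma l_eq_0: "l w = 0 \<longleftrightarrow> w = 0" using l_bounds(1)[of w] linear_0[OF l_linear] by auto

lemma A_lip: assumes "x \<in> U" shows "norm (A x w - A p w) \<le> e * norm w * norm (x - p)"
proof (rule differentiable_bound[OF U_convex _ _ assms pU])
  fix y assume y: "y \<in> U"
  show "((\<lambda>x. A x w) has_derivative (\<lambda>h. A' y h w)) (at y within U)"
    using Ader[OF y] has_derivative_at_withinI by blast
  show "onorm (\<lambda>h. A' y h w) \<le> e * norm w"
    by (rule onorm_bound) (use e A'b[OF y] in \<open>auto simp: algebra_simps\<close>)
qed

lemma v_cont: "continuous_on (ball 0 1) v"
  by (rule has_derivative_continuous_on) (blast intro: has_derivative_at_withinI vder)

text \<open>As long as \<open>cutlog\<close> is not yet constant, the point lies in the polydisc of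
  radius 3, where \<open>ph > - M\<close>. The cut-off of \<open>ph\<close> therefore takes effect
  only where \<open>cutlog\<close> is constant.\<close>

lemma en_small: assumes "norm (en z) \<le> 1" shows "norm (fst (v z)) \<le> 3" "norm (snd (v z)) \<le> 3" "v z \<in> U"
proof -
  have "norm (v z - p) \<le> 2" using l_bounds(1)[of "v z - p"] assms by (simp add: en_def)
  then have a: "norm (fst (v z - p)) \<le> 2" "norm (snd (v z - p)) \<le> 2"
    by (metis norm_fst_le prod.collapse order_trans, metis norm_snd_le prod.collapse order_trans)
  show b: "norm (fst (v z)) \<le> 3" "norm (snd (v z)) \<le> 3"
    using a v0 norm_triangle_ineq2[of "fst (v z)" "fst p"] norm_triangle_ineq2[of "snd (v z)" "snd p"] by (auto simp: p_def)
  show "v z \<in> U" using b R1 R by (auto simp: U_def)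
qed

text \<open>\<open>112 = 28 * 4\<close>, from the loss \<open>28 * |l X|^2\<close> of
  \<open>cutlog\<close> and \<open>|l X| <= 2 * |X|\<close>.\<close>

definition "B = 112 / \<kappa>"

lemma B: "B > 0" "B * \<kappa> = 112" using \<kappa> by (auto simp: B_def)

text \<open>By the chain rule the Laplacian is a loss of \<open>cutlog\<close>, at most
  \<open>112 * |X|^2\<close>, plus \<open>B\<close> times at least \<open>\<kappa> * |X|^2\<close>
  from \<open>ph\<close>. For \<open>|en z| >= 1\<close> the loss is zero.\<close>

lemma lap_test_function_nonneg:
  assumes z: "z \<in> ball 0 1" "v z \<in> U" "en z \<noteq> 0"
  shows "\<exists>gx gy L. has_lap (\<lambda>w. cutlog (en w \<bullet> en w) + B * ph (v w)) gx gy z L \<and> L \<ge> 0"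
proof -
  define x where "x = v z"
  define X where "X = vx z"
  define Y where "Y = vy z"
  define \<Lambda> where "\<Lambda> = (\<Sum>b\<in>Basis. (vx z \<bullet> b) *\<^sub>R A' x (vy z) b - (vy z \<bullet> b) *\<^sub>R A' x (vx z) b)"
  have xU: "x \<in> U" using z by (simp add: x_def)
  have "open (ball 0 1 \<inter> v -` U)" using v_cont U_open continuous_on_open_vimage[of "ball 0 1" v] by (simp add: Int_commute)
  moreover have "z \<in> ball 0 1 \<inter> v -` U" using z by simp
  ultimately obtain d where d: "d > 0" "ball z d \<subseteq> ball 0 1 \<inter> v -` U" unfolding open_contains_ball by meson
  have sub: "w \<in> ball 0 1" "v w \<in> U" if "w \<in> ball z d" for w using d(2) that by auto
  have C1: "C1_near v vx vy z d"
    unfolding C1_near_def using d vder sub vcont by (auto intro: continuous_on_subset[OF vcont(1)] continuous_on_subset[OF vcont(2)])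
  have lapv: "has_lap v vx vy z \<Lambda>"
    unfolding \<Lambda>_def x_def
  proof (rule has_lap_J_hol[OF C1, where A = A])
    fix w assume w: "w \<in> ball z d"
    show "linear (A (v w))" using Alin sub w by blast
    show "A (v w) (vx w) = vy w" using vJ sub w by simp
    then show "A (v w) (vy w) = - vx w" using Asq sub w by metis
  next
    have "continuous_on U (\<lambda>x. A x k)" for k
      by (rule has_derivative_continuous_on) (blast intro: has_derivative_at_withinI Ader)
    then show "continuous_on (ball z d) (\<lambda>w. A (v w) k)" for k
      by (rule continuous_on_compose2) (use sub in \<open>auto intro: continuous_on_subset[OF v_cont]\<close>)
    show "((\<lambda>x. A x k) has_derivative (\<lambda>h. A' (v z) h k)) (at (v z))" for k using Ader z by blast
  qed
  have Yeq: "Y = A x X" using vJ z by (simp add: Y_def X_def x_def)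
  have YX: "norm (Y - imul X) \<le> e * norm X" unfolding Yeq by (rule Anear[OF xU])
  have Y2: "norm Y \<le> 2 * norm X"
  proof -
    have "e * norm X \<le> 1 * norm X" using e by (intro mult_right_mono) auto
    then show ?thesis using norm_triangle_ineq[of "Y - imul X" "imul X"] YX by simp
  qed
  \<comment> \<open>Four basis vectors, each with two terms of size at most
    \<open>2 * e * |X|^2\<close>.\<close>
  have L16: "norm \<Lambda> \<le> 16 * e * (norm X)\<^sup>2"
  proof -
    have "norm \<Lambda> \<le> (\<Sum>b\<in>(Basis :: (complex \<times> complex) set). 4 * e * (norm X)\<^sup>2)"
      unfolding \<Lambda>_def
    proof (rule sum_norm_le)
      fix b :: "complex \<times> complex" assume b: "b \<in> Basis"
      have nb: "norm b = 1" using b by simp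
      have "norm ((vx z \<bullet> b) *\<^sub>R A' x (vy z) b) \<le> norm X * (e * norm Y * norm b)"
        unfolding norm_scaleR X_def Y_def using Basis_le_norm[OF b, of "vx z"] A'b[OF xU, of "vy z" b] by (intro mult_mono) auto
      also have "\<dots> \<le> norm X * (e * (2 * norm X) * 1)" using Y2 nb e by (intro mult_mono mult_left_mono) auto
      finally have 1: "norm ((vx z \<bullet> b) *\<^sub>R A' x (vy z) b) \<le> 2 * e * (norm X)\<^sup>2" by (simp add: power2_eq_square algebra_simps)
      have "norm ((vy z \<bullet> b) *\<^sub>R A' x (vx z) b) \<le> norm Y * (e * norm X * norm b)"
        unfolding norm_scaleR X_def Y_def using Basis_le_norm[OF b, of "vy z"] A'b[OF xU, of "vx z" b] by (intro mult_mono) auto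
      also have "\<dots> \<le> (2 * norm X) * (e * norm X * 1)" using Y2 nb e by (intro mult_mono) auto
      finally have 2: "norm ((vy z \<bullet> b) *\<^sub>R A' x (vx z) b) \<le> 2 * e * (norm X)\<^sup>2" by (simp add: power2_eq_square algebra_simps)
      show "norm ((vx z \<bullet> b) *\<^sub>R A' x (vy z) b - (vy z \<bullet> b) *\<^sub>R A' x (vx z) b) \<le> 4 * e * (norm X)\<^sup>2"
        using norm_triangle_ineq4[of "(vx z \<bullet> b) *\<^sub>R A' x (vy z) b" "(vy z \<bullet> b) *\<^sub>R A' x (vx z) b"] 1 2 by linarith
    qed
    also have "\<dots> = 16 * e * (norm X)\<^sup>2" by simp
    finally show ?thesis .
  qed
  define q where "q = en z"
  have q0: "q \<noteq> 0" using z by (simp add: q_def)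
  have ql: "q = l (x - p)" by (simp add: q_def en_def x_def)
  have xp: "x \<noteq> p" using q0 linear_0[OF l_linear] unfolding ql by auto
  define DD where "DD = (\<lambda>x k. cutlog1 (l (x - p) \<bullet> l (x - p)) * (2 * (l (x - p) \<bullet> l k)) + B * Dphi D lam \<kappa> x k)"
  define DD' where "DD' = (\<lambda>x h k. (4 * cutlog2 (l (x - p) \<bullet> l (x - p)) * (l (x - p) \<bullet> l h) * (l (x - p) \<bullet> l k)
      + 2 * cutlog1 (l (x - p) \<bullet> l (x - p)) * (l h \<bullet> l k)) + B * D2phi D2 lam \<kappa> x h k)"
  have pos: "l (y - p) \<bullet> l (y - p) > 0" if "y \<in> ball x (norm (x - p))" for y
    using that l_eq_0[of "y - p"] by (auto simp: dist_norm)
  have d1: "((\<lambda>x. cutlog (l (x - p) \<bullet> l (x - p)) + B * ph x) has_derivative DD y) (at y)" if "y \<in> ball x (norm (x - p))" for y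
    unfolding DD_def
    by (rule has_derivative_add[OF has_derivative_radial[OF l_bl DERIV_cutlog[OF pos[OF that]]]
        has_derivative_mult_right[OF phi_der[OF dW]]])
  have d2: "((\<lambda>x. DD x k) has_derivative (\<lambda>h. DD' y h k)) (at y)" if "y \<in> ball x (norm (x - p))" for y k
    unfolding DD_def DD'_def
    by (rule has_derivative_add[OF has_derivative_radial2[OF l_bl DERIV_cutlog1[OF pos[OF that]]]
        has_derivative_mult_right[OF Dphi_der[OF dD]]])
  have "has_lap (\<lambda>w. cutlog (l (v w - p) \<bullet> l (v w - p)) + B * ph (v w)) (\<lambda>w. DD (v w) (vx w)) (\<lambda>w. DD (v w) (vy w)) z
     (DD' x (vx z) (vx z) + DD' x (vy z) (vy z) + DD x \<Lambda>)"
  proof (rule has_lap_compose[OF lapv, where e = "norm (x - p)" and \<Psi> = "\<lambda>x. cutlog (l (x - p) \<bullet> l (x - p)) + B * ph x" and D = DD and D' = "DD' x", folded x_def])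
    show "norm (x - p) > 0" using xp by simp
    show "continuous_on (ball x (norm (x - p))) (\<lambda>x. DD x k)" for k
      by (rule has_derivative_continuous_on) (blast intro: has_derivative_at_withinI d2)
    show "((\<lambda>x. DD x k) has_derivative (\<lambda>h. DD' x h k)) (at x)" for k using d2[of x k] xp by simp
    show "linear (DD' x h)" for h
    proof -
      have "linear (\<lambda>k. 4 * cutlog2 (l (x - p) \<bullet> l (x - p)) * (l (x - p) \<bullet> l h) * (l (x - p) \<bullet> l k)
      + 2 * cutlog1 (l (x - p) \<bullet> l (x - p)) * (l h \<bullet> l k))"
        by (rule linearI) (simp_all add: linear_add[OF l_linear] linear_cmul[OF l_linear] inner_add_right algebra_simps)
      moreover have ld: "linear (D2phi D2 lam \<kappa> x h)" by (rule D2phi_linear) (rule lD2)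
      have "linear (\<lambda>k. B * D2phi D2 lam \<kappa> x h k)"
        by (rule linearI) (simp_all add: linear_add[OF ld] linear_cmul[OF ld] algebra_simps)
      ultimately show ?thesis unfolding DD'_def by (rule linear_compose_add)
    qed
  qed (fact d1)
  then have "has_lap (\<lambda>w. cutlog (en w \<bullet> en w) + B * ph (v w)) (\<lambda>w. DD (v w) (vx w)) (\<lambda>w. DD (v w) (vy w)) z
     (DD' x X X + DD' x Y Y + DD x \<Lambda>)" unfolding en_def X_def Y_def x_def .
  moreover have "DD' x X X + DD' x Y Y + DD x \<Lambda> \<ge> 0"
  proof -
    define a where "a = l X"
    define b where "b = l Y"
    have split: "DD' x X X + DD' x Y Y + DD x \<Lambda> =
      (2 * cutlog1 (q \<bullet> q) * (a \<bullet> a + b \<bullet> b + q \<bullet> l \<Lambda>) + 4 * cutlog2 (q \<bullet> q) * ((q \<bullet> a)\<^sup>2 + (q \<bullet> b)\<^sup>2))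
      + B * (D2phi D2 lam \<kappa> x X X + D2phi D2 lam \<kappa> x Y Y + Dphi D lam \<kappa> x \<Lambda>)"
      unfolding DD'_def DD_def ql[symmetric] a_def b_def by (simp add: power2_eq_square algebra_simps)
    have levi': "B * (D2phi D2 lam \<kappa> x X X + D2phi D2 lam \<kappa> x Y Y + Dphi D lam \<kappa> x \<Lambda>) \<ge> 112 * (norm X)\<^sup>2"
    proof -
      have "B * (\<kappa> * (norm X)\<^sup>2) \<le> B * (D2phi D2 lam \<kappa> x X X + D2phi D2 lam \<kappa> x Y Y + Dphi D lam \<kappa> x \<Lambda>)"
        using B levi[OF xU YX L16] by (intro mult_left_mono) auto
      then show ?thesis using B(2) by (simp flip: mult.assoc)
    qed
    have "2 * cutlog1 (q \<bullet> q) * (a \<bullet> a + b \<bullet> b + q \<bullet> l \<Lambda>) + 4 * cutlog2 (q \<bullet> q) * ((q \<bullet> a)\<^sup>2 + (q \<bullet> b)\<^sup>2) \<ge> - 112 * (norm X)\<^sup>2"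
    proof (cases "norm q < 1")
      case True
      have Xa: "norm X \<le> 2 * norm a" "norm a \<le> 2 * norm X" using l_bounds[of X] by (auto simp: a_def)
      \<comment> \<open>Using \<open>4 * e\<close> instead of \<open>e\<close> absorbs the
        distortion factors 2 of \<open>l\<close>; it is at most \<open>1/10000\<close> by the
        assumption on \<open>e\<close>.\<close>
      have "- 28 * (norm a)\<^sup>2 \<le> 2 * cutlog1 (q \<bullet> q) * (a \<bullet> a + b \<bullet> b + q \<bullet> l \<Lambda>) + 4 * cutlog2 (q \<bullet> q) * ((q \<bullet> a)\<^sup>2 + (q \<bullet> b)\<^sup>2)"
      proof (rule lap_cutlog_lower[of "4 * e"])
        show "0 \<le> 4 * e" "4 * e \<le> 1/10000" "0 < norm q" "norm q < 1" using e q0 True by auto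
        \<comment> \<open>\<open>l\<close> carries \<open>A p X\<close> to \<open>imul a\<close>, so
          only the variation of \<open>A\<close> between \<open>p\<close> and \<open>x\<close>
          remains; this is the source of the factor \<open>|q|\<close>.\<close>
        have "b - imul a = l (A x X - A p X)"
          unfolding a_def b_def Yeq linear_diff[OF l_linear] l_imul ..
        then have "norm (b - imul a) \<le> 2 * norm (A x X - A p X)" using l_bounds(2) by simp
        also have "\<dots> \<le> 2 * (e * norm X * norm (x - p))" using A_lip[OF xU, of X] by simp
        also have "\<dots> \<le> 2 * (e * (2 * norm a) * (2 * norm q))"
          using Xa l_bounds(1)[of "x - p"] e unfolding ql by (intro mult_left_mono mult_mono) auto
        also have "\<dots> \<le> 8 * (4 * e) * norm q * norm a" using e by (simp add: algebra_simps)
        finally show "norm (b - imul a) \<le> 8 * (4 * e) * norm q * norm a" .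
        have "norm (l \<Lambda>) \<le> 2 * (16 * e * (norm X)\<^sup>2)" using l_bounds(2)[of \<Lambda>] L16 by linarith
        also have "\<dots> \<le> 2 * (16 * e * (2 * norm a)\<^sup>2)" using Xa e by (intro mult_left_mono power_mono) auto
        also have "\<dots> = 32 * (4 * e) * (norm a)\<^sup>2" by (simp add: power2_eq_square)
        finally show "norm (l \<Lambda>) \<le> 32 * (4 * e) * (norm a)\<^sup>2" .
      qed
      moreover have "(norm a)\<^sup>2 \<le> (2 * norm X)\<^sup>2" using Xa by (intro power_mono) auto
      ultimately show ?thesis by (simp add: power_mult_distrib)
    next
      case False
      then have "1 \<le> (norm q)\<^sup>2" by (simp add: one_le_power)
      then have "q \<bullet> q \<ge> 1" by (simp add: power2_norm_eq_inner)
      then show ?thesis by (simp add: cutlog1_def cutlog2_def)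
    qed
    then show ?thesis unfolding split using levi' by linarith
  qed
  ultimately show ?thesis by blast
qed

end

section \<open>The cut-off test function and the maximum principle along the disc\<close>

context scaled_disc
begin

definition "Phi x = (if x \<in> U then max (ph x) (- M) else - M)"

text \<open>The exponential of Sibony's test function divided by \<open>|z|\<close> to the power
  \<open>2 c\<close>, with \<open>|z|^2\<close> added in the exponent for strictness.\<close>

definition "S c z = exp_cutlog (en z \<bullet> en z) * exp (B * Phi (v z)) * exp (- c * ln (z \<bullet> z) + z \<bullet> z)"

lemma M2: "- M \<le> 2"
proof -
  have "Re (snd p) + H (fst p) \<le> e" using vdom[of 0] pU by (simp add: p_def)
  then have "ph p \<le> 2" using upper[OF pU] by simp
  moreover have "ph p > - M" using v0 by (intro inner) (auto simp: p_def)
  ultimately show ?thesis by simp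
qed

lemma Phi_bounds: assumes "z \<in> ball 0 1" shows "- M \<le> Phi (v z)" "Phi (v z) \<le> 2"
  using M2 upper vdom[OF assms] by (auto simp: Phi_def)

lemma exp_Phi_bounds:
  assumes "z \<in> ball 0 1"
  shows "exp (B * (- M)) \<le> exp (B * Phi (v z))" "exp (B * Phi (v z)) \<le> exp (B * 2)"
  unfolding exp_le_cancel_iff using B(1) Phi_bounds[OF assms] by (intro mult_left_mono; simp)+

lemma ph_cont: "continuous_on UNIV ph"
  by (rule has_derivative_continuous_on) (rule phi_der[OF dW])

lemma en_cont: "continuous_on (ball 0 1) en"
  unfolding en_def[abs_def] by (intro bounded_linear.continuous_on[OF l_bl] continuous_intros v_cont)

text \<open>Two open sets cover the disc: where \<open>v z\<close> lies in \<open>U\<close>, and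
  where it lies outside the closed polydisc with half the radii. On the second, \<open>shell\<close>
  makes \<open>Phi\<close> constantly \<open>- M\<close>, so no jump occurs at the boundary of
  \<open>U\<close>.\<close>

lemma Phi_cont: "continuous_on (ball 0 1) (\<lambda>z. Phi (v z))"
proof -
  define S1 where "S1 = ball 0 1 \<inter> v -` U"
  define K where "K = {x :: complex \<times> complex. norm (fst x) \<le> R1 / 2 \<and> norm (snd x) \<le> R / 2}"
  define S2 where "S2 = ball 0 1 \<inter> v -` (- K)"
  have "closed K"
  proof -
    have "K = (\<lambda>x. norm (fst x)) -` {..R1 / 2} \<inter> (\<lambda>x. norm (snd x)) -` {..R / 2}" unfolding K_def by auto
    then show ?thesis by (simp add: closed_Int closed_vimage continuous_on_fst continuous_on_snd continuous_on_norm)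
  qed
  have o: "open S1" "open S2"
    unfolding S1_def S2_def using v_cont U_open \<open>closed K\<close> continuous_on_open_vimage[of "ball 0 1" v] open_Compl[of K]
    by (simp_all add: Int_commute)
  have KU: "K \<subseteq> U" unfolding K_def U_def using R R1 by auto
  have "S1 \<union> S2 = ball 0 1" using KU by (auto simp: S1_def S2_def)
  moreover have "continuous_on S1 (\<lambda>z. Phi (v z))"
  proof (rule continuous_on_eq)
    show "continuous_on S1 (\<lambda>z. max (ph (v z)) (- M))"
      by (intro continuous_intros continuous_on_compose2[OF ph_cont] continuous_on_subset[OF v_cont]) (auto simp: S1_def)
  qed (auto simp: S1_def Phi_def)
  moreover have "continuous_on S2 (\<lambda>z. Phi (v z))"
  proof (rule continuous_on_eq)
    show "continuous_on S2 (\<lambda>z. - M)" by simp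
    fix z assume z: "z \<in> S2"
    show "- M = Phi (v z)"
    proof (cases "v z \<in> U")
      case True
      have "R1 / 2 \<le> norm (fst (v z)) \<or> R / 2 \<le> norm (snd (v z))" using z by (auto simp: S2_def K_def)
      then have "ph (v z) < - M" using shell[OF True] vdom[of z] z True by (auto simp: S2_def)
      then show ?thesis using True by (simp add: Phi_def)
    qed (simp add: Phi_def)
  qed
  ultimately show ?thesis using continuous_on_open_Un[OF o] by metis
qed

lemma S_cont: "continuous_on (ball 0 1 - {0}) (S c)"
  unfolding S_def[abs_def]
  by (intro continuous_intros continuous_on_compose2[OF continuous_exp_cutlog] continuous_on_subset[OF en_cont] continuous_on_subset[OF Phi_cont]) auto

lemma open_near:
  fixes f :: "complex \<Rightarrow> 'x::topological_space"
  assumes "z \<in> ball 0 1" "open T" "f z \<in> T" "continuous_on (ball 0 1) f"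
  shows "\<exists>d>0. ball z d \<subseteq> ball 0 1 \<and> f ` ball z d \<subseteq> T"
proof -
  have "open (ball 0 1 \<inter> f -` T)" using assms continuous_on_open_vimage[of "ball 0 1" f] by (simp add: Int_commute)
  moreover have "z \<in> ball 0 1 \<inter> f -` T" using assms by simp
  ultimately obtain d where "d > 0" "ball z d \<subseteq> ball 0 1 \<inter> f -` T" unfolding open_contains_ball by meson
  then show ?thesis by blast
qed

text \<open>Where \<open>ph >= - M\<close>, replacing \<open>Phi\<close> by \<open>ph\<close> gives
  a function with Laplacian at least 4 that supports \<open>ln (S c)\<close> from below. At all
  other points \<open>cutlog\<close> is locally constant and \<open>Phi\<close> attains its minimum,
  so the radial weight alone yields such a support.\<close>

lemma S_no_local_max:
  assumes z: "z \<in> ball 0 1" "z \<noteq> 0" "en z \<noteq> 0" and r: "r > 0"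
    and mx: "\<And>w. w \<in> ball z r \<Longrightarrow> w \<in> ball 0 1 \<Longrightarrow> S c w \<le> S c z"
  shows False
proof -
  obtain gx gy where rad: "has_lap (\<lambda>w. - c * ln (w \<bullet> w) + 1 * (w \<bullet> w)) gx gy z (4 * 1)"
    using has_lap_radial_weight[OF z(2)] by blast
  show False
  proof (cases "v z \<in> U \<and> ph (v z) \<ge> - M")
    case True
    obtain hx hy L where L: "has_lap (\<lambda>w. cutlog (en w \<bullet> en w) + B * ph (v w)) hx hy z L" "L \<ge> 0"
      using lap_test_function_nonneg[OF z(1) _ z(3)] True by blast
    obtain d1 where d1: "d1 > 0" "ball z d1 \<subseteq> ball 0 1" "en ` ball z d1 \<subseteq> - {0}"
      using open_near[OF z(1), of "- {0}" en] z(3) en_cont by auto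
    obtain d2 where d2: "d2 > 0" "v ` ball z d2 \<subseteq> U"
      using open_near[OF z(1) U_open, of v] True v_cont by auto
    define F where "F = (\<lambda>w. (cutlog (en w \<bullet> en w) + B * ph (v w)) + (- c * ln (w \<bullet> w) + 1 * (w \<bullet> w)))"
    have lapF: "has_lap F (\<lambda>w. hx w + gx w) (\<lambda>w. hy w + gy w) z (L + 4 * 1)"
      unfolding F_def by (rule has_lap_add[OF L(1) rad])
    \<comment> \<open>The maximum defining \<open>Phi\<close> is not differentiable, but a local
      maximum of \<open>S c\<close> is also one of any lower support that touches it at
      \<open>z\<close>.\<close>
    have FS: "exp (F w) \<le> S c w" if w: "w \<in> ball z (min r (min d1 d2))" for w
    proof -
      have pos: "en w \<bullet> en w > 0" using w d1(3) by auto
      have "v w \<in> U" using w d2 by auto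
      then have "ph (v w) \<le> Phi (v w)" by (simp add: Phi_def)
      then have "B * ph (v w) \<le> B * Phi (v w)" using B by simp
      then have "exp (F w) \<le> exp (cutlog (en w \<bullet> en w) + B * Phi (v w) + (- c * ln (w \<bullet> w) + w \<bullet> w))"
        by (simp add: F_def)
      also have "\<dots> = S c w" unfolding S_def exp_cutlog[OF pos, symmetric] by (simp only: exp_add)
      finally show ?thesis .
    qed
    have eq: "S c z = exp (F z)"
    proof -
      have "Phi (v z) = ph (v z)" using True by (simp add: Phi_def)
      moreover have pos: "en z \<bullet> en z > 0" using z by simp
      ultimately show ?thesis unfolding S_def F_def exp_cutlog[OF pos, symmetric] by (simp only: exp_add mult_1)
    qed
    show False
    proof (rule has_lap_pos_imp_not_local_max[OF lapF])
      show "L + 4 * 1 > 0" using L by simp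
      show "min r (min d1 d2) > 0" using r d1 d2 by simp
      fix w assume w: "w \<in> ball z (min r (min d1 d2))"
      then have "w \<in> ball z r" "w \<in> ball 0 1" using d1 by auto
      then have "exp (F w) \<le> exp (F z)" using order_trans[OF FS[OF w] mx[of w]] unfolding eq by blast
      then show "F w \<le> F z" by (simp only: exp_le_cancel_iff)
    qed
  next
    case False
    have big: "norm (en z) > 1"
    proof (rule ccontr)
      assume "\<not> norm (en z) > 1"
      then have "norm (en z) \<le> 1" by simp
      from en_small[OF this] show False using False inner[of "v z"] by auto
    qed
    have Phz: "Phi (v z) = - M" using False by (auto simp: Phi_def)
    have cn: "continuous_on (ball 0 1) (\<lambda>w. norm (en w))" by (intro continuous_intros en_cont)
    obtain d1 where d1: "d1 > 0" "ball z d1 \<subseteq> ball 0 1" "(\<lambda>w. norm (en w)) ` ball z d1 \<subseteq> {1<..}"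
      using open_near[OF z(1), of "{1<..}" "\<lambda>w. norm (en w)"] big cn by auto
    define F where "F = (\<lambda>w :: complex. - c * ln (w \<bullet> w) + 1 * (w \<bullet> w))"
    define K where "K = exp_cutlog 1 * exp (B * (- M))"
    have K: "K > 0" unfolding K_def exp_cutlog_def by simp
    have ec: "exp_cutlog (en w \<bullet> en w) = exp_cutlog 1" if "w \<in> ball z d1" for w
    proof -
      have "norm (en w) > 1" using subsetD[OF d1(3) imageI[OF that]] by simp
      then have "1 \<le> (norm (en w))\<^sup>2" by (simp add: one_le_power)
      then have "en w \<bullet> en w \<ge> 1" by (simp add: power2_norm_eq_inner)
      then show ?thesis by (simp add: exp_cutlog_def min_def)
    qed
    have eq: "S c z = K * exp (F z)" unfolding S_def K_def F_def Phz using ec[of z] d1 by simp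
    show False
    proof (rule has_lap_pos_imp_not_local_max[OF rad])
      show "min r d1 > 0" using r d1 by simp
      fix w assume w: "w \<in> ball z (min r d1)"
      then have w1: "w \<in> ball 0 1" "w \<in> ball z d1" using d1 by auto
      have "K * exp (F w) \<le> S c w"
        unfolding K_def S_def F_def ec[OF w1(2)] using exp_Phi_bounds(1)[OF w1(1)]
        by (simp add: exp_cutlog_def del: mult_minus_right)
      also have "\<dots> \<le> S c z" using mx[of w] w w1 by auto
      finally have "exp (F w) \<le> exp (F z)" unfolding eq using K by simp
      then show "- c * ln (w \<bullet> w) + 1 * (w \<bullet> w) \<le> - c * ln (z \<bullet> z) + 1 * (z \<bullet> z)" by (simp add: F_def)
    qed simp
  qed
qed

text \<open>A bound for \<open>S c\<close> on the circle of radius 1/2. The last factor bounds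
  \<open>(1/4) powr (- c)\<close> times \<open>exp (1/4)\<close> for \<open>c < 1\<close>.\<close>

definition "K1 = exp 7 * exp (B * 2) * (4 * exp 1)"

lemma v_lipschitz_0: "\<exists>K d. K \<ge> 0 \<and> d > 0 \<and> (\<forall>z. norm z < d \<longrightarrow> norm (en z) \<le> K * norm z)"
proof -
  have d0: "(v has_derivative grad (vx 0) (vy 0)) (at 0)" using vder by simp
  have bl: "bounded_linear (grad (vx 0) (vy 0))" using d0 by (rule has_derivative_bounded_linear)
  obtain K where K: "K > 0" "\<And>h. norm (grad (vx 0) (vy 0) h) \<le> norm h * K"
    using bounded_linear.pos_bounded[OF bl] by blast
  obtain d where d: "d > 0" "\<And>y. norm (y - 0) < d \<Longrightarrow> norm (v y - v 0 - grad (vx 0) (vy 0) (y - 0)) \<le> 1 * norm (y - 0)"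
    using d0 unfolding has_derivative_at_alt by (metis zero_less_one)
  have "norm (en z) \<le> (2 * (K + 1)) * norm z" if "norm z < d" for z
  proof -
    have "norm (v z - p) \<le> norm (v z - v 0 - grad (vx 0) (vy 0) z) + norm (grad (vx 0) (vy 0) z)"
      unfolding p_def by (metis diff_add_cancel norm_triangle_ineq)
    also have "\<dots> \<le> (K + 1) * norm z" using d(2)[of z] that K(2)[of z] by (simp add: algebra_simps)
    finally have "norm (en z) \<le> 2 * ((K + 1) * norm z)" using l_bounds(2)[of "v z - p"] unfolding en_def by linarith
    then show ?thesis by (simp only: mult.assoc)
  qed
  then show ?thesis using K(1) d(1) by (intro exI[of _ "2 * (K + 1)"] exI[of _ d]) auto
qed

text \<open>Maximum principle on an annulus. The outer circle is controlled by \<open>K1\<close>,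
  and near 0 the function is \<open>O(|w|^(2 - 2c))\<close>, hence below the supposed large value at
  \<open>z\<close>. The maximum would be interior, at a point where \<open>en\<close> is nonzero
  because \<open>S c\<close> is positive there.\<close>

lemma S_bound:
  assumes c: "0 < c" "c < 1" and z: "z \<noteq> 0" "norm z < 1/2"
  shows "S c z \<le> K1"
proof (rule ccontr)
  assume "\<not> S c z \<le> K1"
  then have Sz: "S c z > K1" by simp
  have K1: "K1 > 0" by (simp add: K1_def)
  obtain K d where K: "K \<ge> 0" "d > 0" "\<And>w. norm w < d \<Longrightarrow> norm (en w) \<le> K * norm w"
    using v_lipschitz_0 by blast
  define K2 where "K2 = K\<^sup>2 * exp 7 * exp (B * 2) * exp 1"
  have small: "S c w \<le> K2 * (w \<bullet> w) powr (1 - c)" if w: "w \<noteq> 0" "norm w < d" "norm w < 1" for w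
  proof -
    have ww: "w \<bullet> w > 0" using w by simp
    have "(norm (en w))\<^sup>2 \<le> (K * norm w)\<^sup>2" using K(3)[OF w(2)] by (intro power_mono) auto
    then have "en w \<bullet> en w \<le> K\<^sup>2 * (w \<bullet> w)" by (simp add: power2_norm_eq_inner power_mult_distrib)
    then have 1: "exp_cutlog (en w \<bullet> en w) \<le> K\<^sup>2 * (w \<bullet> w) * exp 7"
      using exp_cutlog_le(2)[of "en w \<bullet> en w"] by (meson exp_ge_zero inner_ge_zero mult_right_mono order_trans)
    have 2: "exp (B * Phi (v w)) \<le> exp (B * 2)" using w by (intro exp_Phi_bounds) simp
    have "w \<bullet> w \<le> 1" using w by (simp add: power2_norm_eq_inner[symmetric] power_le_one)
    then have 3: "exp (- c * ln (w \<bullet> w) + w \<bullet> w) \<le> (w \<bullet> w) powr (- c) * exp 1"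
      using ww unfolding exp_add by (simp add: powr_def)
    have 0: "0 \<le> exp_cutlog (en w \<bullet> en w)" by (simp add: exp_cutlog_def)
    have "S c w \<le> (K\<^sup>2 * (w \<bullet> w) * exp 7) * exp (B * 2) * ((w \<bullet> w) powr (- c) * exp 1)"
      unfolding S_def by (intro mult_mono 1 2 3 mult_nonneg_nonneg) (use 0 in auto)
    also have "\<dots> = K2 * ((w \<bullet> w) powr 1 * (w \<bullet> w) powr (- c))" using ww by (simp add: K2_def algebra_simps)
    also have "\<dots> = K2 * (w \<bullet> w) powr (1 - c)" by (simp only: powr_add[symmetric] add_uminus_conv_diff)
    finally show ?thesis .
  qed
  have "((\<lambda>w::complex. K2 * (w \<bullet> w) powr (1 - c)) \<longlongrightarrow> K2 * 0) (at 0)"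
  proof (intro tendsto_mult tendsto_const tendsto_zero_powrI[where b = "1 - c"])
    have "((\<lambda>w::complex. w \<bullet> w) \<longlongrightarrow> (0::complex) \<bullet> 0) (at 0)" by (intro tendsto_inner tendsto_ident_at)
    then show "((\<lambda>w::complex. w \<bullet> w) \<longlongrightarrow> 0) (at 0)" by simp
  qed (use c in auto)
  \<comment> \<open>This is where \<open>c < 1\<close> matters: the exponent \<open>1 - c\<close> is
    positive, so the bound \<open>small\<close> tends to 0 at the centre.\<close>
  then have "\<forall>\<^sub>F w::complex in at 0. K2 * (w \<bullet> w) powr (1 - c) < S c z"
    using Sz K1 by (intro order_tendstoD(2)[where y = "K2 * 0"]) simp_all
  then obtain a0 where a0: "a0 > 0" "\<And>w::complex. w \<noteq> 0 \<Longrightarrow> norm w < a0 \<Longrightarrow> K2 * (w \<bullet> w) powr (1 - c) < S c z"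
    unfolding eventually_at by (auto simp: dist_norm)
  define n where "n = min (norm z) (min a0 (min d 1))"
  have n: "n > 0" "n \<le> norm z" "n \<le> a0" "n \<le> d" "n \<le> 1"
    using z a0 K unfolding n_def min_le_iff_disj by simp_all
  define a where "a = n / 2"
  have a: "a > 0" "a < norm z" "a < a0" "a < d" "a < 1/2" using n z unfolding a_def by linarith+
  define T where "T = cball 0 (1/2) - ball (0::complex) a"
  have T: "compact T" unfolding T_def by (simp add: compact_diff)
  have Tsub: "T \<subseteq> ball 0 1 - {0}" using a by (auto simp: T_def)
  have zT: "z \<in> T" using z a by (auto simp: T_def)
  obtain y where y: "y \<in> T" "\<And>w. w \<in> T \<Longrightarrow> S c w \<le> S c y"
    using continuous_attains_sup[OF T _ continuous_on_subset[OF S_cont Tsub]] zT by blast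
  have Sy: "S c y \<ge> S c z" using y(2)[OF zT] .
  have y0: "y \<noteq> 0" "y \<in> ball 0 1" using y Tsub by auto
  have "norm y \<noteq> a"
  proof
    assume na: "norm y = a"
    have "S c y \<le> K2 * (y \<bullet> y) powr (1 - c)" using small[OF y0(1)] na a by simp
    also have "\<dots> < S c z" using a0(2)[OF y0(1)] na a by simp
    finally show False using Sy by simp
  qed
  moreover have "norm y \<noteq> 1/2"
  proof
    assume ny: "norm y = 1/2"
    have yy: "y \<bullet> y = 1/4" unfolding power2_norm_eq_inner[symmetric] ny by (simp add: power2_eq_square)
    have "- c * ln (y \<bullet> y) = c * ln 4" unfolding yy by (simp add: ln_div)
    also have "\<dots> \<le> 1 * ln 4" using c by (intro mult_right_mono) auto
    finally have "- c * ln (y \<bullet> y) + y \<bullet> y \<le> ln 4 + 1" unfolding yy by simp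
    then have 3: "exp (- c * ln (y \<bullet> y) + y \<bullet> y) \<le> 4 * exp 1"
      using exp_le_cancel_iff[of "- c * ln (y \<bullet> y) + y \<bullet> y" "ln 4 + 1"] by (simp add: exp_add)
    have 2: "exp (B * Phi (v y)) \<le> exp (B * 2)" using y0 by (intro exp_Phi_bounds) simp
    have 0: "0 \<le> exp_cutlog (en y \<bullet> en y)" by (simp add: exp_cutlog_def)
    have "S c y \<le> K1" unfolding S_def K1_def
      by (intro mult_mono 2 3 exp_cutlog_le(1) mult_nonneg_nonneg) (use 0 in auto)
    then show False using Sy Sz by simp
  qed
  ultimately have ya: "a < norm y" "norm y < 1/2" using y(1) by (auto simp: T_def)
  define r where "r = min (norm y - a) (1/2 - norm y)"
  show False
  proof (rule S_no_local_max[of y r c])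
    show "y \<in> ball 0 1" "y \<noteq> 0" using y0 by auto
    show "en y \<noteq> 0"
    proof
      assume "en y = 0"
      then have "S c y = 0" by (simp add: S_def)
      then show False using Sy Sz K1 by simp
    qed
    show "r > 0" using ya by (simp add: r_def)
    fix w assume w: "w \<in> ball y r"
    have "norm w \<le> norm y + norm (w - y)" "norm y \<le> norm w + norm (w - y)"
      by (metis norm_triangle_sub add.commute) (metis norm_triangle_sub norm_minus_commute)
    then have "w \<in> T" using w by (auto simp: T_def r_def dist_norm norm_minus_commute)
    then show "S c w \<le> S c y" by (rule y(2))
  qed
qed

definition "K2 = sqrt (K1 * exp (B * M + 7))"

text \<open>Let \<open>c\<close> tend to 1 in \<open>S_bound\<close>. The lower bounds
  \<open>- M\<close> for \<open>Phi\<close> and \<open>x * exp (- 7)\<close> for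
  \<open>exp_cutlog x\<close> then bound the square of \<open>|en z| / |z|\<close>.\<close>

lemma en_bound:
  assumes z: "z \<noteq> 0" "norm z < 1/2" "norm (en z) \<le> 1"
  shows "norm (en z) \<le> K2 * norm z"
proof -
  define x where "x = en z \<bullet> en z"
  have zz: "z \<bullet> z > 0" using z by simp
  have x: "0 \<le> x" "x \<le> 1" unfolding x_def using z by (auto simp: power2_norm_eq_inner[symmetric] power_le_one)
  have "exp_cutlog x * exp (B * (- M)) * exp (- c * ln (z \<bullet> z)) \<le> K1" if c: "0 < c" "c < 1" for c
  proof -
    have "exp_cutlog x * exp (B * (- M)) * exp (- c * ln (z \<bullet> z)) \<le> S c z"
      unfolding S_def x_def[symmetric]
    proof (intro mult_mono mult_nonneg_nonneg)
      show "exp (B * (- M)) \<le> exp (B * Phi (v z))" using z by (intro exp_Phi_bounds) simp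
    qed (use x in \<open>auto simp: exp_cutlog_def\<close>)
    then show ?thesis using S_bound[OF c z(1,2)] by simp
  qed
  \<comment> \<open>The values \<open>1 - 1 / (n + 2)\<close> lie strictly between 0 and 1, as
    \<open>S_bound\<close> requires.\<close>
  moreover have "(\<lambda>n. exp_cutlog x * exp (B * (- M)) * exp (- (1 - inverse (real (Suc (Suc n)))) * ln (z \<bullet> z))) \<longlonglongrightarrow>
     exp_cutlog x * exp (B * (- M)) * exp (- (1 - 0) * ln (z \<bullet> z))"
    by (intro tendsto_intros) (rule LIMSEQ_Suc[OF LIMSEQ_inverse_real_of_nat])
  moreover have "0 < 1 - inverse (real (Suc (Suc n)))" "1 - inverse (real (Suc (Suc n))) < 1" for n by (auto simp: field_simps)
  ultimately have "exp_cutlog x * exp (B * (- M)) * exp (- (1 - 0) * ln (z \<bullet> z)) \<le> K1"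
    by (intro LIMSEQ_le_const2) blast+
  then have "exp_cutlog x * exp (B * (- M)) * (1 / (z \<bullet> z)) \<le> K1" using zz by (simp add: exp_minus inverse_eq_divide)
  then have "exp_cutlog x * exp (B * (- M)) \<le> K1 * (z \<bullet> z)" using zz by (simp add: field_simps)
  then have 1: "exp_cutlog x \<le> K1 * (z \<bullet> z) * exp (B * M)" by (simp add: exp_minus field_simps)
  have "x * exp (- 7) \<le> exp_cutlog x" using exp_cutlog_ge[OF x] .
  then have "x * exp (- 7) \<le> K1 * (z \<bullet> z) * exp (B * M)" using 1 by linarith
  then have "x \<le> K1 * (z \<bullet> z) * exp (B * M) * exp 7" by (simp add: exp_minus field_simps)
  also have "\<dots> = K1 * exp (B * M + 7) * (norm z)\<^sup>2" by (simp add: exp_add power2_norm_eq_inner)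
  finally have "(norm (en z))\<^sup>2 \<le> K1 * exp (B * M + 7) * (norm z)\<^sup>2" by (simp add: x_def power2_norm_eq_inner)
  then have "norm (en z) \<le> sqrt (K1 * exp (B * M + 7) * (norm z)\<^sup>2)" by (rule real_le_rsqrt)
  then show ?thesis by (simp add: K2_def real_sqrt_mult)
qed

text \<open>Difference quotients along the positive real axis; the factor 2 is the distortion of
  \<open>l\<close>.\<close>

theorem gradient_bound: "norm (vx 0) \<le> 2 * K2"
proof (rule field_le_epsilon)
  fix d :: real assume d: "d > 0"
  have d0: "(v has_derivative grad (vx 0) (vy 0)) (at 0)" using vder by simp
  obtain r where r: "r > 0" "\<And>y. norm (y - 0) < r \<Longrightarrow> norm (v y - v 0 - grad (vx 0) (vy 0) (y - 0)) \<le> d * norm (y - 0)"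
    using d0 d unfolding has_derivative_at_alt by metis
  obtain K s where K: "K \<ge> 0" "s > 0" "\<And>z. norm z < s \<Longrightarrow> norm (en z) \<le> K * norm z" using v_lipschitz_0 by blast
  \<comment> \<open>The last entry gives \<open>|en z| <= K * t <= 1\<close>, the range in which
    \<open>en_bound\<close> applies.\<close>
  define t where "t = min (1/4) (min (r/2) (min (s/2) (1 / (K + 1))))"
  have t0: "t > 0" "t \<le> 1/4" "t \<le> r/2" "t \<le> s/2" "t \<le> 1 / (K + 1)"
    using r K unfolding t_def min_le_iff_disj by simp_all
  then have t: "t > 0" "t < 1/2" "t < r" "t < s" "t \<le> 1 / (K + 1)" by linarith+
  define z where "z = complex_of_real t"
  have z: "z \<noteq> 0" "norm z = t" using t by (auto simp: z_def)
  have "K * t \<le> 1"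
  proof -
    have "(K + 1) * t \<le> 1" using t(5) K by (simp add: pos_le_divide_eq mult.commute)
    then show ?thesis using t(1) by (simp add: distrib_right)
  qed
  then have "norm (en z) \<le> 1" using K(3)[of z] z t by simp
  then have "norm (en z) \<le> K2 * t" using en_bound[of z] z t by simp
  then have 1: "norm (v z - p) \<le> 2 * (K2 * t)" using l_bounds(1)[of "v z - p"] by (simp add: en_def)
  have g: "grad (vx 0) (vy 0) z = t *\<^sub>R vx 0" by (simp add: grad_def z_def)
  have 2: "norm (v z - p - t *\<^sub>R vx 0) \<le> d * t" using r(2)[of z] z t g by (simp add: p_def)
  have "norm (t *\<^sub>R vx 0) \<le> norm (v z - p) + norm (v z - p - t *\<^sub>R vx 0)"
    using norm_triangle_ineq4[of "v z - p" "v z - p - t *\<^sub>R vx 0"] by simp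
  then have "t * norm (vx 0) \<le> t * (2 * K2 + d)" using 1 2 t by (simp add: algebra_simps)
  then show "norm (vx 0) \<le> 2 * K2 + d" using t by simp
qed

end

subsection \<open>Scaling\<close>

lemma hpoly_bound: "\<exists>C\<ge>0. \<forall>z. \<bar>hpoly c n z\<bar> \<le> C * norm z ^ n"
proof (intro exI[of _ "\<Sum>j\<le>n. \<bar>c j\<bar>"] conjI allI)
  fix z
  have "\<bar>hpoly c n z\<bar> \<le> (\<Sum>j\<le>n. \<bar>c j\<bar> * norm z ^ n)"
    unfolding hpoly_def
  proof (rule order_trans[OF sum_abs], rule sum_mono)
    fix j assume "j \<in> {..n}"
    then have n: "norm z ^ n = norm z ^ j * norm z ^ (n - j)" by (simp flip: power_add)
    have "\<bar>Re z\<bar> ^ j * \<bar>Im z\<bar> ^ (n - j) \<le> norm z ^ j * norm z ^ (n - j)"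
      by (intro mult_mono power_mono abs_Re_le_cmod abs_Im_le_cmod) auto
    then show "\<bar>c j * Re z ^ j * Im z ^ (n - j)\<bar> \<le> \<bar>c j\<bar> * norm z ^ n"
      unfolding n by (simp add: abs_mult power_abs mult.assoc mult_left_mono)
  qed
  then show "\<bar>hpoly c n z\<bar> \<le> (\<Sum>j\<le>n. \<bar>c j\<bar>) * norm z ^ n" by (simp add: sum_distrib_right)
qed (simp add: sum_nonneg)

lemma smooth_on_imp_has_derivative:
  assumes "smooth_on (ball 0 r) f" "x \<in> ball 0 r"
  shows "(f has_derivative frechet_derivative f (at x)) (at x)"
proof -
  have "Ck (Suc 0) (ball 0 r) f" using assms(1) unfolding smooth_on_def by blast
  then show ?thesis using assms(2) by (simp add: differentiable_on_eq_differentiable_at frechet_derivative_works)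
qed

lemma smooth_on_imp_bounded_derivative:
  fixes f :: "'a::euclidean_space \<Rightarrow> real"
  assumes f: "smooth_on (ball 0 r) f" and s: "s < r"
  shows "\<exists>K. K \<ge> 0 \<and> (\<forall>x\<in>cball 0 s. \<forall>h. \<bar>frechet_derivative f (at x) h\<bar> \<le> K * norm h)"
proof -
  have "Ck (Suc 0) (ball 0 r) f" using f unfolding smooth_on_def by blast
  then have c: "\<And>i. i \<in> Basis \<Longrightarrow> continuous_on (ball 0 r) (\<lambda>x. frechet_derivative f (at x) i)"
    by auto
  have "\<exists>k. \<forall>x\<in>cball 0 s. \<bar>frechet_derivative f (at x) i\<bar> \<le> k" if "i \<in> Basis" for i
  proof -
    have "cball 0 s \<subseteq> ball (0::'a) r" using s by auto
    then have "compact ((\<lambda>x. frechet_derivative f (at x) i) ` cball 0 s)"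
      by (intro compact_continuous_image continuous_on_subset[OF c[OF that]]) auto
    then have "bounded ((\<lambda>x. frechet_derivative f (at x) i) ` cball 0 s)" by (rule compact_imp_bounded)
    then show ?thesis unfolding bounded_iff by auto
  qed
  then obtain k where k: "\<And>i x. i \<in> Basis \<Longrightarrow> x \<in> cball 0 s \<Longrightarrow> \<bar>frechet_derivative f (at x) i\<bar> \<le> k i" by metis
  define K where "K = (\<Sum>i\<in>(Basis::'a set). \<bar>k i\<bar>)"
  have "\<bar>frechet_derivative f (at x) h\<bar> \<le> K * norm h" if x: "x \<in> cball 0 s" for x h
  proof -
    have "x \<in> ball 0 r" using x s by auto
    then have "linear (frechet_derivative f (at x))" using smooth_on_imp_has_derivative[OF f] has_derivative_linear by blast
    then have "\<bar>frechet_derivative f (at x) h\<bar> = \<bar>\<Sum>i\<in>Basis. (h \<bullet> i) * frechet_derivative f (at x) i\<bar>"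
      by (subst linear_euclidean_expand) auto
    also have "\<dots> \<le> (\<Sum>i\<in>Basis. norm h * \<bar>k i\<bar>)"
    proof (rule order_trans[OF sum_abs], rule sum_mono)
      fix i :: 'a assume i: "i \<in> Basis"
      show "\<bar>(h \<bullet> i) * frechet_derivative f (at x) i\<bar> \<le> norm h * \<bar>k i\<bar>"
        unfolding abs_mult using k[OF i x] Basis_le_norm[OF i, of h] by (intro mult_mono) auto
    qed
    also have "\<dots> = K * norm h" by (simp add: K_def sum_distrib_left mult.commute)
    finally show ?thesis .
  qed
  moreover have "K \<ge> 0" by (simp add: K_def sum_nonneg)
  ultimately show ?thesis by blast
qed

lemma norm_blk: "norm (blk a b c p w) \<le> (2 * \<bar>a p\<bar> + \<bar>b p\<bar> + \<bar>c p\<bar>) * norm w"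
proof -
  have 1: "\<bar>x * Re w\<bar> \<le> \<bar>x\<bar> * norm w" "\<bar>x * Im w\<bar> \<le> \<bar>x\<bar> * norm w" for x
    unfolding abs_mult by (intro mult_left_mono abs_Re_le_cmod abs_Im_le_cmod abs_ge_zero)+
  have "norm (blk a b c p w) \<le> \<bar>a p * Re w + b p * Im w\<bar> + \<bar>c p * Re w - a p * Im w\<bar>"
    using cmod_le[of "blk a b c p w"] by (simp add: blk_def)
  moreover have "(2 * \<bar>a p\<bar> + \<bar>b p\<bar> + \<bar>c p\<bar>) * norm w = \<bar>a p\<bar> * norm w + \<bar>a p\<bar> * norm w + \<bar>b p\<bar> * norm w + \<bar>c p\<bar> * norm w"
    by (simp add: algebra_simps)
  ultimately show ?thesis using 1(1)[of "a p"] 1(2)[of "a p"] 1(2)[of "b p"] 1(1)[of "c p"] by linarith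
qed

lemma blk_add: "blk a b c p (w + w') = blk a b c p w + blk a b c p w'"
  and blk_scaleR: "blk a b c p (k *\<^sub>R w) = k *\<^sub>R blk a b c p w"
  by (auto simp: blk_def complex_eq_iff algebra_simps)

lemma has_derivative_blk:
  assumes S: "bounded_linear S" and d: "(a has_derivative a') (at (S x))" "(b has_derivative b') (at (S x))" "(c has_derivative c') (at (S x))"
  shows "((\<lambda>x. blk a b c (S x) w) has_derivative (\<lambda>h. blk a' b' c' (S h) w)) (at x)"
proof -
  have S': "(S has_derivative S) (at x)" using S by (rule bounded_linear_imp_has_derivative)
  note d' = has_derivative_compose[OF S' d(1)] has_derivative_compose[OF S' d(2)] has_derivative_compose[OF S' d(3)]
  have e: "blk a b c (S x) w = (a (S x) * Re w + b (S x) * Im w) *\<^sub>R 1 + (c (S x) * Re w - a (S x) * Im w) *\<^sub>R \<i>" for a b c :: "c2 \<Rightarrow> real" and x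
    by (simp add: blk_def complex_eq_iff)
  show ?thesis unfolding e
    by (intro has_derivative_add has_derivative_scaleR_left has_derivative_diff has_derivative_mult_left d')
qed

definition scl :: "real \<Rightarrow> nat \<Rightarrow> c2 \<Rightarrow> c2" where
  "scl t m x = (t *\<^sub>R fst x, t ^ (2*m) *\<^sub>R snd x)"

lemma scl_bl: "bounded_linear (scl t m)"
  unfolding scl_def[abs_def] by (intro bounded_linear_Pair bounded_linear_const_scaleR bounded_linear_fst bounded_linear_snd)

lemma norm_scl: assumes "0 \<le> t" "t \<le> 1" "m \<ge> 1" shows "norm (scl t m x) \<le> t * (norm (fst x) + norm (snd x))"
proof -
  have "t ^ (2*m) \<le> t ^ 1" using assms by (intro power_decreasing) auto
  then have "t ^ (2*m) * norm (snd x) \<le> t * norm (snd x)" by (intro mult_right_mono) auto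
  moreover have "norm (scl t m x) \<le> t * norm (fst x) + t ^ (2*m) * norm (snd x)"
    using norm_Pair_le[of "t *\<^sub>R fst x" "t ^ (2*m) *\<^sub>R snd x"] assms by (simp add: scl_def)
  ultimately show ?thesis by (simp add: algebra_simps)
qed

lemma norm_le_components: "norm (x :: c2) \<le> norm (fst x) + norm (snd x)"
  using norm_Pair_le[of "fst x" "snd x"] by simp

lemma components_le_norm: "norm (fst (x :: c2)) \<le> norm x" "norm (snd x) \<le> norm x"
  by (metis norm_fst_le prod.collapse, metis norm_snd_le prod.collapse)

definition qnorm :: "nat \<Rightarrow> c2 \<Rightarrow> real" where "qnorm m p = norm (fst p) ^ (4*m) + norm (snd p) ^ 2"

text \<open>The dilated disc satisfies \<open>scaled_disc\<close> with parameters that no longer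
  involve \<open>t\<close>; undoing the dilation multiplies the two components of the bound by
  \<open>t\<close> and \<open>t ^ (2*m)\<close>.\<close>

lemma anisotropic_gradient_bound:
  fixes J :: "c2 \<Rightarrow> c2 \<Rightarrow> c2" and \<rho> :: "c2 \<Rightarrow> real" and D W :: "c2 set"
    and a1 b1 c1 a2 b2 c2 :: "c2 \<Rightarrow> real" and r :: real and m :: nat and h :: "nat \<Rightarrow> real"
  assumes acs: "almost_complex_structure J"
    and r_pos: "r > 0"
    and coeffs_smooth: "smooth_on (ball 0 r) a1" "smooth_on (ball 0 r) b1" "smooth_on (ball 0 r) c1"
        "smooth_on (ball 0 r) a2" "smooth_on (ball 0 r) b2" "smooth_on (ball 0 r) c2"
    and J_block: "\<forall>p\<in>ball 0 r. \<forall>v1 v2. J p (v1, v2) = (blk a1 b1 c1 p v1, blk a2 b2 c2 p v2)"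
    and J_st: "\<exists>C. \<forall>p\<in>ball 0 r.
        \<bar>a1 p\<bar> + \<bar>b1 p + 1\<bar> + \<bar>c1 p - 1\<bar> + \<bar>a2 p\<bar> + \<bar>b2 p + 1\<bar> + \<bar>c2 p - 1\<bar> \<le> C * norm (snd p)"
    and D: "\<And>p. p \<in> D \<Longrightarrow> \<rho> p < 0"
    and m: "m \<ge> 1"
    and subh: "\<forall>z. laplacian (hpoly h (2*m)) z \<ge> 0"
    and not_harm: "\<exists>z. laplacian (hpoly h (2*m)) z \<noteq> 0"
    and expansion: "\<exists>C s. s > 0 \<and> (\<forall>p\<in>ball 0 s.
        \<bar>\<rho> p - (Re (snd p) + hpoly h (2*m) (fst p))\<bar>
          \<le> C * (norm (fst p) ^ (2*m+1) + norm (snd p) * norm (fst p) ^ m + norm (snd p) ^ 2))"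
  obtains t0 K where "t0 > 0" "K \<ge> 0"
    "\<And>u t. J_hol_disc J u \<Longrightarrow> u ` ball 0 1 \<subseteq> D \<Longrightarrow> 0 < t \<Longrightarrow> t \<le> t0 \<Longrightarrow>
       norm (fst (u 0)) \<le> t \<Longrightarrow> norm (snd (u 0)) \<le> t ^ (2*m) \<Longrightarrow>
       norm (fst (frechet_derivative u (at 0) 1)) \<le> K * t \<and> norm (snd (frechet_derivative u (at 0) 1)) \<le> K * t ^ (2*m)"
proof -
  define H where "H = hpoly h (2*m)"
  obtain CH where CH: "CH \<ge> 0" "\<And>z. \<bar>H z\<bar> \<le> CH * norm z ^ (2*m)" using hpoly_bound[of h "2*m"] unfolding H_def by blast
  obtain \<epsilon> W D1 D2 CW where bump: "bump (2*m) H \<epsilon> W D1 D2 CW" using bump_exists[OF m subh not_harm] unfolding H_def by blast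
  obtain R1 lam \<kappa> M where R1: "R1 \<ge> 8" and lam: "0 \<le> lam" and \<kappa>: "\<kappa> > 0"
    and bar: "\<And>x. norm (fst x) \<le> 3 \<Longrightarrow> norm (snd x) \<le> 3 \<Longrightarrow> phi W lam \<kappa> x > - M"
    "\<And>x. norm (fst x) \<le> R1 \<Longrightarrow> norm (snd x) \<le> R1 ^ (2*m) \<Longrightarrow> Re (snd x) + H (fst x) \<le> 1/4 \<Longrightarrow> phi W lam \<kappa> x \<le> 2"
    "\<And>x. norm (fst x) \<le> R1 \<Longrightarrow> norm (snd x) \<le> R1 ^ (2*m) \<Longrightarrow> Re (snd x) + H (fst x) \<le> 1/4 \<Longrightarrow>
        R1 / 2 \<le> norm (fst x) \<or> R1 ^ (2*m) / 2 \<le> norm (snd x) \<Longrightarrow> phi W lam \<kappa> x < - M"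
    using phi_barrier[OF m bump CH] by metis
  define R where "R = R1 ^ (2*m)"
  have Rg: "R \<ge> 1" unfolding R_def using R1 by (intro one_le_power) auto
  have R1g: "R1 \<ge> 1" using R1 by simp
  obtain e0 where e0: "e0 > 0" "\<And>e x X Y \<Lambda>. 0 \<le> e \<Longrightarrow> e \<le> e0 \<Longrightarrow> norm (fst x) \<le> R1 \<Longrightarrow> norm (snd x) \<le> R \<Longrightarrow>
     norm (Y - imul X) \<le> e * norm X \<Longrightarrow> norm \<Lambda> \<le> 16 * e * (norm X)\<^sup>2 \<Longrightarrow>
     D2phi D2 lam \<kappa> x X X + D2phi D2 lam \<kappa> x Y Y + Dphi D1 lam \<kappa> x \<Lambda> \<ge> \<kappa> * (norm X)\<^sup>2"
    using lap_phi_lower[OF bump lam \<kappa> R1g Rg] by blast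
  \<comment> \<open>The first entry serves the estimate for \<open>cutlog\<close>, the second the
    strict positivity of \<open>phi\<close>.\<close>
  define e where "e = min (1/40000) e0"
  have e: "0 < e" "e \<le> 1/40000" "e \<le> e0" using e0(1) unfolding e_def min_le_iff_disj by simp_all
  obtain CJ where CJ: "\<And>p. p \<in> ball 0 r \<Longrightarrow>
     \<bar>a1 p\<bar> + \<bar>b1 p + 1\<bar> + \<bar>c1 p - 1\<bar> + \<bar>a2 p\<bar> + \<bar>b2 p + 1\<bar> + \<bar>c2 p - 1\<bar> \<le> CJ * norm (snd p)"
    using J_st by blast
  obtain CE s where s: "s > 0" and CE: "\<And>p. p \<in> ball 0 s \<Longrightarrow> \<bar>\<rho> p - (Re (snd p) + H (fst p))\<bar>
          \<le> CE * (norm (fst p) ^ (2*m+1) + norm (snd p) * norm (fst p) ^ m + norm (snd p) ^ 2)"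
    using expansion unfolding H_def by blast
  have r2: "r / 2 < r" using r_pos by simp
  define kf where "kf = (\<lambda>f :: c2 \<Rightarrow> real. SOME k. k \<ge> 0 \<and> (\<forall>x\<in>cball 0 (r/2). \<forall>h. \<bar>frechet_derivative f (at x) h\<bar> \<le> k * norm h))"
  have sm: "kf f \<ge> 0 \<and> (\<forall>x\<in>cball 0 (r/2). \<forall>h. \<bar>frechet_derivative f (at x) h\<bar> \<le> kf f * norm h)"
    if f: "smooth_on (ball 0 r) f" for f :: "c2 \<Rightarrow> real"
    unfolding kf_def by (rule someI_ex) (rule smooth_on_imp_bounded_derivative[OF f r2])
  have kf: "kf f \<ge> 0" if "smooth_on (ball 0 r) f" for f using sm[OF that] by blast
  have derb: "\<bar>frechet_derivative f (at x) h\<bar> \<le> kf f * norm h" if "smooth_on (ball 0 r) f" "x \<in> cball 0 (r/2)" for f x h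
    using sm[OF that(1)] that(2) by blast
  define kk where "kk = 2 * (kf a1 + kf b1 + kf c1 + kf a2 + kf b2 + kf c2)"
  note kf0 = kf[OF coeffs_smooth(1)] kf[OF coeffs_smooth(2)] kf[OF coeffs_smooth(3)]
    kf[OF coeffs_smooth(4)] kf[OF coeffs_smooth(5)] kf[OF coeffs_smooth(6)]
  have kk: "kk \<ge> 0" "2 * (kf a1 + kf b1 + kf c1) \<le> kk" "2 * (kf a2 + kf b2 + kf c2) \<le> kk"
    unfolding kk_def using kf0 by simp_all
  \<comment> \<open>Every smallness condition on \<open>t\<close> reads \<open>t * x <= y\<close>.
    The reciprocal of the sum of all quotients \<open>x / y\<close> meets them at once; the final 1
    yields \<open>t <= 1\<close>.\<close>
  define G where "G = (R1 + R) / (r / 2) + (R1 + R) / (s / 2) + 4 * \<bar>CJ\<bar> * R / e + 4 * kk / e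
     + \<bar>CE\<bar> * (R1 ^ (2*m+1) + R * R1 ^ m + R ^ 2) / e + 1"
  have Gt: "(R1 + R) / (r / 2) \<ge> 0" "(R1 + R) / (s / 2) \<ge> 0" "4 * \<bar>CJ\<bar> * R / e \<ge> 0" "4 * kk / e \<ge> 0"
     "\<bar>CE\<bar> * (R1 ^ (2*m+1) + R * R1 ^ m + R ^ 2) / e \<ge> 0"
    using R1g Rg r_pos s e kk by (auto intro!: divide_nonneg_pos mult_nonneg_nonneg add_nonneg_nonneg)
  define t0 where "t0 = 1 / G"
  have G1: "G \<ge> 1" using Gt unfolding G_def by linarith
  have t0: "t0 > 0" using G1 by (simp add: t0_def)
  \<comment> \<open>Outside the locale this constant depends on \<open>\<kappa>\<close> and
    \<open>M\<close> alone, so it is uniform in the disc and in \<open>t\<close>.\<close>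
  define K where "K = 2 * scaled_disc.K2 \<kappa> M"
  show thesis
  proof (rule that[of t0 "max K 0"])
    fix u t assume u: "J_hol_disc J u" "u ` ball 0 1 \<subseteq> D" and t: "0 < t" "t \<le> t0"
      and u0: "norm (fst (u 0)) \<le> t" "norm (snd (u 0)) \<le> t ^ (2*m)"
    have tG: "t * G \<le> 1" using t(2) G1 by (simp add: t0_def pos_le_divide_eq)
    have use: "t * x \<le> y" if "x / y \<le> G" "y > 0" for x y
    proof -
      have "t * (x / y) \<le> t * G" using that t by (intro mult_left_mono) auto
      then have "t * (x / y) \<le> 1" using tG by linarith
      then show ?thesis using that(2) by (simp add: pos_divide_le_eq)
    qed
    have t1: "t \<le> 1" using use[of 1 1] G1 by simp
    have tr: "t * (R1 + R) \<le> r / 2" using r_pos Gt by (intro use) (auto simp: G_def)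
    have ts: "t * (R1 + R) \<le> s / 2" using s Gt by (intro use) (auto simp: G_def)
    have tJ: "t * (4 * \<bar>CJ\<bar> * R) \<le> e" using e Gt by (intro use) (auto simp: G_def)
    have tk: "t * (4 * kk) \<le> e" using e Gt by (intro use) (auto simp: G_def)
    have tE: "t * (\<bar>CE\<bar> * (R1 ^ (2*m+1) + R * R1 ^ m + R ^ 2)) \<le> e" using e Gt by (intro use) (auto simp: G_def)
    define U where "U = {x :: c2. norm (fst x) < R1 \<and> norm (snd x) < R1 ^ (2*m)}"
    define S where "S = scl t m"
    have Sbl: "bounded_linear S" unfolding S_def by (rule scl_bl)
    have tp: "t ^ (2*m) > 0" using t by simp
    have nS: "norm (S x) \<le> t * (norm (fst x) + norm (snd x))" for x
      unfolding S_def using norm_scl t(1) t1 m by simp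
    have SU: "norm (S x) \<le> r / 2" "norm (S x) \<le> s / 2" if "x \<in> U" for x
    proof -
      have "norm (fst x) + norm (snd x) \<le> R1 + R" using that by (simp add: U_def R_def)
      then have "t * (norm (fst x) + norm (snd x)) \<le> t * (R1 + R)" using t by (intro mult_left_mono) auto
      then show "norm (S x) \<le> r / 2" "norm (S x) \<le> s / 2" using nS[of x] tr ts by linarith+
    qed
    have Sr: "S x \<in> ball 0 r" "S x \<in> cball 0 (r/2)" "S x \<in> ball 0 s" if "x \<in> U" for x
      using SU[OF that] r_pos s by auto
    have S2: "norm (S h) \<le> 2 * t * norm h" for h
    proof -
      have "t * (norm (fst h) + norm (snd h)) \<le> t * (norm h + norm h)"
        using components_le_norm[of h] t by (intro mult_left_mono add_mono) auto
      then show ?thesis using nS[of h] by simp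
    qed
    define T where "T = (\<lambda>w :: c2. ((1 / t) *\<^sub>R fst w, (1 / t ^ (2*m)) *\<^sub>R snd w))"
    have Tbl: "bounded_linear T" unfolding T_def
      by (intro bounded_linear_Pair bounded_linear_const_scaleR bounded_linear_fst bounded_linear_snd)
    have ST: "S (T w) = w" for w using t by (simp add: S_def scl_def T_def)
    \<comment> \<open>This is \<open>J (S x)\<close> conjugated by \<open>S\<close>: within each
      block the dilation factors cancel.\<close>
    define A where "A = (\<lambda>x w. (blk a1 b1 c1 (S x) (fst w), blk a2 b2 c2 (S x) (snd w)))"
    define A' where "A' = (\<lambda>x h w. (blk (frechet_derivative a1 (at (S x))) (frechet_derivative b1 (at (S x))) (frechet_derivative c1 (at (S x))) (S h) (fst w),
       blk (frechet_derivative a2 (at (S x))) (frechet_derivative b2 (at (S x))) (frechet_derivative c2 (at (S x))) (S h) (snd w)))"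
    have Ck1: "u differentiable_on ball 0 1" "\<And>i. i \<in> Basis \<Longrightarrow> continuous_on (ball 0 1) (\<lambda>x. frechet_derivative u (at x) i)"
      and uJ: "\<And>z. z \<in> ball 0 1 \<Longrightarrow> frechet_derivative u (at z) \<i> = J (u z) (frechet_derivative u (at z) 1)"
      using u(1) unfolding J_hol_disc_def by (auto simp: numeral_eq_Suc)
    have ud: "(u has_derivative frechet_derivative u (at z)) (at z)" if "z \<in> ball 0 1" for z
      using Ck1(1) that by (simp add: differentiable_on_eq_differentiable_at frechet_derivative_works)
    define v where "v = (\<lambda>z. T (u z))"
    define vx where "vx = (\<lambda>z. T (frechet_derivative u (at z) 1))"
    define vy where "vy = (\<lambda>z. T (frechet_derivative u (at z) \<i>))"
    have Sv: "S (v z) = u z" for z by (simp add: v_def ST)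
    have dd: "scaled_disc m H W D1 D2 \<epsilon> CW R1 lam \<kappa> M e A A' v vx vy"
      unfolding scaled_disc_def U_def[symmetric]
    proof (intro conjI allI impI)
      show "m \<ge> 1" "bump (2*m) H \<epsilon> W D1 D2 CW" "R1 \<ge> 8" "\<kappa> > 0" by fact+
      show "0 \<le> e" "e \<le> 1/40000" using e by auto
      show "\<And>x. norm (fst x) \<le> 3 \<Longrightarrow> norm (snd x) \<le> 3 \<Longrightarrow> phi W lam \<kappa> x > - M" by fact
    next
      fix x assume x: "x \<in> U" and d: "Re (snd x) + H (fst x) \<le> e"
      show "phi W lam \<kappa> x \<le> 2" using bar(2)[of x] x d e by (simp add: U_def)
      assume "R1 / 2 \<le> norm (fst x) \<or> R1 ^ (2*m) / 2 \<le> norm (snd x)"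
      then show "phi W lam \<kappa> x < - M" using bar(3)[of x] x d e by (simp add: U_def)
    next
      fix x X Y \<Lambda> :: c2 assume "x \<in> U" "norm (Y - imul X) \<le> e * norm X" "norm \<Lambda> \<le> 16 * e * (norm X)\<^sup>2"
      then show "D2phi D2 lam \<kappa> x X X + D2phi D2 lam \<kappa> x Y Y + Dphi D1 lam \<kappa> x \<Lambda> \<ge> \<kappa> * (norm X)\<^sup>2"
        using e by (intro e0(2)[of e]) (auto simp: U_def R_def)
    next
      fix z :: complex assume z: "z \<in> ball 0 1"
      have "(v has_derivative (\<lambda>h. T (frechet_derivative u (at z) h))) (at z)"
        unfolding v_def by (rule bounded_linear.has_derivative[OF Tbl ud[OF z]])
      moreover have "(\<lambda>h. T (frechet_derivative u (at z) h)) = grad (vx z) (vy z)"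
      proof
        fix h
        have l: "linear (\<lambda>h. T (frechet_derivative u (at z) h))"
          using calculation has_derivative_linear by blast
        have "h = Re h *\<^sub>R 1 + Im h *\<^sub>R \<i>" by (simp add: complex_eq_iff)
        then have "T (frechet_derivative u (at z) h) = T (frechet_derivative u (at z) (Re h *\<^sub>R 1 + Im h *\<^sub>R \<i>))" by simp
        also have "\<dots> = grad (vx z) (vy z) h"
          unfolding linear_add[OF l] linear_cmul[OF l] by (simp add: grad_def vx_def vy_def)
        finally show "T (frechet_derivative u (at z) h) = grad (vx z) (vy z) h" .
      qed
      ultimately show "(v has_derivative grad (vx z) (vy z)) (at z)" by simp
    next
      show "continuous_on (ball 0 1) vx" unfolding vx_def
        by (rule bounded_linear.continuous_on[OF Tbl]) (rule Ck1(2), simp add: Basis_complex_def)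
      show "continuous_on (ball 0 1) vy" unfolding vy_def
        by (rule bounded_linear.continuous_on[OF Tbl]) (rule Ck1(2), simp add: Basis_complex_def)
    next
      fix z :: complex assume z: "z \<in> ball 0 1" and U: "v z \<in> U"
      have uz: "u z \<in> ball 0 r" "u z \<in> ball 0 s" using Sr[OF U] by (auto simp: Sv)
      define w where "w = frechet_derivative u (at z) 1"
      have "J (u z) (fst w, snd w) = (blk a1 b1 c1 (u z) (fst w), blk a2 b2 c2 (u z) (snd w))" using J_block uz by blast
      then have "frechet_derivative u (at z) \<i> = (blk a1 b1 c1 (u z) (fst w), blk a2 b2 c2 (u z) (snd w))"
        using uJ[OF z] by (simp add: w_def)
      then show "vy z = A (v z) (vx z)"
        unfolding vy_def vx_def A_def Sv w_def[symmetric] by (simp add: T_def blk_scaleR)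
      define x where "x = v z"
      have x: "norm (fst x) \<le> R1" "norm (snd x) \<le> R" using U by (auto simp: x_def U_def R_def)
      have ux: "fst (u z) = t *\<^sub>R fst x" "snd (u z) = t ^ (2*m) *\<^sub>R snd x"
        unfolding Sv[of z, symmetric] x_def by (simp_all add: S_def scl_def)
      have "u z \<in> D" using u(2) z by auto
      then have "\<rho> (u z) < 0" by (rule D)
      then have "Re (snd (u z)) + H (fst (u z)) \<le> CE * (norm (fst (u z)) ^ (2*m+1) + norm (snd (u z)) * norm (fst (u z)) ^ m + norm (snd (u z)) ^ 2)"
        using CE[OF uz(2)] by linarith
      also have "\<dots> \<le> \<bar>CE\<bar> * (norm (fst (u z)) ^ (2*m+1) + norm (snd (u z)) * norm (fst (u z)) ^ m + norm (snd (u z)) ^ 2)"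
        by (intro mult_right_mono) auto
      \<comment> \<open>The three error terms scale with the powers \<open>2*m + 1\<close>,
        \<open>3*m\<close> and \<open>4*m\<close> of \<open>t\<close>, none below
        \<open>2*m + 1\<close> since \<open>m >= 1\<close>. After division by
        \<open>t ^ (2*m)\<close> one factor \<open>t\<close> is left.\<close>
      also have "\<dots> \<le> \<bar>CE\<bar> * (t ^ (2*m+1) * (R1 ^ (2*m+1) + R * R1 ^ m + R ^ 2))"
      proof (intro mult_left_mono)
        have 1: "norm (fst (u z)) ^ (2*m+1) \<le> t ^ (2*m+1) * R1 ^ (2*m+1)"
          unfolding ux using x t by (simp add: power_mult_distrib mult_left_mono power_mono mult_mono del: power_Suc)
        have 2: "norm (snd (u z)) * norm (fst (u z)) ^ m \<le> t ^ (2*m+1) * (R * R1 ^ m)"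
        proof -
          have "norm (snd (u z)) * norm (fst (u z)) ^ m = (t ^ (2*m) * t ^ m) * (norm (snd x) * norm (fst x) ^ m)"
            unfolding ux using t by (simp add: power_mult_distrib)
          also have "\<dots> \<le> (t ^ (2*m) * t ^ 1) * (R * R1 ^ m)"
            using t t1 m x Rg R1g by (intro mult_mono mult_left_mono power_decreasing power_mono) auto
          finally show ?thesis by (simp add: ac_simps)
        qed
        have 3: "norm (snd (u z)) ^ 2 \<le> t ^ (2*m+1) * R ^ 2"
        proof -
          have "norm (snd (u z)) ^ 2 = (t ^ (2*m) * t ^ (2*m)) * norm (snd x) ^ 2"
            unfolding ux using t by (simp add: power_mult_distrib power2_eq_square)
          also have "\<dots> \<le> (t ^ (2*m) * t ^ 1) * R ^ 2"
            using t t1 m x Rg R1g by (intro mult_mono mult_left_mono power_decreasing power_mono) auto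
          finally show ?thesis by (simp add: ac_simps)
        qed
        show "norm (fst (u z)) ^ (2*m+1) + norm (snd (u z)) * norm (fst (u z)) ^ m + norm (snd (u z)) ^ 2
          \<le> t ^ (2*m+1) * (R1 ^ (2*m+1) + R * R1 ^ m + R ^ 2)"
          unfolding distrib_left using 1 2 3 by linarith
      qed simp
      also have "\<dots> = t ^ (2*m) * (t * (\<bar>CE\<bar> * (R1 ^ (2*m+1) + R * R1 ^ m + R ^ 2)))" by simp
      also have "\<dots> \<le> t ^ (2*m) * e" using tE tp by (intro mult_left_mono) auto
      finally have fin: "Re (snd (u z)) + H (fst (u z)) \<le> t ^ (2*m) * e" .
      have "H (fst (u z)) = t ^ (2*m) * H (fst x)"
        unfolding ux H_def scaleR_conv_of_real by (rule hpoly_homogeneous)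
      then have "t ^ (2*m) * (Re (snd x) + H (fst x)) \<le> t ^ (2*m) * e" using fin by (simp add: ux distrib_left)
      then show "Re (snd (v z)) + H (fst (v z)) \<le> e" using tp by (simp add: x_def)
    next
      show "norm (fst (v 0)) \<le> 1" "norm (snd (v 0)) \<le> 1" using u0 t tp by (auto simp: v_def T_def)
    next
      fix x w h :: c2 assume x: "x \<in> U"
      show "linear (A x)" by (rule linearI) (simp_all add: A_def blk_add blk_scaleR)
      have Jx: "J (S x) (y1, y2) = (blk a1 b1 c1 (S x) y1, blk a2 b2 c2 (S x) y2)" for y1 y2 using J_block Sr[OF x] by blast
      have "J (S x) (J (S x) (fst w, snd w)) = - (fst w, snd w)" using acs unfolding almost_complex_structure_def by blast
      then show "A x (A x w) = - w" unfolding Jx A_def by (simp add: prod_eq_iff)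
      have sn: "norm (snd (S x)) \<le> t * R"
      proof -
        have "t ^ (2*m) \<le> t ^ 1" using t t1 m by (intro power_decreasing) auto
        then have "t ^ (2*m) * norm (snd x) \<le> t * R" using x t by (intro mult_mono) (auto simp: U_def R_def)
        then show ?thesis using t by (simp add: S_def scl_def)
      qed
      have "CJ * norm (snd (S x)) \<le> \<bar>CJ\<bar> * (t * R)" using sn by (intro mult_mono) auto
      then have cj: "\<bar>a1 (S x)\<bar> + \<bar>b1 (S x) + 1\<bar> + \<bar>c1 (S x) - 1\<bar> + \<bar>a2 (S x)\<bar> + \<bar>b2 (S x) + 1\<bar> + \<bar>c2 (S x) - 1\<bar> \<le> \<bar>CJ\<bar> * (t * R)"
        using CJ[OF Sr(1)[OF x]] by linarith
      have ar: "2 * x1 + x2 + x3 \<le> 2 * X" "2 * x4 + x5 + x6 \<le> 2 * X"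
        if "x1 + x2 + x3 + x4 + x5 + x6 \<le> X" "0 \<le> x1" "0 \<le> x2" "0 \<le> x3" "0 \<le> x4" "0 \<le> x5" "0 \<le> x6"
        for x1 x2 x3 x4 x5 x6 X :: real using that by linarith+
      note cj' = ar[OF cj abs_ge_zero abs_ge_zero abs_ge_zero abs_ge_zero abs_ge_zero abs_ge_zero]
      \<comment> \<open>The standard structure has \<open>b = - 1\<close> and \<open>c = 1\<close>,
        so the deviation is again a block, with coefficients controlled by
        \<open>CJ\<close>.\<close>
      have bi: "blk a b c y k - \<i> * k = blk a (\<lambda>y. b y + 1) (\<lambda>y. c y - 1) y k" for a b c y k
        by (simp add: blk_def complex_eq_iff algebra_simps)
      have "norm (A x w - imul w) \<le> norm (fst (A x w - imul w)) + norm (snd (A x w - imul w))" by (rule norm_le_components)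
      also have "\<dots> \<le> (2 * (\<bar>CJ\<bar> * (t * R))) * norm (fst w) + (2 * (\<bar>CJ\<bar> * (t * R))) * norm (snd w)"
        unfolding A_def imul_def fst_diff snd_diff fst_conv snd_conv bi
        by (intro add_mono order_trans[OF norm_blk] mult_right_mono cj' norm_ge_zero)
      also have "\<dots> \<le> (2 * (\<bar>CJ\<bar> * (t * R))) * norm w + (2 * (\<bar>CJ\<bar> * (t * R))) * norm w"
        using components_le_norm[of w] t Rg by (intro add_mono mult_left_mono) auto
      also have "\<dots> = (t * (4 * \<bar>CJ\<bar> * R)) * norm w" by simp
      also have "\<dots> \<le> e * norm w" using tJ by (intro mult_right_mono) auto
      finally show "norm (A x w - imul w) \<le> e * norm w" .
      show "((\<lambda>x. A x w) has_derivative (\<lambda>h. A' x h w)) (at x)"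
        unfolding A_def A'_def
        by (intro has_derivative_Pair has_derivative_blk[OF Sbl] smooth_on_imp_has_derivative[where r = r] coeffs_smooth Sr[OF x])
      have bb: "norm (blk (frechet_derivative a (at (S x))) (frechet_derivative b (at (S x))) (frechet_derivative c (at (S x))) (S h) y) \<le> kk * norm (S h) * norm y"
        if sm: "smooth_on (ball 0 r) a" "smooth_on (ball 0 r) b" "smooth_on (ball 0 r) c" and k: "2 * (kf a + kf b + kf c) \<le> kk" for a b c y
      proof (rule order_trans[OF norm_blk], intro mult_right_mono norm_ge_zero)
        note d = derb[OF _ Sr(2)[OF x], of _ "S h"]
        have "2 * (kf a * norm (S h)) + 2 * (kf b * norm (S h)) + 2 * (kf c * norm (S h)) \<le> kk * norm (S h)"
          using mult_right_mono[OF k norm_ge_zero[of "S h"]] by (simp add: algebra_simps)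
        moreover have "0 \<le> kf b * norm (S h)" "0 \<le> kf c * norm (S h)" using kf sm by simp_all
        ultimately show "2 * \<bar>frechet_derivative a (at (S x)) (S h)\<bar> + \<bar>frechet_derivative b (at (S x)) (S h)\<bar> + \<bar>frechet_derivative c (at (S x)) (S h)\<bar> \<le> kk * norm (S h)"
          using d[OF sm(1)] d[OF sm(2)] d[OF sm(3)] by linarith
      qed
      have "norm (A' x h w) \<le> norm (fst (A' x h w)) + norm (snd (A' x h w))" by (rule norm_le_components)
      also have "\<dots> \<le> kk * norm (S h) * norm (fst w) + kk * norm (S h) * norm (snd w)"
        unfolding A'_def fst_conv snd_conv by (intro add_mono bb coeffs_smooth kk)
      also have "\<dots> \<le> kk * norm (S h) * norm w + kk * norm (S h) * norm w"
        using components_le_norm[of w] kk by (intro add_mono mult_left_mono) auto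
      also have "\<dots> = (2 * kk * norm w) * norm (S h)" by simp
      also have "\<dots> \<le> (2 * kk * norm w) * (2 * t * norm h)" using S2 kk by (intro mult_left_mono) auto
      also have "\<dots> = (t * (4 * kk)) * (norm h * norm w)" by simp
      also have "\<dots> \<le> e * (norm h * norm w)" using tk by (intro mult_right_mono) auto
      finally show "norm (A' x h w) \<le> e * norm h * norm w" by (simp add: mult.assoc)
    qed
    have g: "norm (vx 0) \<le> max K 0" using scaled_disc.gradient_bound[OF dd] unfolding K_def by simp
    define w where "w = frechet_derivative u (at 0) 1"
    have "norm (fst (vx 0)) \<le> max K 0" "norm (snd (vx 0)) \<le> max K 0"
      using components_le_norm[of "vx 0"] g by linarith+
    then have "norm (fst w) / t \<le> max K 0" "norm (snd w) / t ^ (2*m) \<le> max K 0"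
      using t by (simp_all add: vx_def T_def w_def)
    then show "norm (fst (frechet_derivative u (at 0) 1)) \<le> max K 0 * t \<and> norm (snd (frechet_derivative u (at 0) 1)) \<le> max K 0 * t ^ (2*m)"
      using t tp by (simp add: w_def pos_divide_le_eq)
  qed (use t0 in auto)
qed

subsection \<open>Kobayashi distance\<close>

definition dqnorm :: "nat \<Rightarrow> c2 \<Rightarrow> c2 \<Rightarrow> real" where
  "dqnorm m p w = real (2*m) * (fst p \<bullet> fst p) ^ (2*m - 1) * (2 * (fst p \<bullet> fst w)) + 2 * (snd p \<bullet> snd w)"

lemma qnorm_inner: "qnorm m p = (fst p \<bullet> fst p) ^ (2*m) + snd p \<bullet> snd p"
proof -
  have "norm (fst p) ^ (4*m) = (norm (fst p) ^ 2) ^ (2*m)" by (simp flip: power_mult)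
  then show ?thesis by (simp add: qnorm_def power2_norm_eq_inner)
qed

lemma qnorm_has_derivative: "(qnorm m has_derivative dqnorm m p) (at p)"
proof -
  have f: "((\<lambda>p. fst p) has_derivative (\<lambda>h. fst h)) (at p)" "((\<lambda>p. snd p) has_derivative (\<lambda>h. snd h)) (at p)" for p :: c2
    by (auto intro!: derivative_eq_intros)
  have 1: "((\<lambda>p::c2. fst p \<bullet> fst p) has_derivative (\<lambda>h. 2 * (fst p \<bullet> fst h))) (at p)"
    by (rule has_derivative_eq_rhs[OF has_derivative_inner[OF f(1) f(1)]]) (auto simp: inner_commute)
  have 2: "((\<lambda>p::c2. snd p \<bullet> snd p) has_derivative (\<lambda>h. 2 * (snd p \<bullet> snd h))) (at p)"
    by (rule has_derivative_eq_rhs[OF has_derivative_inner[OF f(2) f(2)]]) (auto simp: inner_commute)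
  have "((\<lambda>p::c2. (fst p \<bullet> fst p) ^ (2*m) + snd p \<bullet> snd p) has_derivative dqnorm m p) (at p)"
    by (rule has_derivative_eq_rhs[OF has_derivative_add[OF has_derivative_power[OF 1] 2]])
      (auto simp: dqnorm_def algebra_simps)
  moreover have "(\<lambda>p::c2. (fst p \<bullet> fst p) ^ (2*m) + snd p \<bullet> snd p) = qnorm m" by (auto simp: qnorm_inner)
  ultimately show ?thesis by simp
qed

lemma dqnorm_scaleR: "dqnorm m p (k *\<^sub>R w) = k * dqnorm m p w"
  by (simp add: dqnorm_def algebra_simps)

lemma qnorm_pos: assumes "m \<ge> 1" "p \<noteq> 0" shows "qnorm m p > 0"
proof (cases "snd p = 0")
  case True
  then have "fst p \<noteq> 0" using assms by (simp add: prod_eq_iff)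
  then show ?thesis unfolding qnorm_def by (simp add: add_pos_nonneg)
next
  case False
  then show ?thesis unfolding qnorm_def by (simp add: add_nonneg_pos)
qed

text \<open>A direction with components of size \<open>t\<close> and \<open>t ^ (2*m)\<close>
  changes \<open>qnorm\<close> by at most a multiple of \<open>t ^ (4*m)\<close>; \<open>4*m\<close>
  and 2 are the degrees of its two terms.\<close>

lemma dqnorm_bound:
  assumes m: "m \<ge> 1" and t: "t > 0" "t ^ (4*m) = qnorm m p" and K: "K \<ge> 0" and w: "norm (fst w) \<le> K * t" "norm (snd w) \<le> K * t ^ (2*m)"
    and p: "norm (fst p) \<le> t" "norm (snd p) \<le> t ^ (2*m)"
  shows "\<bar>dqnorm m p w\<bar> \<le> (4 * real m + 2) * K * qnorm m p"
proof -
  have e1: "4*m = (4*m - 2) + 1 + 1" using m by simp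
  have pw: "(fst p \<bullet> fst p) ^ (2*m - 1) = norm (fst p) ^ (4*m - 2)"
  proof -
    have "norm (fst p) ^ (4*m - 2) = (norm (fst p) ^ 2) ^ (2*m - 1)" by (simp flip: power_mult add: right_diff_distrib')
    then show ?thesis by (simp add: power2_norm_eq_inner)
  qed
  have "\<bar>(fst p \<bullet> fst p) ^ (2*m - 1) * (fst p \<bullet> fst w)\<bar> \<le> t ^ (4*m - 2) * (t * (K * t))"
    unfolding abs_mult pw
  proof (intro mult_mono)
    show "\<bar>norm (fst p) ^ (4*m - 2)\<bar> \<le> t ^ (4*m - 2)" using p by (simp add: power_mono)
    have "\<bar>fst p \<bullet> fst w\<bar> \<le> norm (fst p) * norm (fst w)" by (rule Cauchy_Schwarz_ineq2)
    also have "\<dots> \<le> t * (K * t)" using p w t by (intro mult_mono) auto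
    finally show "\<bar>fst p \<bullet> fst w\<bar> \<le> t * (K * t)" .
  qed (use t in auto)
  also have "\<dots> = K * t ^ (4*m)" by (subst e1, simp only: power_add power_one_right) (simp add: ac_simps)
  finally have 1: "\<bar>(fst p \<bullet> fst p) ^ (2*m - 1) * (fst p \<bullet> fst w)\<bar> \<le> K * qnorm m p" unfolding t(2) .
  have "\<bar>snd p \<bullet> snd w\<bar> \<le> norm (snd p) * norm (snd w)" by (rule Cauchy_Schwarz_ineq2)
  also have "\<dots> \<le> t ^ (2*m) * (K * t ^ (2*m))" using p w t by (intro mult_mono) auto
  also have "\<dots> = K * t ^ (2*m + 2*m)" unfolding power_add by simp
  also have "\<dots> = K * qnorm m p" unfolding t(2)[symmetric] by simp
  finally have 2: "\<bar>snd p \<bullet> snd w\<bar> \<le> K * qnorm m p" .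
  have "dqnorm m p w = 4 * real m * ((fst p \<bullet> fst p) ^ (2*m - 1) * (fst p \<bullet> fst w)) + 2 * (snd p \<bullet> snd w)"
    by (simp add: dqnorm_def)
  also have "\<bar>\<dots>\<bar> \<le> \<bar>4 * real m * ((fst p \<bullet> fst p) ^ (2*m - 1) * (fst p \<bullet> fst w))\<bar> + \<bar>2 * (snd p \<bullet> snd w)\<bar>" by (rule abs_triangle_ineq)
  also have "\<dots> \<le> 4 * real m * (K * qnorm m p) + 2 * (K * qnorm m p)"
  proof (rule add_mono)
    show "\<bar>4 * real m * ((fst p \<bullet> fst p) ^ (2*m - 1) * (fst p \<bullet> fst w))\<bar> \<le> 4 * real m * (K * qnorm m p)"
      unfolding abs_mult[of "4 * real m"] using 1 by (intro mult_mono) auto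
  qed (use 2 in \<open>simp add: abs_mult\<close>)
  also have "\<dots> = (4 * real m + 2) * K * qnorm m p" by (simp add: algebra_simps)
  finally show ?thesis .
qed

text \<open>The infinitesimal form of the Lipschitz bound for \<open>ln qnorm\<close>. The summand 1
  keeps \<open>K'\<close> positive when \<open>K = 0\<close>.\<close>

lemma kob_metric_lower_bound:
  assumes m: "m \<ge> 1" and t0: "t0 > 0" and K: "K \<ge> 0"
    and grad: "\<And>u t. J_hol_disc J u \<Longrightarrow> u ` ball 0 1 \<subseteq> D \<Longrightarrow> 0 < t \<Longrightarrow> t \<le> t0 \<Longrightarrow>
       norm (fst (u 0)) \<le> t \<Longrightarrow> norm (snd (u 0)) \<le> t ^ (2*m) \<Longrightarrow>
       norm (fst (frechet_derivative u (at 0) 1)) \<le> K * t \<and> norm (snd (frechet_derivative u (at 0) 1)) \<le> K * t ^ (2*m)"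
    and p: "p \<noteq> 0" "qnorm m p \<le> t0 ^ (4*m)" and K': "K' = (4 * real m + 2) * K + 1"
  shows "kob_metric J D p v \<ge> ennreal (\<bar>dqnorm m p v\<bar> / (K' * qnorm m p))"
  unfolding kob_metric_def
proof (rule INF_greatest)
  fix r assume "r \<in> {r. 0 < r \<and> (\<exists>u. J_hol_disc J u \<and> u ` ball 0 1 \<subseteq> D \<and> u 0 = p \<and> frechet_derivative u (at 0) 1 = r *\<^sub>R v)}"
  then obtain u where r: "r > 0" and u: "J_hol_disc J u" "u ` ball 0 1 \<subseteq> D" "u 0 = p" "frechet_derivative u (at 0) 1 = r *\<^sub>R v"
    by blast
  have Qp: "qnorm m p > 0" by (rule qnorm_pos[OF m p(1)])
  define t where "t = root (4*m) (qnorm m p)"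
  have m4: "4*m > 0" using m by simp
  have t: "t > 0" "t ^ (4*m) = qnorm m p" unfolding t_def using m4 Qp by (auto simp: real_root_pow_pos2)
  have tt: "t \<le> t0"
  proof (rule ccontr)
    assume "\<not> t \<le> t0"
    then have "t0 ^ (4*m) < t ^ (4*m)" using t0 m4 by (intro power_strict_mono) auto
    then show False using p(2) t by simp
  qed
  have n1: "norm (fst p) \<le> t"
  proof (rule power_le_imp_le_base[of _ "4*m - 1"])
    have "Suc (4*m - 1) = 4*m" using m by simp
    then show "norm (fst p) ^ Suc (4*m - 1) \<le> t ^ Suc (4*m - 1)" unfolding t(2) using t(2) by (simp add: qnorm_def)
  qed (use t in auto)
  have n2: "norm (snd p) \<le> t ^ (2*m)"
  proof (rule power2_le_imp_le)
    have "(t ^ (2*m))\<^sup>2 = qnorm m p" unfolding t(2)[symmetric] by (simp flip: power_mult add: mult.commute)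
    then show "(norm (snd p))\<^sup>2 \<le> (t ^ (2*m))\<^sup>2" by (simp add: qnorm_def)
  qed (use t in auto)
  have g: "norm (fst (r *\<^sub>R v)) \<le> K * t" "norm (snd (r *\<^sub>R v)) \<le> K * t ^ (2*m)"
    using grad[OF u(1,2) t(1) tt] n1 n2 u by auto
  have "\<bar>dqnorm m p (r *\<^sub>R v)\<bar> \<le> (4 * real m + 2) * K * qnorm m p"
    by (rule dqnorm_bound[OF m t K g n1 n2])
  also have "\<dots> \<le> K' * qnorm m p" unfolding K' using Qp by (intro mult_right_mono) auto
  finally have "r * \<bar>dqnorm m p v\<bar> \<le> K' * qnorm m p" using r by (simp add: dqnorm_scaleR abs_mult)
  moreover have "K' > 0" unfolding K' using K by (simp add: add_nonneg_pos)
  ultimately have "\<bar>dqnorm m p v\<bar> / (K' * qnorm m p) \<le> 1 / r" using Qp r by (simp add: field_simps)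
  then show "ennreal (\<bar>dqnorm m p v\<bar> / (K' * qnorm m p)) \<le> ennreal (1 / r)" by (rule ennreal_leI)
qed

text \<open>\<open>g'\<close> may be unbounded near the exceptional points. If the integral on the
  right is infinite there is nothing to show; otherwise \<open>g'\<close> is Lebesgue integrable and
  its integral agrees with the gauge integral of the fundamental theorem.\<close>

lemma nn_integral_derivative_ge:
  fixes g g' :: "real \<Rightarrow> real"
  assumes ab: "0 < b" and S: "finite S" and cont: "continuous_on {0..b} g"
    and der: "\<And>t. t \<in> {0<..<b} - S \<Longrightarrow> (g has_vector_derivative g' t) (at t)"
    and cg': "continuous_on ({0<..<b} - S) g'"
  shows "ennreal (g b - g 0) \<le> (\<integral>\<^sup>+ t. ennreal (indicator ({0<..<b} - S) t * \<bar>g' t\<bar>) \<partial>lborel)"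
proof -
  define T where "T = {0<..<b} - S"
  have To: "open T" unfolding T_def by (intro open_Diff finite_imp_closed S) auto
  define k where "k = (\<lambda>t. indicator T t *\<^sub>R g' t)"
  have kb: "k \<in> borel_measurable borel" unfolding k_def
    using borel_measurable_continuous_on_indicator[of T g'] cg' To by (auto simp: T_def)
  have FTC: "(g' has_integral (g b - g 0)) {0..b}"
    by (rule fundamental_theorem_of_calculus_interior_strong[OF S _ _ cont]) (use ab der in auto)
  have nk: "ennreal (norm (k t)) = ennreal (indicator T t * \<bar>g' t\<bar>)" for t by (simp add: k_def indicator_def)
  show ?thesis
  proof (cases "(\<integral>\<^sup>+ t. ennreal (norm (k t)) \<partial>lborel) = \<infinity>")
    case True
    then show ?thesis unfolding nk T_def by simp
  next
    case False
    then have I: "integrable lborel k" using kb by (simp add: integrable_iff_bounded top.not_eq_extremum)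
    have "(k has_integral (\<integral>t. k t \<partial>lborel)) UNIV" by (rule has_integral_integral_lborel[OF I])
    moreover have "(k has_integral (g b - g 0)) UNIV"
    proof -
      have "((\<lambda>t. if t \<in> {0..b} then g' t else 0) has_integral (g b - g 0)) UNIV" using FTC by (simp only: has_integral_restrict_UNIV)
      then show ?thesis
      proof (rule has_integral_spike_finite[rotated 2])
        show "finite (S \<union> {0, b})" using S by simp
        show "k t = (if t \<in> {0..b} then g' t else 0)" if "t \<in> UNIV - (S \<union> {0, b})" for t
          using that by (auto simp: k_def T_def indicator_def)
      qed
    qed
    ultimately have e: "g b - g 0 = (\<integral>t. k t \<partial>lborel)" by (rule has_integral_unique[symmetric])
    have "ennreal (g b - g 0) \<le> ennreal (norm (\<integral>t. k t \<partial>lborel))" unfolding e by (rule ennreal_leI) simp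
    also have "\<dots> \<le> (\<integral>\<^sup>+ t. ennreal (norm (k t)) \<partial>lborel)" by (rule integral_norm_bound_ennreal[OF I])
    finally show ?thesis unfolding nk T_def .
  qed
qed

text \<open>The metric bound is available only below the level \<open>b\<close> of
  \<open>qnorm\<close>, but every path from \<open>p\<close> to \<open>q\<close> reaches that level.
  Integrating up to the first such time bounds the length below by the growth of
  \<open>ln qnorm\<close>.\<close>

lemma kob_dist_lower_bound:
  assumes m: "m \<ge> 1" and K': "K' > 0" and zero: "0 \<notin> D" and b: "0 < b"
    and low: "\<And>p v. p \<in> D \<Longrightarrow> qnorm m p < b \<Longrightarrow> kob_metric J D p v \<ge> ennreal (\<bar>dqnorm m p v\<bar> / (K' * qnorm m p))"
    and p: "qnorm m p < b" and q: "b \<le> qnorm m q"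
  shows "kob_dist J D p q \<ge> ennreal ((ln b - ln (qnorm m p)) / K')"
  unfolding kob_dist_def
proof (rule INF_greatest)
  fix \<gamma> assume "\<gamma> \<in> {\<gamma>. \<gamma> piecewise_C1_differentiable_on {0..1} \<and> \<gamma> 0 = p \<and> \<gamma> 1 = q \<and> \<gamma> ` {0..1} \<subseteq> D}"
  then have \<gamma>: "\<gamma> piecewise_C1_differentiable_on {0..1}" "\<gamma> ` {0..1} \<subseteq> D" "\<gamma> 0 = p" "\<gamma> 1 = q" by auto
  obtain S V where cg: "continuous_on {0..1} \<gamma>" and S: "finite S"
    and V: "\<And>t. t \<in> {0..1} - S \<Longrightarrow> (\<gamma> has_vector_derivative V t) (at t)" "continuous_on ({0..1} - S) V"
    using \<gamma>(1) unfolding piecewise_C1_differentiable_on_def C1_differentiable_on_def by metis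
  have Qc: "continuous_on UNIV (qnorm m)" by (rule has_derivative_continuous_on) (rule qnorm_has_derivative)
  define f where "f = (\<lambda>t. qnorm m (\<gamma> t))"
  have fc: "continuous_on {0..1} f" unfolding f_def by (rule continuous_on_compose2[OF Qc cg]) auto
  have inD: "\<gamma> t \<in> D" if "t \<in> {0..1}" for t using \<gamma>(2) that by blast
  have fpos: "f t > 0" if "t \<in> {0..1}" for t
    unfolding f_def using inD[OF that] zero by (intro qnorm_pos[OF m]) auto
  define T where "T = {t\<in>{0..1}. b \<le> f t}"
  have "closedin (top_of_set {0..1}) T"
    using continuous_closedin_preimage[OF fc, of "{b..}"] unfolding T_def by (simp add: vimage_def Int_def)
  then have Tc: "compact T" using closedin_compact[OF compact_Icc] by blast
  have "1 \<in> T" using q \<gamma> by (simp add: T_def f_def)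
  then obtain t1 where t1: "t1 \<in> T" "\<And>t. t \<in> T \<Longrightarrow> t1 \<le> t" using compact_attains_inf[OF Tc] by blast
  have t1p: "0 < t1" "t1 \<le> 1" "b \<le> f t1"
  proof -
    show "t1 \<le> 1" "b \<le> f t1" using t1(1) by (auto simp: T_def)
    have "0 \<notin> T" using p \<gamma> by (simp add: T_def f_def)
    then have "t1 \<noteq> 0" using t1(1) by blast
    then show "0 < t1" using t1(1) by (simp add: T_def)
  qed
  have below: "f t < b" if "0 \<le> t" "t < t1" for t
    using t1(2)[of t] that t1p unfolding T_def by force
  define g where "g = (\<lambda>t. ln (f t))"
  define g' where "g' = (\<lambda>t. dqnorm m (\<gamma> t) (V t) / f t)"
  have sub: "{0<..<t1} - S \<subseteq> {0..1} - S" "{0..t1} \<subseteq> {0..1}" using t1p by auto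
  have fne: "f t \<noteq> 0" if "t \<in> {0..1}" for t using fpos[OF that] by simp
  have cV: "continuous_on ({0<..<t1} - S) V" by (rule continuous_on_subset[OF V(2) sub(1)])
  have c\<gamma>: "continuous_on ({0<..<t1} - S) \<gamma>" by (rule continuous_on_subset[OF cg]) (use sub in auto)
  have cf: "continuous_on ({0<..<t1} - S) f" by (rule continuous_on_subset[OF fc]) (use sub in auto)
  have cg': "continuous_on ({0<..<t1} - S) g'"
    unfolding g'_def dqnorm_def by (intro continuous_intros cV c\<gamma> cf) (use fne sub in auto)
  have "ennreal (g t1 - g 0) \<le> (\<integral>\<^sup>+ t. ennreal (indicator ({0<..<t1} - S) t * \<bar>g' t\<bar>) \<partial>lborel)"
  proof (rule nn_integral_derivative_ge[OF t1p(1) S])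
    show "continuous_on {0..t1} g" unfolding g_def
      by (intro continuous_on_ln continuous_on_subset[OF fc]) (use t1p fne in auto)
    show "(g has_vector_derivative g' t) (at t)" if t: "t \<in> {0<..<t1} - S" for t
    proof -
      have tI: "t \<in> {0..1}" using t t1p by auto
      have "(\<gamma> has_derivative (\<lambda>h. h *\<^sub>R V t)) (at t)" using V(1) t sub unfolding has_vector_derivative_def by blast
      from has_derivative_compose[OF this qnorm_has_derivative]
      have "(f has_derivative (\<lambda>h. h * dqnorm m (\<gamma> t) (V t))) (at t)" unfolding f_def dqnorm_scaleR .
      then have "(f has_field_derivative dqnorm m (\<gamma> t) (V t)) (at t)"
        unfolding has_field_derivative_def by (rule has_derivative_eq_rhs) (auto simp: mult.commute)
      from DERIV_chain2[OF DERIV_ln[OF fpos[OF tI]] this] show ?thesis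
        unfolding g_def g'_def has_real_derivative_iff_has_vector_derivative[symmetric] by (simp add: divide_inverse mult.commute)
    qed
    show "continuous_on ({0<..<t1} - S) g'" by (rule cg')
  qed
  then have 1: "ennreal (ln b - ln (qnorm m p)) \<le> (\<integral>\<^sup>+ t. ennreal (indicator ({0<..<t1} - S) t * \<bar>g' t\<bar>) \<partial>lborel)"
  proof (rule order_trans[rotated], intro ennreal_leI)
    have "ln b \<le> ln (f t1)" using t1p b by simp
    then show "ln b - ln (qnorm m p) \<le> g t1 - g 0" using \<gamma> by (simp add: g_def f_def)
  qed
  have "ennreal ((ln b - ln (qnorm m p)) / K') = ennreal (1 / K') * ennreal (ln b - ln (qnorm m p))"
    using K' by (simp flip: ennreal_mult')
  also have "\<dots> \<le> ennreal (1 / K') * (\<integral>\<^sup>+ t. ennreal (indicator ({0<..<t1} - S) t * \<bar>g' t\<bar>) \<partial>lborel)"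
    by (intro mult_left_mono 1) auto
  also have "\<dots> = (\<integral>\<^sup>+ t. ennreal (1 / K') * ennreal (indicator ({0<..<t1} - S) t * \<bar>g' t\<bar>) \<partial>lborel)"
  proof (rule nn_integral_cmult[symmetric])
    have "continuous_on ({0<..<t1} - S) (\<lambda>t. \<bar>g' t\<bar>)" by (intro continuous_intros cg')
    moreover have "open ({0<..<t1} - S)" by (intro open_Diff finite_imp_closed S) auto
    ultimately have "(\<lambda>t. indicator ({0<..<t1} - S) t *\<^sub>R \<bar>g' t\<bar>) \<in> borel_measurable borel"
      by (intro borel_measurable_continuous_on_indicator) auto
    then show "(\<lambda>t. ennreal (indicator ({0<..<t1} - S) t * \<bar>g' t\<bar>)) \<in> borel_measurable lborel" by simp
  qed
  \<comment> \<open>Monotonicity of the nonnegative integral holds for arbitrary functions, so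
    measurability of \<open>kob_metric\<close> along the path is not an issue.\<close>
  also have "\<dots> \<le> (\<integral>\<^sup>+ t \<in> {0..1}. kob_metric J D (\<gamma> t) (vector_derivative \<gamma> (at t)) \<partial>lborel)"
  proof (rule nn_integral_mono)
    fix t
    show "ennreal (1 / K') * ennreal (indicator ({0<..<t1} - S) t * \<bar>g' t\<bar>) \<le> kob_metric J D (\<gamma> t) (vector_derivative \<gamma> (at t)) * indicator {0..1} t"
    proof (cases "t \<in> {0<..<t1} - S")
      case True
      then have tI: "t \<in> {0..1}" using sub by auto
      have vd: "vector_derivative \<gamma> (at t) = V t" using V(1) True sub by (intro vector_derivative_at) blast
      have "ennreal (1 / K') * ennreal (indicator ({0<..<t1} - S) t * \<bar>g' t\<bar>) = ennreal (\<bar>dqnorm m (\<gamma> t) (V t)\<bar> / (K' * qnorm m (\<gamma> t)))"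
      proof -
        have "1 / K' * (indicator ({0<..<t1} - S) t * \<bar>g' t\<bar>) = \<bar>dqnorm m (\<gamma> t) (V t)\<bar> / (K' * qnorm m (\<gamma> t))"
          using True fpos[OF tI] by (simp add: g'_def f_def abs_div_pos[symmetric])
        then show ?thesis using K' by (subst ennreal_mult'[symmetric]) auto
      qed
      also have "\<dots> \<le> kob_metric J D (\<gamma> t) (V t)"
        using below[of t] True inD[OF tI] by (intro low) (auto simp: f_def)
      finally show ?thesis using tI by (simp add: vd)
    qed simp
  qed
  finally show "ennreal ((ln b - ln (qnorm m p)) / K') \<le> (\<integral>\<^sup>+ t \<in> {0..1}. kob_metric J D (\<gamma> t) (vector_derivative \<gamma> (at t)) \<partial>lborel)" .
qed

theorem theorem1:
  fixes J :: "c2 \<Rightarrow> c2 \<Rightarrow> c2" and \<rho> :: "c2 \<Rightarrow> real" and D W :: "c2 set"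
    and a1 b1 c1 a2 b2 c2 :: "c2 \<Rightarrow> real" and r :: real and m :: nat and h :: "nat \<Rightarrow> real"
  assumes acs: "almost_complex_structure J"
    and r_pos: "r > 0"
    and coeffs_smooth: "smooth_on (ball 0 r) a1" "smooth_on (ball 0 r) b1" "smooth_on (ball 0 r) c1"
        "smooth_on (ball 0 r) a2" "smooth_on (ball 0 r) b2" "smooth_on (ball 0 r) c2"
    and J_block: "\<forall>p\<in>ball 0 r. \<forall>v1 v2. J p (v1, v2) = (blk a1 b1 c1 p v1, blk a2 b2 c2 p v2)"
    and J_st: "\<exists>C. \<forall>p\<in>ball 0 r.
        \<bar>a1 p\<bar> + \<bar>b1 p + 1\<bar> + \<bar>c1 p - 1\<bar> + \<bar>a2 p\<bar> + \<bar>b2 p + 1\<bar> + \<bar>c2 p - 1\<bar> \<le> C * norm (snd p)"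
    and domain: "open D" "connected D"
    and defining: "open W" "closure D \<subseteq> W" "smooth_on W \<rho>" "D = {p\<in>W. \<rho> p < 0}"
        "\<forall>p\<in>frontier D. frechet_derivative \<rho> (at p) \<noteq> (\<lambda>_. 0)"
    and psh: "\<exists>V. open V \<and> closure D \<subseteq> V \<and> V \<subseteq> W \<and> (\<forall>p\<in>V. \<forall>v. levi_form J \<rho> p v \<ge> 0)"
    and fin: "finite_type J \<rho> D"
    and m: "m \<ge> 1"
    and subh: "\<forall>z. laplacian (hpoly h (2*m)) z \<ge> 0"
    and not_harm: "\<exists>z. laplacian (hpoly h (2*m)) z \<noteq> 0"
    and expansion: "\<exists>C s. s > 0 \<and> ball 0 s \<subseteq> W \<and> (\<forall>p\<in>ball 0 s.
        \<bar>\<rho> p - (Re (snd p) + hpoly h (2*m) (fst p))\<bar>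
          \<le> C * (norm (fst p) ^ (2*m+1) + norm (snd p) * norm (fst p) ^ m + norm (snd p) ^ 2))"
  shows "\<exists>U. open U \<and> 0 \<in> U \<and>
    (\<forall>q\<in>D \<inter> U. \<forall>qs. (\<forall>j. qs j \<in> D) \<and> qs \<longlonglongrightarrow> 0 \<longrightarrow>
        (\<forall>B::real. \<exists>j. kob_dist J D (qs j) q > ennreal B))"
proof -
  have neg: "\<rho> p < 0" if "p \<in> D" for p using that defining(4) by simp
  have expansion': "\<exists>C s. s > 0 \<and> (\<forall>p\<in>ball 0 s.
        \<bar>\<rho> p - (Re (snd p) + hpoly h (2*m) (fst p))\<bar>
          \<le> C * (norm (fst p) ^ (2*m+1) + norm (snd p) * norm (fst p) ^ m + norm (snd p) ^ 2))"
    using expansion by blast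
  obtain t0 K where t0: "t0 > 0" and K: "K \<ge> 0"
    and grad: "\<And>u t. J_hol_disc J u \<Longrightarrow> u ` ball 0 1 \<subseteq> D \<Longrightarrow> 0 < t \<Longrightarrow> t \<le> t0 \<Longrightarrow>
       norm (fst (u 0)) \<le> t \<Longrightarrow> norm (snd (u 0)) \<le> t ^ (2*m) \<Longrightarrow>
       norm (fst (frechet_derivative u (at 0) 1)) \<le> K * t \<and> norm (snd (frechet_derivative u (at 0) 1)) \<le> K * t ^ (2*m)"
    using anisotropic_gradient_bound[OF acs r_pos coeffs_smooth J_block J_st neg m subh not_harm expansion'] by metis
  \<comment> \<open>At the origin the model and the error term of the expansion vanish, so
    \<open>\<rho> 0 = 0\<close>.\<close>
  have zero: "0 \<notin> D"
  proof
    assume "0 \<in> D"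
    then have "\<rho> 0 < 0" by (rule neg)
    moreover have "hpoly h (2*m) 0 = 0" using hpoly_homogeneous[of h "2*m" 0 0] m by (simp add: zero_power)
    moreover obtain C s where "s > 0" "\<forall>p\<in>ball 0 s. \<bar>\<rho> p - (Re (snd p) + hpoly h (2*m) (fst p))\<bar>
          \<le> C * (norm (fst p) ^ (2*m+1) + norm (snd p) * norm (fst p) ^ m + norm (snd p) ^ 2)" using expansion' by blast
    then have "\<bar>\<rho> 0 - (Re (snd (0::c2)) + hpoly h (2*m) (fst (0::c2)))\<bar>
          \<le> C * (norm (fst (0::c2)) ^ (2*m+1) + norm (snd (0::c2)) * norm (fst (0::c2)) ^ m + norm (snd (0::c2)) ^ 2)"
      by (metis centre_in_ball)
    ultimately show False by simp
  qed
  define K' where "K' = (4 * real m + 2) * K + 1"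
  have K': "K' > 0" unfolding K'_def using K by (simp add: add_nonneg_pos)
  have "\<exists>j. kob_dist J D (qs j) q > ennreal B"
    if q: "q \<in> D" and qs: "\<And>j. qs j \<in> D" "qs \<longlonglongrightarrow> 0" for q qs B
  proof -
    have Qq: "qnorm m q > 0" using q zero by (intro qnorm_pos[OF m]) auto
    \<comment> \<open>The gradient bound holds below \<open>t0 ^ (4*m)\<close>, and a level not
      above \<open>qnorm m q\<close> has to be crossed on the way to \<open>q\<close>.\<close>
    define b where "b = min (t0 ^ (4*m)) (qnorm m q)"
    have b: "b > 0" "b \<le> t0 ^ (4*m)" "b \<le> qnorm m q" using t0 Qq by (auto simp: b_def)
    \<comment> \<open>Once \<open>qnorm m (qs j)\<close> is below the second entry, the lower bound
      for the distance exceeds \<open>|B| + 1\<close>.\<close>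
    define X where "X = min b (exp (ln b - K' * (\<bar>B\<bar> + 1)))"
    have X: "X > 0" using b by (simp add: X_def)
    have "isCont (qnorm m) 0" by (rule has_derivative_continuous) (rule qnorm_has_derivative)
    then have "(\<lambda>j. qnorm m (qs j)) \<longlonglongrightarrow> qnorm m 0" using qs(2) isCont_tendsto_compose by blast
    moreover have "qnorm m 0 = 0" using m by (simp add: qnorm_def zero_power)
    ultimately have "\<forall>\<^sub>F j in sequentially. qnorm m (qs j) < X" using X by (simp add: order_tendstoD(2))
    then obtain j where "qnorm m (qs j) < X" by (meson eventually_happens trivial_limit_sequentially)
    then have j: "qnorm m (qs j) < b" "qnorm m (qs j) < exp (ln b - K' * (\<bar>B\<bar> + 1))" by (simp_all add: X_def)
    have Qj: "qnorm m (qs j) > 0" using qs(1)[of j] zero by (intro qnorm_pos[OF m]) auto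
    have "ln (qnorm m (qs j)) < ln b - K' * (\<bar>B\<bar> + 1)" using j(2) Qj by (metis ln_exp ln_less_cancel_iff exp_gt_zero)
    then have "K' * (\<bar>B\<bar> + 1) < ln b - ln (qnorm m (qs j))" by linarith
    then have "\<bar>B\<bar> + 1 < (ln b - ln (qnorm m (qs j))) / K'" using K' by (simp add: pos_less_divide_eq mult.commute)
    then have "ennreal B < ennreal ((ln b - ln (qnorm m (qs j))) / K')" by (intro ennreal_lessI) auto
    also have "\<dots> \<le> kob_dist J D (qs j) q"
    proof (rule kob_dist_lower_bound[OF m K' zero b(1) _ j(1) b(3)])
      fix p v assume "p \<in> D" "qnorm m p < b"
      then show "kob_metric J D p v \<ge> ennreal (\<bar>dqnorm m p v\<bar> / (K' * qnorm m p))"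
        using zero b by (intro kob_metric_lower_bound[OF m t0 K grad _ _ K'_def]) auto
    qed
    finally show ?thesis by blast
  qed
  \<comment> \<open>The point \<open>q\<close> was arbitrary in \<open>D\<close>, so the whole space
    serves as neighbourhood.\<close>
  then show ?thesis by (intro exI[of _ UNIV]) auto
qed

end
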